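(* There is a polynomial-time random-order contention resolution scheme for vertex arrivals which, for every graph $G=(V,E)$ and every fractional matching $\bm{x}$ of $G$, is $\beta$-selectable, where $\beta=\frac{1}{30}(16+5t_0^2-10t_0^3+4t_0^5)\approx 0.535$ and $t_0\approx 0.119$ is the unique root in $(0,1)$ of $4t^6+16t^5+100t^4+180t^3+80t^2-4t-1$.
   Context: Graph $G=(V,E)$; $N(v)$ denotes the neighbours of $v$. A fractional matching is $\bm{x}=(x_e)_{e\in E}\in[0,1]^E$ with $\sum_{e\ni v}x_e\le 1$ for all $v\in V$. Random-order vertex arrival model: independently for each $v\in V$, draw $F_v\in N(v)\cup\{\perp\}$ with $\mathbb{P}[F_v=u]=x_{u,v}$ for $u\in N(v)$ and $\mathbb{P}[F_v=\perp]=1-\sum_{u\in N(v)}x_{u,v}$, and an arrival time $Y_v$ uniform on $[0,1]$, all independent. An edge $(u,v)$ is active if ($F_v=u$ and $Y_u<Y_v$) or ($F_u=v$ and $Y_v<Y_u$). An RCRS knows $G,\bm{x}$, processes vertices in increasing order of arrival, and when $v$ arrives learns which edge (if any) from $v$ to earlier vertices is active; it may irrevocably add that edge to its matching $\mathcal{M}$ if $\mathcal{M}$ remains a matching. It is $\beta$-selectable if $\mathbb{P}[e\in\mathcal{M}]\ge\beta x_e$ for all $e\in E$. *)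

theory Defs
  imports "HOL-Probability.Probability" "HOL-Computational_Algebra.Polynomial"
begin

text \<open>
  Graphs are finite and simple. Since they are handed to an algorithm, their vertices are numbered
  \<open>0, \<dots>, n - 1\<close>; edges are two-element sets of vertices.
\<close>

definition graph :: "nat \<Rightarrow> nat set set \<Rightarrow> bool" where
  "graph n E \<longleftrightarrow> (\<forall>e\<in>E. e \<subseteq> {..<n} \<and> card e = 2)"

definition nbrs :: "nat set set \<Rightarrow> nat \<Rightarrow> nat set" where
  "nbrs E v = {u. {u, v} \<in> E}"

definition fractional_matching :: "nat \<Rightarrow> nat set set \<Rightarrow> (nat set \<Rightarrow> real) \<Rightarrow> bool" where
  "fractional_matching n E x \<longleftrightarrow>
     (\<forall>e\<in>E. 0 \<le> x e \<and> x e \<le> 1) \<and> (\<forall>v<n. (\<Sum>e | e \<in> E \<and> v \<in> e. x e) \<le> 1)"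

definition matching :: "nat set set \<Rightarrow> bool" where
  "matching M \<longleftrightarrow> pairwise disjnt M"


section \<open>The random-order vertex arrival model\<close>

text \<open>The law of \<open>F\<^sub>v\<close>, with \<^const>\<open>None\<close> in the role of \<open>\<bottom>\<close>.\<close>

definition choice_pmf :: "nat set set \<Rightarrow> (nat set \<Rightarrow> real) \<Rightarrow> nat \<Rightarrow> nat option pmf" where
  "choice_pmf E x v = embed_pmf (\<lambda>r. case r of
       None \<Rightarrow> 1 - (\<Sum>u\<in>nbrs E v. x {u, v})
     | Some u \<Rightarrow> (if u \<in> nbrs E v then x {u, v} else 0))"

lemma choice_pmf:
  assumes "graph n E" "fractional_matching n E x" "v < n"
  shows "pmf (choice_pmf E x v) None = 1 - (\<Sum>u\<in>nbrs E v. x {u, v})"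
    and "u \<in> nbrs E v \<Longrightarrow> pmf (choice_pmf E x v) (Some u) = x {u, v}"
proof -
  let ?N = "nbrs E v" and ?S = "\<Sum>u\<in>nbrs E v. x {u, v}"
  define f where "f = (\<lambda>r. case r of None \<Rightarrow> 1 - ?S | Some u \<Rightarrow> (if u \<in> ?N then x {u, v} else 0))"
  have N: "?N \<subseteq> {..<n}"
    using assms(1) by (auto simp: graph_def nbrs_def)
  hence fin: "finite ?N"
    by (rule finite_subset) simp
  have inj: "inj_on (\<lambda>u. {u, v}) ?N"
    by (auto simp: inj_on_def doubleton_eq_iff)
  have img: "(\<lambda>u. {u, v}) ` ?N = {e. e \<in> E \<and> v \<in> e}"
  proof (intro equalityI subsetI)
    fix e assume e: "e \<in> {e. e \<in> E \<and> v \<in> e}"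
    then obtain a b where ab: "e = {a, b}"
      using assms(1) by (auto simp: graph_def card_2_iff)
    have "e = {a, v} \<or> e = {b, v}"
      using e ab by (auto simp: doubleton_eq_iff)
    thus "e \<in> (\<lambda>u. {u, v}) ` ?N"
      using e by (auto simp: nbrs_def)
  qed (auto simp: nbrs_def)
  have "?S = (\<Sum>e | e \<in> E \<and> v \<in> e. x e)"
    unfolding img[symmetric] by (simp add: sum.reindex[OF inj])
  hence S: "?S \<le> 1"
    using assms(2,3) by (simp add: fractional_matching_def)
  have x: "0 \<le> x {u, v}" if "u \<in> ?N" for u
    using that assms(2) by (auto simp: fractional_matching_def nbrs_def)
  have nonneg: "0 \<le> f r" for r
    using S x by (auto simp: f_def split: option.split)
  have "(\<integral>\<^sup>+ r. ennreal (f r) \<partial>count_space UNIV) =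
      (\<integral>\<^sup>+ r. ennreal (f r) \<partial>count_space (insert None (Some ` ?N)))"
    by (rule nn_integral_count_space_eq) (auto simp: f_def split: option.splits if_splits)
  also have "\<dots> = (\<Sum>r\<in>insert None (Some ` ?N). ennreal (f r))"
    using fin by (intro nn_integral_count_space_finite) auto
  also have "\<dots> = ennreal (\<Sum>r\<in>insert None (Some ` ?N). f r)"
    using nonneg by (intro sum_ennreal) auto
  also have "(\<Sum>r\<in>insert None (Some ` ?N). f r) = 1"
    using fin by (simp add: image_iff sum.reindex f_def)
  finally have "pmf (embed_pmf f) r = f r" for r
    by (intro pmf_embed_pmf nonneg) simp
  thus "pmf (choice_pmf E x v) None = 1 - ?S"
    and "u \<in> ?N \<Longrightarrow> pmf (choice_pmf E x v) (Some u) = x {u, v}"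
    unfolding choice_pmf_def f_def by simp_all
qed

abbreviation unif :: "real measure" where
  "unif \<equiv> uniform_measure lborel {0..1}"

text \<open>
  The first two components are \<open>F\<close> and \<open>Y\<close>. The third is the internal randomness of the
  contention resolution scheme: an unlimited supply of independent uniform numbers.
\<close>

definition arrival_space ::
  "nat \<Rightarrow> nat set set \<Rightarrow> (nat set \<Rightarrow> real) \<Rightarrow>
     ((nat \<Rightarrow> nat option) \<times> (nat \<Rightarrow> real) \<times> real stream) measure" where
  "arrival_space n E x =
     (\<Pi>\<^sub>M v\<in>{..<n}. measure_pmf (choice_pmf E x v)) \<Otimes>\<^sub>M (\<Pi>\<^sub>M v\<in>{..<n}. unif) \<Otimes>\<^sub>M stream_space unif"

definition active :: "(nat \<Rightarrow> nat option) \<Rightarrow> (nat \<Rightarrow> real) \<Rightarrow> nat \<Rightarrow> nat \<Rightarrow> bool" where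
  "active F Y u v \<longleftrightarrow> (F v = Some u \<and> Y u < Y v) \<or> (F u = Some v \<and> Y v < Y u)"

definition arrival_order :: "nat \<Rightarrow> (nat \<Rightarrow> real) \<Rightarrow> nat list" where
  "arrival_order n Y = sort_key Y [0..<n]"

text \<open>
  What is learnt at the arrival of \<open>v\<close>: the earlier endpoint of the active edge from \<open>v\<close> to an
  earlier vertex, if there is one. It is unique, because \<open>Y u < Y v\<close> leaves only the first
  alternative of \<^const>\<open>active\<close>.
\<close>

definition revealed ::
  "nat set set \<Rightarrow> (nat \<Rightarrow> nat option) \<Rightarrow> (nat \<Rightarrow> real) \<Rightarrow> nat \<Rightarrow> nat option" where
  "revealed E F Y v =
     (if \<exists>u\<in>nbrs E v. Y u < Y v \<and> active F Y u v
      then Some (THE u. u \<in> nbrs E v \<and> Y u < Y v \<and> active F Y u v) else None)"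


section \<open>Randomised real random access machines\<close>

text \<open>
  Time is measured on a randomised real RAM with unit costs, presented as a structured programming
  language. Memory consists of integer cells and real cells; a cell has an array number, which is
  fixed in the program, and two computed indices. Restrictions that keep the unit cost
  measure honest: natural numbers can be added and subtracted but not multiplied, so that their
  length in bits stays bounded by the input size plus the running time; there is no rounding of
  reals to integers; and the only information about reals that influences control is the
  outcome of comparisons.

  The type parameter \<open>'c\<close> stands for the real constants; the function \<open>constants\<close> collects
  those occurring in a program.
\<close>

datatype iexp =
    IConst nat
  | ICell nat iexp iexp
  | IAdd iexp iexp
  | ISub iexp iexp

datatype 'c rexp =
    RConst 'c
  | RCell nat iexp iexp
  | ROfNat iexp
  | RAdd "'c rexp" "'c rexp"
  | RSub "'c rexp" "'c rexp"
  | RMult "'c rexp" "'c rexp"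
  | RDiv "'c rexp" "'c rexp"

datatype 'c bexp =
    ILess iexp iexp
  | RLess "'c rexp" "'c rexp"
  | BNot "'c bexp"
  | BAnd "'c bexp" "'c bexp"

datatype (constants: 'c) com =
    ISet nat iexp iexp iexp
  | RSet nat iexp iexp "'c rexp"
  | Draw nat iexp iexp
  | Seq "'c com" "'c com"
  | Cond "'c bexp" "'c com" "'c com"
  | Loop "'c bexp" "'c com"

record mstate =
  imem :: "nat \<Rightarrow> nat \<Rightarrow> nat \<Rightarrow> nat"
  rmem :: "nat \<Rightarrow> nat \<Rightarrow> nat \<Rightarrow> real"
  rand :: "real stream"

definition upd :: "(nat \<Rightarrow> nat \<Rightarrow> nat \<Rightarrow> 'b) \<Rightarrow> nat \<Rightarrow> nat \<Rightarrow> nat \<Rightarrow> 'b \<Rightarrow> nat \<Rightarrow> nat \<Rightarrow> nat \<Rightarrow> 'b" where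
  "upd m a i j z = m(a := (m a)(i := (m a i)(j := z)))"

primrec ival :: "iexp \<Rightarrow> mstate \<Rightarrow> nat" where
  "ival (IConst k) s = k"
| "ival (ICell a i j) s = imem s a (ival i s) (ival j s)"
| "ival (IAdd d e) s = ival d s + ival e s"
| "ival (ISub d e) s = ival d s - ival e s"

primrec rval :: "real rexp \<Rightarrow> mstate \<Rightarrow> real" where
  "rval (RConst c) s = c"
| "rval (RCell a i j) s = rmem s a (ival i s) (ival j s)"
| "rval (ROfNat e) s = real (ival e s)"
| "rval (RAdd d e) s = rval d s + rval e s"
| "rval (RSub d e) s = rval d s - rval e s"
| "rval (RMult d e) s = rval d s * rval e s"
| "rval (RDiv d e) s = rval d s / rval e s"

primrec bval :: "real bexp \<Rightarrow> mstate \<Rightarrow> bool" where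
  "bval (ILess d e) s \<longleftrightarrow> ival d s < ival e s"
| "bval (RLess d e) s \<longleftrightarrow> rval d s < rval e s"
| "bval (BNot b) s \<longleftrightarrow> \<not> bval b s"
| "bval (BAnd b b') s \<longleftrightarrow> bval b s \<and> bval b' s"

text \<open>
  \<open>exec c s t s'\<close>: started in \<open>s\<close>, the program \<open>c\<close> halts in \<open>s'\<close> after \<open>t\<close> steps. Expressions are
  not charged for, since their size is fixed by the program.
\<close>

inductive exec :: "real com \<Rightarrow> mstate \<Rightarrow> nat \<Rightarrow> mstate \<Rightarrow> bool" where
  ISet: "exec (ISet a i j e) s 1 (s\<lparr>imem := upd (imem s) a (ival i s) (ival j s) (ival e s)\<rparr>)"
| RSet: "exec (RSet a i j e) s 1 (s\<lparr>rmem := upd (rmem s) a (ival i s) (ival j s) (rval e s)\<rparr>)"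
| Draw: "exec (Draw a i j) s 1
           (s\<lparr>rmem := upd (rmem s) a (ival i s) (ival j s) (shd (rand s)), rand := stl (rand s)\<rparr>)"
| Seq: "exec c s t s' \<Longrightarrow> exec d s' t' s'' \<Longrightarrow> exec (Seq c d) s (t + t') s''"
| CondTrue: "bval b s \<Longrightarrow> exec c s t s' \<Longrightarrow> exec (Cond b c d) s (Suc t) s'"
| CondFalse: "\<not> bval b s \<Longrightarrow> exec d s t s' \<Longrightarrow> exec (Cond b c d) s (Suc t) s'"
| LoopFalse: "\<not> bval b s \<Longrightarrow> exec (Loop b c) s 1 s"
| LoopTrue: "bval b s \<Longrightarrow> exec c s t s' \<Longrightarrow> exec (Loop b c) s' t' s'' \<Longrightarrow>
    exec (Loop b c) s (Suc (t + t')) s''"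

inductive_cases exec_ISetE: "exec (ISet a i j e) s t s'"
inductive_cases exec_RSetE: "exec (RSet a i j e) s t s'"
inductive_cases exec_DrawE: "exec (Draw a i j) s t s'"
inductive_cases exec_SeqE: "exec (Seq c d) s t s'"
inductive_cases exec_CondE: "exec (Cond b c d) s t s'"
inductive_cases exec_LoopE: "exec (Loop b c) s t s'"

lemma exec_deterministic:
  "exec c s t s' \<Longrightarrow> exec c s u s'' \<Longrightarrow> t = u \<and> s' = s''"
proof (induction arbitrary: u s'' rule: exec.induct)
  case (Seq c s t s' d t' s1)
  from Seq.prems show ?case by (rule exec_SeqE) (use Seq.IH in metis)
next
  case (CondTrue b s c t s' d)
  from CondTrue.prems show ?case by (rule exec_CondE) (use CondTrue in metis)+
next
  case (CondFalse b s d t s' c)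
  from CondFalse.prems show ?case by (rule exec_CondE) (use CondFalse in metis)+
next
  case (LoopTrue b s c t s' t' s1)
  from LoopTrue.prems show ?case by (rule exec_LoopE) (use LoopTrue in metis)+
next
  case (LoopFalse b s c)
  from LoopFalse.prems show ?case by (rule exec_LoopE) (use LoopFalse in simp_all)
qed (erule exec_ISetE exec_RSetE exec_DrawE, simp)+

definition final :: "real com \<Rightarrow> mstate \<Rightarrow> mstate" where
  "final c s = (THE s'. \<exists>t. exec c s t s')"

definition halts_within :: "real com \<Rightarrow> mstate \<Rightarrow> nat \<Rightarrow> bool" where
  "halts_within c s k \<longleftrightarrow> (\<exists>t\<le>k. \<exists>s'. exec c s t s')"


section \<open>Contention resolution schemes given by programs\<close>

text \<open>
  Before the first arrival the memory holds \<open>n\<close>, the adjacency matrix and the matrix of the \<open>x\<^sub>e\<close>;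
  all other cells are zero.
\<close>

definition init :: "nat \<Rightarrow> nat set set \<Rightarrow> (nat set \<Rightarrow> real) \<Rightarrow> real stream \<Rightarrow> mstate" where
  "init n E x \<omega> = \<lparr>
     imem = (\<lambda>a i j. if a = 0 \<and> i = 0 \<and> j = 0 then n
                     else if a = 1 \<and> {i, j} \<in> E then 1 else 0),
     rmem = (\<lambda>a i j. if a = 0 \<and> {i, j} \<in> E then x {i, j} else 0),
     rand = \<omega>\<rparr>"

text \<open>
  On each arrival the program is run once, on the memory left by its previous run. Its input is the
  arriving vertex, what is revealed (\<open>0\<close> for no active edge, \<open>Suc u\<close> for the edge to \<open>u\<close>), and
  the arrival time; it accepts the edge by leaving a nonzero number in the cell \<open>(3, 0, 0)\<close>.
\<close>

definition feed :: "nat \<Rightarrow> nat option \<Rightarrow> real \<Rightarrow> mstate \<Rightarrow> mstate" where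
  "feed v r y s = s\<lparr>
     imem := upd (upd (upd (imem s) 2 0 0 v) 2 0 1 (case r of None \<Rightarrow> 0 | Some u \<Rightarrow> Suc u)) 3 0 0 0,
     rmem := upd (rmem s) 1 0 0 y\<rparr>"

definition accepts :: "mstate \<Rightarrow> bool" where
  "accepts s \<longleftrightarrow> imem s 3 0 0 \<noteq> 0"

definition try_add :: "nat set \<Rightarrow> nat set set \<Rightarrow> nat set set" where
  "try_add e M = (if matching (insert e M) then insert e M else M)"

definition fed_state ::
  "nat set set \<Rightarrow> (nat \<Rightarrow> nat option) \<Rightarrow> (nat \<Rightarrow> real) \<Rightarrow> nat \<Rightarrow> mstate \<Rightarrow> mstate" where
  "fed_state E F Y v s = feed v (revealed E F Y v) (Y v) s"

text \<open>The memory and the matching after the first \<open>i\<close> arrivals.\<close>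

primrec play ::
  "real com \<Rightarrow> nat \<Rightarrow> nat set set \<Rightarrow> (nat set \<Rightarrow> real) \<Rightarrow>
     (nat \<Rightarrow> nat option) \<times> (nat \<Rightarrow> real) \<times> real stream \<Rightarrow> nat \<Rightarrow> mstate \<times> nat set set" where
  "play c n E x \<xi> 0 = (case \<xi> of (F, Y, \<omega>) \<Rightarrow> (init n E x \<omega>, {}))"
| "play c n E x \<xi> (Suc i) = (case \<xi> of (F, Y, \<omega>) \<Rightarrow> (case play c n E x \<xi> i of (s, M) \<Rightarrow>
     let v = arrival_order n Y ! i; s' = final c (fed_state E F Y v s)
     in (s', case revealed E F Y v of
               None \<Rightarrow> M
             | Some u \<Rightarrow> if accepts s' then try_add {u, v} M else M)))"

definition rcrs_matching ::
  "real com \<Rightarrow> nat \<Rightarrow> nat set set \<Rightarrow> (nat set \<Rightarrow> real) \<Rightarrow>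
     (nat \<Rightarrow> nat option) \<times> (nat \<Rightarrow> real) \<times> real stream \<Rightarrow> nat set set" where
  "rcrs_matching c n E x \<xi> = snd (play c n E x \<xi> n)"

definition selectable ::
  "real com \<Rightarrow> nat \<Rightarrow> nat set set \<Rightarrow> (nat set \<Rightarrow> real) \<Rightarrow> real \<Rightarrow> bool" where
  "selectable c n E x \<beta> \<longleftrightarrow>
     (\<forall>e\<in>E. measure (arrival_space n E x)
        {\<xi> \<in> space (arrival_space n E x). e \<in> rcrs_matching c n E x \<xi>} \<ge> \<beta> * x e)"

text \<open>
  Worst-case polynomial time: on all inputs and for all outcomes of \<open>F\<close>, \<open>Y\<close> and the internal
  randomness, each of the \<open>n\<close> arrivals is processed within \<open>p(n)\<close> steps, whatever the reals \<open>x\<^sub>e\<close>.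
  Constants are restricted to algebraic numbers because the digits of an arbitrary real constant
  could encode nonuniform advice.
\<close>

definition polynomial_time :: "real com \<Rightarrow> bool" where
  "polynomial_time c \<longleftrightarrow> (\<forall>a\<in>constants c. algebraic a) \<and>
     (\<exists>p :: nat poly. \<forall>n E x F Y \<omega>.
        graph n E \<longrightarrow> fractional_matching n E x \<longrightarrow>
        (\<forall>v<n. F v \<in> insert None (Some ` nbrs E v)) \<longrightarrow> (\<forall>v<n. Y v \<in> {0..1}) \<longrightarrow>
        sset \<omega> \<subseteq> {0..1} \<longrightarrow>
        (\<forall>i<n. halts_within c
           (fed_state E F Y (arrival_order n Y ! i) (fst (play c n E x (F, Y, \<omega>) i)))
           (poly p n)))"


section \<open>The selectability constant\<close>

definition q_poly :: "real \<Rightarrow> real" where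
  "q_poly t = 4 * t^6 + 16 * t^5 + 100 * t^4 + 180 * t^3 + 80 * t^2 - 4 * t - 1"

definition t\<^sub>0 :: real where
  "t\<^sub>0 = (THE t. 0 < t \<and> t < 1 \<and> q_poly t = 0)"

definition \<beta>\<^sub>0 :: real where
  "\<beta>\<^sub>0 = 1 / 30 * (16 + 5 * t\<^sub>0^2 - 10 * t\<^sub>0^3 + 4 * t\<^sub>0^5)"

end

theory Submission
  imports Defs
begin

text \<open>
  Each vertex \<open>w\<close> carries a coin. When \<open>w\<close> arrives and the edge to \<open>u\<close> is revealed, the edge is taken
  if \<open>u\<close> is still free and the coin of \<open>w\<close> falls below \<open>att m (Y w)\<close>, where
  \<open>m = (deg u + deg w) / 2 - x\<^sub>u\<^sub>w\<close> is the average fractional degree of the two endpoints towards other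
  vertices. Thinning edges with small \<open>m\<close> helps the edges they compete with.

  Let \<open>\<phi> S u y\<close> be the probability, in the process restricted to the vertex set \<open>S\<close>, that \<open>u\<close>
  arrives before time \<open>y\<close> and is free just before \<open>y\<close>. The vertex whose arrival completes an edge
  influences nothing earlier, so it can be deleted, whence the exact recursion
  \<open>\<phi> S u y = y - \<Sum>w\<in>S - {u}. X u w * \<integral>\<^sub>0\<^sup>y att m\<^sub>u\<^sub>w s * (\<phi> (S - {w}) u s + \<phi> (S - {u}) w s) ds\<close>.
  Feeding the trivial bound \<open>\<phi> S u y \<le> y\<close> into the recursion gives a lower bound for \<open>\<phi>\<close>, that one an
  upper bound, and so on. After two rounds of polynomial bounds, a final round shows that an edge \<open>e\<close>
  is selected with probability at least \<open>669/1250 * x\<^sub>e\<close>, and \<open>\<beta>\<^sub>0 < 669/1250 = 0.5352\<close>.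
\<close>


section \<open>The attenuation function\<close>

text \<open>The recursion is antitone in \<phi>, which is why lower and upper bounds alternate. The
  obstacle is that it does not close: it couples all pairs of a vertex set and a vertex, and the
  rates refer to the full graph while \<open>S\<close> shrinks. Each round therefore seeks a bound
  that sees \<open>S\<close> only through the remaining fractional degree of \<open>u\<close>. This
  dictates the choice of \<open>m\<close>: in the bracket each endpoint has lost the other one, so
  the two remaining degrees add up to at most \<open>2 * m\<close>, and bounds linear in the degree
  control the bracket by \<open>m\<close> alone. The rate has to meet opposite demands: small enough
  to pay for the degree lost by deleting \<open>w\<close> (\<open>att_con\<^sub>0\<close>), large
  enough that the upper bounds fall well below \<open>y\<close> (\<open>att_low\<^sub>0\<close>,
  \<open>att_low\<^sub>1\<close>). The final estimate is tightest at \<open>m = 1\<close>, the limit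
  of an edge of weight zero between two saturated endpoints. No thinning takes place there and the
  bound is \<open>1 - 2 * 0.2323 = 0.5354\<close>, so that \<open>669/1250\<close> leaves a slack of
  \<open>1/5000\<close>.\<close>

definition fade\<^sub>1 :: "real \<Rightarrow> real" where
  "fade\<^sub>1 s = 6/5 * s - 3/4 * s^2"

definition fade\<^sub>2 :: "real \<Rightarrow> real" where
  "fade\<^sub>2 s = s - 4/5 * s^2"

text \<open>The factor \<open>1 - m\<close> switches thinning off at \<open>m = 1\<close>; at
  \<open>m = 0\<close> the rate is \<open>1 - fade\<^sub>1 s\<close>. Being quadratic in
  \<open>m\<close> with coefficients polynomial in \<open>s\<close>, it keeps all later estimates
  polynomial.\<close>

definition att :: "real \<Rightarrow> real \<Rightarrow> real" where
  "att m s = 1 - (1 - m) * (fade\<^sub>1 s + m * fade\<^sub>2 s)"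

text \<open>
  \<open>low\<^sub>i\<close> minorises, uniformly in \<open>m\<close>, the integrand obtained from the \<open>i\<close>-th lower bound on \<open>\<phi>\<close>, and
  \<open>con\<^sub>i y = 2 * \<integral>\<^sub>0\<^sup>y low\<^sub>i\<close> is the resulting upper bound \<open>\<phi> S u y \<le> y - deg u * con\<^sub>i y\<close>. The coefficients
  here and in \<open>fade\<^sub>i\<close> were found by numerical optimisation.
\<close>

definition low\<^sub>0 :: "real \<Rightarrow> real" where
  "low\<^sub>0 s = s * (1 - s) * (1 - 2/5 * s)"

definition con\<^sub>0 :: "real \<Rightarrow> real" where
  "con\<^sub>0 s = s^2 - 14/15 * s^3 + 1/5 * s^4"

definition con\<^sub>0_int :: "real \<Rightarrow> real" where
  "con\<^sub>0_int s = 1/3 * s^3 - 7/30 * s^4 + 1/25 * s^5"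

definition low\<^sub>1 :: "real \<Rightarrow> real" where
  "low\<^sub>1 s = s - 143/100 * s^2 + 3/2 * s^3 - s^4"

definition con\<^sub>1 :: "real \<Rightarrow> real" where
  "con\<^sub>1 s = s^2 - 143/150 * s^3 + 3/4 * s^4 - 2/5 * s^5"

text \<open>These bounds make the three coefficients of \<open>att\<close> as a polynomial in
  \<open>m\<close> nonnegative (see \<open>att_expand\<close>). Hence the rate increases with
  \<open>m\<close>, starting from a nonnegative value at \<open>m = 0\<close>.\<close>

lemma fade_bounds:
  assumes "0 \<le> s" "s \<le> 1"
  shows "0 \<le> fade\<^sub>2 s" "fade\<^sub>2 s \<le> fade\<^sub>1 s" "fade\<^sub>1 s + fade\<^sub>2 s \<le> 1"
proof -
  have "fade\<^sub>2 s = s * (1 - 4/5 * s)"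
    by (simp add: fade\<^sub>2_def algebra_simps power2_eq_square)
  thus "0 \<le> fade\<^sub>2 s" using assms by simp
  have "fade\<^sub>1 s - fade\<^sub>2 s = s / 5 + s^2 / 20"
    by (simp add: fade\<^sub>1_def fade\<^sub>2_def algebra_simps)
  thus "fade\<^sub>2 s \<le> fade\<^sub>1 s"
    using assms by (smt (verit) divide_nonneg_nonneg zero_le_power)
  have "1 - (fade\<^sub>1 s + fade\<^sub>2 s) = 31/20 * (s - 22/31)^2 + 34/155"
    unfolding fade\<^sub>1_def fade\<^sub>2_def by algebra
  thus "fade\<^sub>1 s + fade\<^sub>2 s \<le> 1"
    by (smt (verit) zero_le_power2 mult_nonneg_nonneg divide_nonneg_nonneg)
qed

lemma att_expand: "att m s = (1 - fade\<^sub>1 s) + m * (fade\<^sub>1 s - fade\<^sub>2 s) + m^2 * fade\<^sub>2 s"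
  by (simp add: att_def algebra_simps power2_eq_square)

lemma att_mono:
  assumes "0 \<le> s" "s \<le> 1" "0 \<le> m" "m \<le> m'"
  shows "att m s \<le> att m' s"
  unfolding att_expand using fade_bounds[OF assms(1,2)] assms(3,4)
  by (intro add_mono mult_right_mono power_mono) auto

lemma att_bounds:
  assumes "0 \<le> s" "s \<le> 1" "0 \<le> m" "m \<le> 1"
  shows "0 \<le> att m s" "att m s \<le> 1"
proof -
  have "0 \<le> att 0 s"
    using fade_bounds[OF assms(1,2)] by (simp add: att_def)
  also have "\<dots> \<le> att m s" using assms by (intro att_mono) auto
  finally show "0 \<le> att m s" .
  have "att m s \<le> att 1 s" using assms by (intro att_mono) auto
  thus "att m s \<le> 1" by (simp add: att_def)
qed

lemma continuous_on_att [continuous_intros]: "continuous_on A (att m)"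
  unfolding att_def fade\<^sub>1_def fade\<^sub>2_def by (intro continuous_intros)

lemma has_integral_from_0:
  fixes F f :: "real \<Rightarrow> real"
  assumes "0 \<le> y" "\<And>s. (F has_real_derivative f s) (at s)" "F 0 = 0"
  shows "(f has_integral F y) {0..y}"
  using fundamental_theorem_of_calculus[of 0 y F f] assms
  by (auto simp: has_real_derivative_iff_has_vector_derivative intro: has_vector_derivative_at_within)

lemma low\<^sub>0_has_integral: "0 \<le> y \<Longrightarrow> ((\<lambda>s. 2 * low\<^sub>0 s) has_integral con\<^sub>0 y) {0..y}"
  unfolding low\<^sub>0_def con\<^sub>0_def
  by (rule has_integral_from_0)
     (auto intro!: derivative_eq_intros simp: field_simps eval_nat_numeral)

lemma con\<^sub>0_has_integral: "0 \<le> y \<Longrightarrow> (con\<^sub>0 has_integral con\<^sub>0_int y) {0..y}"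
  unfolding con\<^sub>0_int_def con\<^sub>0_def
  by (rule has_integral_from_0)
     (auto intro!: derivative_eq_intros simp: field_simps eval_nat_numeral)

lemma low\<^sub>1_has_integral: "0 \<le> y \<Longrightarrow> ((\<lambda>s. 2 * low\<^sub>1 s) has_integral con\<^sub>1 y) {0..y}"
  unfolding low\<^sub>1_def con\<^sub>1_def
  by (rule has_integral_from_0)
     (auto intro!: derivative_eq_intros simp: field_simps eval_nat_numeral)

lemma con\<^sub>0_nonneg: assumes "0 \<le> s" "s \<le> 1" shows "0 \<le> con\<^sub>0 s"
proof -
  have "con\<^sub>0 s = s^2 * ((1 - s) + s * (1/15 + 1/5 * s))"
    unfolding con\<^sub>0_def by algebra
  thus ?thesis using assms by simp
qed

lemma con\<^sub>1_nonneg: assumes "0 \<le> s" "s \<le> 1" shows "0 \<le> con\<^sub>1 s"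
proof -
  have "con\<^sub>1 s = s^2 * ((1 - s) + s * (7/150) + s^2 * ((1 - s) * (2/5) + 7/20))"
    unfolding con\<^sub>1_def by algebra
  thus ?thesis using assms by simp
qed

text \<open>The second bound makes \<open>s - d * s^2 + d^2 * con\<^sub>0_int s\<close> decreasing
  in \<open>d\<close> for \<open>0 \<le> d \<le> 1\<close>. This is the monotonicity in the degree
  that \<open>\<phi>_upper\<^sub>1\<close> relies on.\<close>

lemma con\<^sub>0_int_bounds: assumes "0 \<le> s" "s \<le> 1" shows "0 \<le> con\<^sub>0_int s" "2 * con\<^sub>0_int s \<le> s^2"
proof -
  have "con\<^sub>0_int s = s^3 * ((1 - s) * (1/3) + s * (1/10) + s^2 * (1/25))"
    unfolding con\<^sub>0_int_def by algebra
  thus "0 \<le> con\<^sub>0_int s" using assms by simp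
  have "s^2 - 2 * con\<^sub>0_int s = s^2 * ((1 - s) * (2/3) + 1/3 * (1 - s^3) + s^2 * (7/15) + 19/75 * s^3)"
    unfolding con\<^sub>0_int_def by algebra
  moreover have "s^3 \<le> 1" using assms by (simp add: power_le_one)
  ultimately show "2 * con\<^sub>0_int s \<le> s^2" using assms
    by (smt (verit) mult_nonneg_nonneg zero_le_power divide_nonneg_nonneg)
qed

text \<open>Thinning pays for the deletion of a neighbour of weight \<open>x\<close>. The deletion
  costs \<open>x * con\<^sub>0 s\<close>, the rate \<open>att (1 - x)\<close> saves a multiple of
  \<open>x\<close> as well, and after removing the common \<open>x\<close> the worst case
  \<open>m - x = 1\<close> is the inequality
  \<open>con\<^sub>0 s \<le> fade\<^sub>1 s * (2 * s - con\<^sub>0 s)\<close> in one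
  variable.\<close>

lemma att_con\<^sub>0:
  assumes "0 \<le> s" "s \<le> 1" "0 \<le> x" "x \<le> m" "m \<le> 1"
  shows "att (1 - x) s * (2 * s - (m - x) * con\<^sub>0 s) \<le> 2 * s - m * con\<^sub>0 s"
proof -
  have c: "0 \<le> con\<^sub>0 s" using con\<^sub>0_nonneg assms by simp
  have "fade\<^sub>1 s * (2 * s - con\<^sub>0 s) - con\<^sub>0 s =
      s^2 * (7/5 * (1 - 53/84 * s)^2 + s^2 * ((1 - s) * (47/50) + 4351/25200) + 3/20 * s^4)"
    unfolding fade\<^sub>1_def con\<^sub>0_def by algebra
  moreover have "0 \<le> \<dots>"
    using assms by (intro mult_nonneg_nonneg add_nonneg_nonneg zero_le_power) simp_all
  ultimately have 1: "con\<^sub>0 s \<le> fade\<^sub>1 s * (2 * s - con\<^sub>0 s)" by linarith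
  note fade = fade_bounds[OF assms(1,2)]
  have "con\<^sub>0 s \<le> s * 1"
  proof -
    have "s * 1 - con\<^sub>0 s = s * ((1 - s) + s * (s * (1 - s) * (1/5) + s * (11/15)))"
      unfolding con\<^sub>0_def by algebra
    moreover have "0 \<le> \<dots>" using assms by simp
    ultimately show ?thesis by linarith
  qed
  moreover have "(m - x) * con\<^sub>0 s \<le> 1 * con\<^sub>0 s"
    using assms c by (intro mult_right_mono) auto
  ultimately have "0 \<le> 2 * s - con\<^sub>0 s" "2 * s - con\<^sub>0 s \<le> 2 * s - (m - x) * con\<^sub>0 s"
    using assms by auto
  hence "con\<^sub>0 s \<le> (fade\<^sub>1 s + (1 - x) * fade\<^sub>2 s) * (2 * s - (m - x) * con\<^sub>0 s)"
    using 1 fade assms by (smt (verit) mult_mono mult_nonneg_nonneg)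
  hence "x * con\<^sub>0 s \<le> x * ((fade\<^sub>1 s + (1 - x) * fade\<^sub>2 s) * (2 * s - (m - x) * con\<^sub>0 s))"
    using assms by (intro mult_left_mono)
  thus ?thesis by (simp add: att_def algebra_simps)
qed

text \<open>
  The polynomial inequalities in \<open>m\<close> and \<open>s\<close> are certified by their Bernstein expansions on
  rectangles: all coefficients are nonnegative.
\<close>

lemma att_low\<^sub>0:
  assumes "0 \<le> s" "s \<le> 1" "0 \<le> m" "m \<le> 1"
  shows "low\<^sub>0 s \<le> att m s * (s - m * s^2)"
proof -
  \<comment> \<open>Both sides agree with \<open>s\<close> up to order \<open>s^2\<close>, so
    \<open>s^2\<close> factors out of the difference. What remains has degree 3 in \<open>m\<close>
    and 2 in \<open>s\<close>.\<close>
  consider "0 \<le> m" "m \<le> 3/10" "0 \<le> s" "s \<le> 1"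
    | "3/10 \<le> m" "m \<le> 1" "0 \<le> s" "s \<le> 1"
    using assms by linarith
  thus ?thesis
  proof cases
    case 1
    have "att m s * (s - m * s^2) - low\<^sub>0 s = s^2 *
      (200/27 * (3/10 - m)^3 * (1 - s)^2
      + 250/9 * (3/10 - m)^3 * s * (1 - s)
      + 550/27 * (3/10 - m)^3 * s^2
      + 40/3 * m * (3/10 - m)^2 * (1 - s)^2
      + 715/9 * m * (3/10 - m)^2 * s * (1 - s)
      + 520/9 * m * (3/10 - m)^2 * s^2
      + 70/9 * m^2 * (3/10 - m) * (1 - s)^2
      + 710/9 * m^2 * (3/10 - m) * s * (1 - s)
      + 977/18 * m^2 * (3/10 - m) * s^2
      + 50/27 * m^3 * (1 - s)^2
      + 236/9 * m^3 * s * (1 - s)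
      + 4501/270 * m^3 * s^2)"
      unfolding att_def fade\<^sub>1_def fade\<^sub>2_def low\<^sub>0_def by algebra
    moreover have "0 \<le> \<dots>"
      using 1 assms by (intro mult_nonneg_nonneg add_nonneg_nonneg zero_le_power) simp_all
    ultimately show ?thesis by linarith
  next
    case 2
    \<comment> \<open>The coefficient at the corner \<open>m = s = 1\<close> vanishes, since both
      sides are 0 there. This is the origin of the factor \<open>1 - s\<close> of
      \<open>low\<^sub>0\<close>.\<close>
    have "att m s * (s - m * s^2) - low\<^sub>0 s = s^2 *
      (50/343 * (1 - m)^3 * (1 - s)^2
      + 708/343 * (1 - m)^3 * s * (1 - s)
      + 643/490 * (1 - m)^3 * s^2
      + 10/343 * (m - 3/10) * (1 - m)^2 * (1 - s)^2
      + 2110/343 * (m - 3/10) * (1 - m)^2 * s * (1 - s)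
      + 309/98 * (m - 3/10) * (1 - m)^2 * s^2
      + 360/343 * (m - 3/10)^2 * (1 - m) * (1 - s)^2
      + 2145/343 * (m - 3/10)^2 * (1 - m) * s * (1 - s)
      + 100/49 * (m - 3/10)^2 * (1 - m) * s^2
      + 400/343 * (m - 3/10)^3 * (1 - s)^2
      + 400/343 * (m - 3/10)^3 * s * (1 - s))"
      unfolding att_def fade\<^sub>1_def fade\<^sub>2_def low\<^sub>0_def by algebra
    moreover have "0 \<le> \<dots>"
      using 2 assms by (intro mult_nonneg_nonneg add_nonneg_nonneg zero_le_power) simp_all
    ultimately show ?thesis by linarith
  qed
qed

lemma att_low\<^sub>1:
  assumes "0 \<le> s" "s \<le> 1" "0 \<le> m" "m \<le> 1"
  shows "low\<^sub>1 s \<le> att m s * (s - m * s^2 + m^2 * con\<^sub>0_int s)"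
proof -
  \<comment> \<open>Again \<open>s^2\<close> factors out. The quotient has degree 4 in
    \<open>m\<close> and 5 in \<open>s\<close>, hence 30 coefficients on each rectangle.\<close>
  consider "0 \<le> m" "m \<le> 2/5" "0 \<le> s" "s \<le> 3/10"
    | "0 \<le> m" "m \<le> 2/5" "3/10 \<le> s" "s \<le> 1"
    | "2/5 \<le> m" "m \<le> 1" "0 \<le> s" "s \<le> 3/10"
    | "2/5 \<le> m" "m \<le> 1" "3/10 \<le> s" "s \<le> 7/10"
    | "2/5 \<le> m" "m \<le> 1" "7/10 \<le> s" "s \<le> 1"
    using assms by linarith
  thus ?thesis
  proof cases
    case 1
    have "att m s * (s - m * s^2 + m^2 * con\<^sub>0_int s) - low\<^sub>1 s = s^2 *
      (1796875/486 * (2/5 - m)^4 * (3/10 - s)^5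
      + 14453125/972 * (2/5 - m)^4 * s * (3/10 - s)^4
      + 11640625/486 * (2/5 - m)^4 * s^2 * (3/10 - s)^3
      + 4765625/243 * (2/5 - m)^4 * s^3 * (3/10 - s)^2
      + 2031250/243 * (2/5 - m)^4 * s^4 * (3/10 - s)
      + 1484375/972 * (2/5 - m)^4 * s^5
      + 781250/81 * m * (2/5 - m)^3 * (3/10 - s)^5
      + 1953125/54 * m * (2/5 - m)^3 * s * (3/10 - s)^4
      + 17359375/324 * m * (2/5 - m)^3 * s^2 * (3/10 - s)^3
      + 13015625/324 * m * (2/5 - m)^3 * s^3 * (3/10 - s)^2
      + 578125/36 * m * (2/5 - m)^3 * s^4 * (3/10 - s)
      + 953125/324 * m * (2/5 - m)^3 * s^5
      + 2265625/243 * m^2 * (2/5 - m)^2 * (3/10 - s)^5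
      + 2562500/81 * m^2 * (2/5 - m)^2 * s * (3/10 - s)^4
      + 39393125/972 * m^2 * (2/5 - m)^2 * s^2 * (3/10 - s)^3
      + 12171425/486 * m^2 * (2/5 - m)^2 * s^3 * (3/10 - s)^2
      + 1213231/144 * m^2 * (2/5 - m)^2 * s^4 * (3/10 - s)
      + 3104533/1944 * m^2 * (2/5 - m)^2 * s^5
      + 1093750/243 * m^3 * (2/5 - m) * (3/10 - s)^5
      + 6771875/486 * m^3 * (2/5 - m) * s * (3/10 - s)^4
      + 4851625/324 * m^3 * (2/5 - m) * s^2 * (3/10 - s)^3
      + 6228265/972 * m^3 * (2/5 - m) * s^3 * (3/10 - s)^2
      + 5414219/4860 * m^3 * (2/5 - m) * s^4 * (3/10 - s)
      + 2008943/8100 * m^3 * (2/5 - m) * s^5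
      + 546875/486 * m^4 * (3/10 - s)^5
      + 1165625/324 * m^4 * s * (3/10 - s)^4
      + 3970625/972 * m^4 * s^2 * (3/10 - s)^3
      + 950195/486 * m^4 * s^3 * (3/10 - s)^2
      + 897431/2160 * m^4 * s^4 * (3/10 - s)
      + 17777489/243000 * m^4 * s^5)"
      unfolding att_def fade\<^sub>1_def fade\<^sub>2_def low\<^sub>1_def con\<^sub>0_int_def by algebra
    moreover have "0 \<le> \<dots>"
      using 1 assms by (intro mult_nonneg_nonneg add_nonneg_nonneg zero_le_power) simp_all
    ultimately show ?thesis by linarith
  next
    case 2
    have "att m s * (s - m * s^2 + m^2 * con\<^sub>0_int s) - low\<^sub>1 s = s^2 *
      (1484375/67228 * (2/5 - m)^4 * (1 - s)^5
      + 2890625/33614 * (2/5 - m)^4 * (s - 3/10) * (1 - s)^4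
      + 3984375/16807 * (2/5 - m)^4 * (s - 3/10)^2 * (1 - s)^3
      + 13984375/33614 * (2/5 - m)^4 * (s - 3/10)^3 * (1 - s)^2
      + 23828125/67228 * (2/5 - m)^4 * (s - 3/10)^4 * (1 - s)
      + 1875000/16807 * (2/5 - m)^4 * (s - 3/10)^5
      + 2859375/67228 * m * (2/5 - m)^3 * (1 - s)^5
      + 11234375/67228 * m * (2/5 - m)^3 * (s - 3/10) * (1 - s)^4
      + 44671875/67228 * m * (2/5 - m)^3 * (s - 3/10)^2 * (1 - s)^3
      + 95203125/67228 * m * (2/5 - m)^3 * (s - 3/10)^3 * (1 - s)^2
      + 43515625/33614 * m * (2/5 - m)^3 * (s - 3/10)^4 * (1 - s)
      + 7031250/16807 * m * (2/5 - m)^3 * (s - 3/10)^5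
      + 3104533/134456 * m^2 * (2/5 - m)^2 * (1 - s)^5
      + 81152641/806736 * m^2 * (2/5 - m)^2 * (s - 3/10) * (1 - s)^4
      + 12557210/16807 * m^2 * (2/5 - m)^2 * (s - 3/10)^2 * (1 - s)^3
      + 125915325/67228 * m^2 * (2/5 - m)^2 * (s - 3/10)^3 * (1 - s)^2
      + 90245125/50421 * m^2 * (2/5 - m)^2 * (s - 3/10)^4 * (1 - s)
      + 9860625/16807 * m^2 * (2/5 - m)^2 * (s - 3/10)^5
      + 6026829/1680700 * m^3 * (2/5 - m) * (1 - s)^5
      + 22368757/1008420 * m^3 * (2/5 - m) * (s - 3/10) * (1 - s)^4
      + 81020627/201684 * m^3 * (2/5 - m) * (s - 3/10)^2 * (1 - s)^3
      + 75037595/67228 * m^3 * (2/5 - m) * (s - 3/10)^3 * (1 - s)^2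
      + 36800175/33614 * m^3 * (2/5 - m) * (s - 3/10)^4 * (1 - s)
      + 6086250/16807 * m^3 * (2/5 - m) * (s - 3/10)^5
      + 17777489/16807000 * m^4 * (1 - s)^5
      + 14571803/4033680 * m^4 * (s - 3/10) * (1 - s)^4
      + 1420910/16807 * m^4 * (s - 3/10)^2 * (1 - s)^3
      + 16540885/67228 * m^4 * (s - 3/10)^3 * (1 - s)^2
      + 49670725/201684 * m^4 * (s - 3/10)^4 * (1 - s)
      + 1384675/16807 * m^4 * (s - 3/10)^5)"
      unfolding att_def fade\<^sub>1_def fade\<^sub>2_def low\<^sub>1_def con\<^sub>0_int_def by algebra
    moreover have "0 \<le> \<dots>"
      using 2 assms by (intro mult_nonneg_nonneg add_nonneg_nonneg zero_le_power) simp_all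
    ultimately show ?thesis by linarith
  next
    case 3
    have "att m s * (s - m * s^2 + m^2 * con\<^sub>0_int s) - low\<^sub>1 s = s^2 *
      (4375000/19683 * (1 - m)^4 * (3/10 - s)^5
      + 4662500/6561 * (1 - m)^4 * s * (3/10 - s)^4
      + 15882500/19683 * (1 - m)^4 * s^2 * (3/10 - s)^3
      + 7601560/19683 * (1 - m)^4 * s^3 * (3/10 - s)^2
      + 897431/10935 * (1 - m)^4 * s^4 * (3/10 - s)
      + 35554978/2460375 * (1 - m)^4 * s^5
      + 17500000/19683 * (m - 2/5) * (1 - m)^3 * (3/10 - s)^5
      + 6512500/2187 * (m - 2/5) * (1 - m)^3 * s * (3/10 - s)^4
      + 71495750/19683 * (m - 2/5) * (1 - m)^3 * s^2 * (3/10 - s)^3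
      + 38646010/19683 * (m - 2/5) * (1 - m)^3 * s^3 * (3/10 - s)^2
      + 16094492/32805 * (m - 2/5) * (1 - m)^3 * s^4 * (3/10 - s)
      + 34948982/492075 * (m - 2/5) * (1 - m)^3 * s^5
      + 16250000/6561 * (m - 2/5)^2 * (1 - m)^2 * (3/10 - s)^5
      + 21312500/2187 * (m - 2/5)^2 * (1 - m)^2 * s * (3/10 - s)^4
      + 98387500/6561 * (m - 2/5)^2 * (1 - m)^2 * s^2 * (3/10 - s)^3
      + 74624075/6561 * (m - 2/5)^2 * (1 - m)^2 * s^3 * (3/10 - s)^2
      + 38023291/8748 * (m - 2/5)^2 * (1 - m)^2 * s^4 * (3/10 - s)
      + 45961999/65610 * (m - 2/5)^2 * (1 - m)^2 * s^5
      + 62500000/19683 * (m - 2/5)^3 * (1 - m) * (3/10 - s)^5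
      + 86562500/6561 * (m - 2/5)^3 * (1 - m) * s * (3/10 - s)^4
      + 424868750/19683 * (m - 2/5)^3 * (1 - m) * s^2 * (3/10 - s)^3
      + 342713125/19683 * (m - 2/5)^3 * (1 - m) * s^3 * (3/10 - s)^2
      + 60859295/8748 * (m - 2/5)^3 * (1 - m) * s^4 * (3/10 - s)
      + 43814377/39366 * (m - 2/5)^3 * (1 - m) * s^5
      + 26875000/19683 * (m - 2/5)^4 * (3/10 - s)^5
      + 12500000/2187 * (m - 2/5)^4 * s * (3/10 - s)^4
      + 185562500/19683 * (m - 2/5)^4 * s^2 * (3/10 - s)^3
      + 150505000/19683 * (m - 2/5)^4 * s^3 * (3/10 - s)^2
      + 19982500/6561 * (m - 2/5)^4 * s^4 * (3/10 - s)
      + 9380000/19683 * (m - 2/5)^4 * s^5)"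
      unfolding att_def fade\<^sub>1_def fade\<^sub>2_def low\<^sub>1_def con\<^sub>0_int_def by algebra
    moreover have "0 \<le> \<dots>"
      using 3 assms by (intro mult_nonneg_nonneg add_nonneg_nonneg zero_le_power) simp_all
    ultimately show ?thesis by linarith
  next
    case 4
    have "att m s * (s - m * s^2 + m^2 * con\<^sub>0_int s) - low\<^sub>1 s = s^2 *
      (17777489/5184000 * (1 - m)^4 * (7/10 - s)^5
      + 43673633/3110400 * (1 - m)^4 * (s - 3/10) * (7/10 - s)^4
      + 18536663/172800 * (1 - m)^4 * (s - 3/10)^2 * (7/10 - s)^3
      + 142034911/518400 * (1 - m)^4 * (s - 3/10)^3 * (7/10 - s)^2
      + 823364267/3110400 * (1 - m)^4 * (s - 3/10)^4 * (7/10 - s)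
      + 453177011/5184000 * (1 - m)^4 * (s - 3/10)^5
      + 17474491/1036800 * (m - 2/5) * (1 - m)^3 * (7/10 - s)^5
      + 5150897/124416 * (m - 2/5) * (1 - m)^3 * (s - 3/10) * (7/10 - s)^4
      + 30803659/103680 * (m - 2/5) * (1 - m)^3 * (s - 3/10)^2 * (7/10 - s)^3
      + 85558247/103680 * (m - 2/5) * (1 - m)^3 * (s - 3/10)^3 * (7/10 - s)^2
      + 520979761/622080 * (m - 2/5) * (1 - m)^3 * (s - 3/10)^4 * (7/10 - s)
      + 295516039/1036800 * (m - 2/5) * (1 - m)^3 * (s - 3/10)^5
      + 45961999/276480 * (m - 2/5)^2 * (1 - m)^2 * (7/10 - s)^5
      + 93594247/165888 * (m - 2/5)^2 * (1 - m)^2 * (s - 3/10) * (7/10 - s)^4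
      + 28018523/27648 * (m - 2/5)^2 * (1 - m)^2 * (s - 3/10)^2 * (7/10 - s)^3
      + 37233785/27648 * (m - 2/5)^2 * (1 - m)^2 * (s - 3/10)^3 * (7/10 - s)^2
      + 177936181/165888 * (m - 2/5)^2 * (1 - m)^2 * (s - 3/10)^4 * (7/10 - s)
      + 94497541/276480 * (m - 2/5)^2 * (1 - m)^2 * (s - 3/10)^5
      + 43814377/165888 * (m - 2/5)^3 * (1 - m) * (7/10 - s)^5
      + 438035885/497664 * (m - 2/5)^3 * (1 - m) * (s - 3/10) * (7/10 - s)^4
      + 32644075/27648 * (m - 2/5)^3 * (1 - m) * (s - 3/10)^2 * (7/10 - s)^3
      + 76591555/82944 * (m - 2/5)^3 * (1 - m) * (s - 3/10)^3 * (7/10 - s)^2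
      + 249192095/497664 * (m - 2/5)^3 * (1 - m) * (s - 3/10)^4 * (7/10 - s)
      + 23595403/165888 * (m - 2/5)^3 * (1 - m) * (s - 3/10)^5
      + 293125/2592 * (m - 2/5)^4 * (7/10 - s)^5
      + 5531875/15552 * (m - 2/5)^4 * (s - 3/10) * (7/10 - s)^4
      + 251875/648 * (m - 2/5)^4 * (s - 3/10)^2 * (7/10 - s)^3
      + 426875/2592 * (m - 2/5)^4 * (s - 3/10)^3 * (7/10 - s)^2
      + 160625/7776 * (m - 2/5)^4 * (s - 3/10)^4 * (7/10 - s)
      + 10625/5184 * (m - 2/5)^4 * (s - 3/10)^5)"
      unfolding att_def fade\<^sub>1_def fade\<^sub>2_def low\<^sub>1_def con\<^sub>0_int_def by algebra
    moreover have "0 \<le> \<dots>"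
      using 4 assms by (intro mult_nonneg_nonneg add_nonneg_nonneg zero_le_power) simp_all
    ultimately show ?thesis by linarith
  next
    case 5
    have "att m s * (s - m * s^2 + m^2 * con\<^sub>0_int s) - low\<^sub>1 s = s^2 *
      (906354022/2460375 * (1 - m)^4 * (1 - s)^5
      + 26098609/10935 * (1 - m)^4 * (s - 7/10) * (1 - s)^4
      + 119568880/19683 * (1 - m)^4 * (s - 7/10)^2 * (1 - s)^3
      + 149370740/19683 * (1 - m)^4 * (s - 7/10)^3 * (1 - s)^2
      + 30560900/6561 * (1 - m)^4 * (s - 7/10)^4 * (1 - s)
      + 22154800/19683 * (1 - m)^4 * (s - 7/10)^5
      + 591032078/492075 * (m - 2/5) * (1 - m)^3 * (1 - s)^5
      + 85979584/10935 * (m - 2/5) * (1 - m)^3 * (s - 7/10) * (1 - s)^4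
      + 397829674/19683 * (m - 2/5) * (1 - m)^3 * (s - 7/10)^2 * (1 - s)^3
      + 501459830/19683 * (m - 2/5) * (1 - m)^3 * (s - 7/10)^3 * (1 - s)^2
      + 103408700/6561 * (m - 2/5) * (1 - m)^3 * (s - 7/10)^4 * (1 - s)
      + 75478000/19683 * (m - 2/5) * (1 - m)^3 * (s - 7/10)^5
      + 94497541/65610 * (m - 2/5)^2 * (1 - m)^2 * (1 - s)^5
      + 80591101/8748 * (m - 2/5)^2 * (1 - m)^2 * (s - 7/10) * (1 - s)^4
      + 154648565/6561 * (m - 2/5)^2 * (1 - m)^2 * (s - 7/10)^2 * (1 - s)^3
      + 195886300/6561 * (m - 2/5)^2 * (1 - m)^2 * (s - 7/10)^3 * (1 - s)^2
      + 40772000/2187 * (m - 2/5)^2 * (1 - m)^2 * (s - 7/10)^4 * (1 - s)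
      + 30087500/6561 * (m - 2/5)^2 * (1 - m)^2 * (s - 7/10)^5
      + 23595403/39366 * (m - 2/5)^3 * (1 - m) * (1 - s)^5
      + 32035945/8748 * (m - 2/5)^3 * (1 - m) * (s - 7/10) * (1 - s)^4
      + 186344275/19683 * (m - 2/5)^3 * (1 - m) * (s - 7/10)^2 * (1 - s)^3
      + 244789250/19683 * (m - 2/5)^3 * (1 - m) * (s - 7/10)^3 * (1 - s)^2
      + 53270000/6561 * (m - 2/5)^3 * (1 - m) * (s - 7/10)^4 * (1 - s)
      + 41087500/19683 * (m - 2/5)^3 * (1 - m) * (s - 7/10)^5
      + 170000/19683 * (m - 2/5)^4 * (1 - s)^5
      + 2500/243 * (m - 2/5)^4 * (s - 7/10) * (1 - s)^4
      + 3895000/19683 * (m - 2/5)^4 * (s - 7/10)^2 * (1 - s)^3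
      + 12237500/19683 * (m - 2/5)^4 * (s - 7/10)^3 * (1 - s)^2
      + 4250000/6561 * (m - 2/5)^4 * (s - 7/10)^4 * (1 - s)
      + 4375000/19683 * (m - 2/5)^4 * (s - 7/10)^5)"
      unfolding att_def fade\<^sub>1_def fade\<^sub>2_def low\<^sub>1_def con\<^sub>0_int_def by algebra
    moreover have "0 \<le> \<dots>"
      using 5 assms by (intro mult_nonneg_nonneg add_nonneg_nonneg zero_le_power) simp_all
    ultimately show ?thesis by linarith
  qed
qed


section \<open>Bounds from the recursion\<close>

locale weighted_graph =
  fixes V :: "'a set" and X :: "'a \<Rightarrow> 'a \<Rightarrow> real"
  assumes finite_V: "finite V"
    and X_sym: "X u v = X v u"
    and X_nonneg: "0 \<le> X u v"
    and X_irrefl: "X u u = 0"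
    and X_sum_le: "u \<in> V \<Longrightarrow> (\<Sum>w\<in>V. X u w) \<le> 1"
begin

definition wdeg :: "'a \<Rightarrow> real" where
  "wdeg u = (\<Sum>w\<in>V. X u w)"

definition wdeg_in :: "'a set \<Rightarrow> 'a \<Rightarrow> real" where
  "wdeg_in S u = (\<Sum>w\<in>S - {u}. X u w)"

text \<open>The degrees are those of the whole graph, not of the current vertex set: the rate of an
  edge is fixed once and for all, and deleting vertices in the recursion must not change it.\<close>

definition excess :: "'a \<Rightarrow> 'a \<Rightarrow> real" where
  "excess u w = (wdeg u + wdeg w) / 2 - X u w"

lemma excess_sym: "excess u w = excess w u"
  by (simp add: excess_def X_sym add.commute)

lemma wdeg_in_V: "wdeg_in V u = wdeg u"
  unfolding wdeg_in_def wdeg_def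
  by (rule sum.mono_neutral_left) (auto simp: finite_V X_irrefl)

lemma wdeg_in_nonneg: "0 \<le> wdeg_in S u"
  unfolding wdeg_in_def by (intro sum_nonneg X_nonneg)

lemma wdeg_in_mono: "S \<subseteq> S' \<Longrightarrow> S' \<subseteq> V \<Longrightarrow> wdeg_in S u \<le> wdeg_in S' u"
  unfolding wdeg_in_def
  by (rule sum_mono2) (auto simp: X_nonneg intro: finite_subset[OF _ finite_V])

lemma wdeg_in_le_1: "u \<in> V \<Longrightarrow> S \<subseteq> V \<Longrightarrow> wdeg_in S u \<le> 1"
  using wdeg_in_mono[of S V u] X_sum_le[of u] by (simp add: wdeg_in_V wdeg_def)

lemma wdeg_in_remove:
  assumes "S \<subseteq> V" "w \<in> S" "w \<noteq> u"
  shows "wdeg_in (S - {w}) u = wdeg_in S u - X u w"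
proof -
  have fin: "finite (S - {u})" using finite_subset[OF assms(1) finite_V] by simp
  have eq: "S - {w} - {u} = S - {u} - {w}" by auto
  show ?thesis
    unfolding wdeg_in_def eq using assms(2,3) fin by (simp add: sum_diff1)
qed

lemma X_le_wdeg_in: "S \<subseteq> V \<Longrightarrow> w \<in> S \<Longrightarrow> w \<noteq> u \<Longrightarrow> X u w \<le> wdeg_in S u"
  using wdeg_in_remove[of S w u] wdeg_in_nonneg[of "S - {w}" u] by simp

lemma excess_bounds:
  assumes "u \<in> V" "w \<in> V" "u \<noteq> w"
  shows "0 \<le> excess u w" "excess u w \<le> 1 - X u w" "excess u w \<le> 1"
proof -
  have "X u w \<le> wdeg u" "X u w \<le> wdeg w"
    using X_le_wdeg_in[of V w u] X_le_wdeg_in[of V u w] assms by (auto simp: wdeg_in_V X_sym)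
  moreover have "wdeg u \<le> 1" "wdeg w \<le> 1"
    using assms wdeg_in_le_1[of _ V] by (auto simp: wdeg_in_V)
  ultimately show "0 \<le> excess u w" "excess u w \<le> 1 - X u w" "excess u w \<le> 1"
    using X_nonneg[of u w] by (auto simp: excess_def field_simps)
qed

text \<open>Each deletion removes \<open>X u w\<close> from one of the two degrees, which is the
  \<open>2 * X u w\<close> subtracted in \<open>2 * excess u w\<close>. Passing from
  \<open>S\<close> to \<open>V\<close> can only increase the rest.\<close>

lemma wdeg_in_pair_le:
  assumes "S \<subseteq> V" "u \<in> S" "w \<in> S" "u \<noteq> w"
  shows "wdeg_in (S - {w}) u + wdeg_in (S - {u}) w \<le> 2 * excess u w"
  using wdeg_in_remove[of S w u] wdeg_in_remove[of S u w] assms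
    wdeg_in_mono[of S V u] wdeg_in_mono[of S V w]
  by (simp add: excess_def wdeg_in_V X_sym)

end

text \<open>The interface between probability and analysis: everything proved here about \<phi> uses
  the recursion, nonnegativity and continuity only. The random process supplies the instance
  \<open>vacancy\<close>.\<close>

locale vacancy_recursion = weighted_graph +
  fixes \<phi> :: "'a set \<Rightarrow> 'a \<Rightarrow> real \<Rightarrow> real"
  assumes \<phi>_nonneg: "S \<subseteq> V \<Longrightarrow> u \<in> S \<Longrightarrow> 0 \<le> y \<Longrightarrow> y \<le> 1 \<Longrightarrow> 0 \<le> \<phi> S u y"
    and \<phi>_cont: "S \<subseteq> V \<Longrightarrow> u \<in> S \<Longrightarrow> continuous_on {0..1} (\<phi> S u)"
    and \<phi>_rec: "S \<subseteq> V \<Longrightarrow> u \<in> S \<Longrightarrow> 0 \<le> y \<Longrightarrow> y \<le> 1 \<Longrightarrow>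
      \<phi> S u y = y - (\<Sum>w\<in>S - {u}. X u w *
        integral {0..y} (\<lambda>s. att (excess u w) s * (\<phi> (S - {w}) u s + \<phi> (S - {u}) w s)))"
begin

lemma pair_integrable:
  assumes "S \<subseteq> V" "u \<in> S" "w \<in> S" "u \<noteq> w" "y \<le> 1"
  shows "(\<lambda>s. att m s * (\<phi> (S - {w}) u s + \<phi> (S - {u}) w s)) integrable_on {0..y}"
proof -
  have "continuous_on {0..y} (\<phi> (S - {w}) u)" "continuous_on {0..y} (\<phi> (S - {u}) w)"
    using assms by (auto intro!: continuous_on_subset[OF \<phi>_cont])
  thus ?thesis
    by (intro integrable_continuous_real continuous_intros)
qed

text \<open>The function \<open>h\<close> is the same for all \<open>w\<close>, so the sum over
  \<open>w\<close> collapses to the degree times one integral. The minus sign in the recursion turns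
  an upper bound on the integrand into a lower bound on \<phi>.\<close>

lemma \<phi>_lower_step:
  assumes S: "S \<subseteq> V" "u \<in> S" and y: "0 \<le> y" "y \<le> 1"
    and h: "(h has_integral H) {0..y}"
    and le: "\<And>w s. w \<in> S \<Longrightarrow> w \<noteq> u \<Longrightarrow> 0 \<le> s \<Longrightarrow> s \<le> y \<Longrightarrow>
      att (excess u w) s * (\<phi> (S - {w}) u s + \<phi> (S - {u}) w s) \<le> h s"
  shows "y - wdeg_in S u * H \<le> \<phi> S u y"
proof -
  have "integral {0..y} (\<lambda>s. att (excess u w) s * (\<phi> (S - {w}) u s + \<phi> (S - {u}) w s)) \<le> H"
    if "w \<in> S" "w \<noteq> u" for w
    using that S y le
    by (intro has_integral_le[OF integrable_integral[OF pair_integrable] h]) auto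
  hence "(\<Sum>w\<in>S - {u}. X u w *
        integral {0..y} (\<lambda>s. att (excess u w) s * (\<phi> (S - {w}) u s + \<phi> (S - {u}) w s))) \<le>
      (\<Sum>w\<in>S - {u}. X u w * H)"
    by (intro sum_mono mult_left_mono X_nonneg) auto
  thus ?thesis
    using \<phi>_rec[OF S y] by (simp add: wdeg_in_def sum_distrib_right)
qed

lemma \<phi>_upper_step:
  assumes S: "S \<subseteq> V" "u \<in> S" and y: "0 \<le> y" "y \<le> 1"
    and h: "(h has_integral H) {0..y}"
    and le: "\<And>w s. w \<in> S \<Longrightarrow> w \<noteq> u \<Longrightarrow> 0 \<le> s \<Longrightarrow> s \<le> y \<Longrightarrow>
      h s \<le> att (excess u w) s * (\<phi> (S - {w}) u s + \<phi> (S - {u}) w s)"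
  shows "\<phi> S u y \<le> y - wdeg_in S u * H"
proof -
  have "H \<le> integral {0..y} (\<lambda>s. att (excess u w) s * (\<phi> (S - {w}) u s + \<phi> (S - {u}) w s))"
    if "w \<in> S" "w \<noteq> u" for w
    using that S y le
    by (intro has_integral_le[OF h integrable_integral[OF pair_integrable]]) auto
  hence "(\<Sum>w\<in>S - {u}. X u w * H) \<le> (\<Sum>w\<in>S - {u}. X u w *
        integral {0..y} (\<lambda>s. att (excess u w) s * (\<phi> (S - {w}) u s + \<phi> (S - {u}) w s)))"
    by (intro sum_mono mult_left_mono X_nonneg) auto
  thus ?thesis
    using \<phi>_rec[OF S y] by (simp add: wdeg_in_def sum_distrib_right)
qed

lemma \<phi>_le:
  assumes S: "S \<subseteq> V" "u \<in> S" and y: "0 \<le> y" "y \<le> 1"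
  shows "\<phi> S u y \<le> y"
proof -
  have "\<phi> S u y \<le> y - wdeg_in S u * 0"
  proof (rule \<phi>_upper_step[OF S y])
    show "((\<lambda>s::real. 0::real) has_integral 0) {0..y}" by simp
    fix w s assume "w \<in> S" "w \<noteq> u" "0 \<le> s" "s \<le> y"
    thus "0 \<le> att (excess u w) s * (\<phi> (S - {w}) u s + \<phi> (S - {u}) w s)"
      using S y excess_bounds[of u w]
      by (intro mult_nonneg_nonneg add_nonneg_nonneg att_bounds \<phi>_nonneg) auto
  qed
  thus ?thesis by simp
qed

lemma \<phi>_lower\<^sub>0:
  assumes S: "S \<subseteq> V" "u \<in> S" and y: "0 \<le> y" "y \<le> 1"
  shows "y - wdeg_in S u * y^2 \<le> \<phi> S u y"
proof (rule \<phi>_lower_step[OF S y])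
  show "((\<lambda>s. 2 * s) has_integral y^2) {0..y}"
    using y(1) by (rule has_integral_from_0) (auto intro!: derivative_eq_intros)
  fix w s assume w: "w \<in> S" "w \<noteq> u" and s: "0 \<le> s" "s \<le> y"
  have "att (excess u w) s * (\<phi> (S - {w}) u s + \<phi> (S - {u}) w s) \<le> 1 * (s + s)"
    using w s S y excess_bounds[of u w]
    by (intro mult_mono add_mono att_bounds \<phi>_le add_nonneg_nonneg \<phi>_nonneg) auto
  thus "att (excess u w) s * (\<phi> (S - {w}) u s + \<phi> (S - {u}) w s) \<le> 2 * s" by simp
qed

text \<open>The lower bounds of the previous round are linear in the degree, so their sum is
  governed by \<open>wdeg_in_pair_le\<close>. \<open>att_low\<^sub>0\<close> then removes the
  dependence on \<open>excess u w\<close>.\<close>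

lemma \<phi>_upper\<^sub>0:
  assumes S: "S \<subseteq> V" "u \<in> S" and y: "0 \<le> y" "y \<le> 1"
  shows "\<phi> S u y \<le> y - wdeg_in S u * con\<^sub>0 y"
proof (rule \<phi>_upper_step[OF S y low\<^sub>0_has_integral[OF y(1)]])
  fix w s assume w: "w \<in> S" "w \<noteq> u" and s: "0 \<le> s" "s \<le> y"
  have b: "0 \<le> excess u w" "excess u w \<le> 1" "0 \<le> s" "s \<le> 1"
    using excess_bounds[of u w] w S s y by auto
  have "s - wdeg_in (S - {w}) u * s^2 \<le> \<phi> (S - {w}) u s"
       "s - wdeg_in (S - {u}) w * s^2 \<le> \<phi> (S - {u}) w s"
    using w s S y by (auto intro!: \<phi>_lower\<^sub>0)
  moreover have "(wdeg_in (S - {w}) u + wdeg_in (S - {u}) w) * s^2 \<le> (2 * excess u w) * s^2"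
    using wdeg_in_pair_le[of S u w] w S by (intro mult_right_mono) auto
  ultimately have "2 * (s - excess u w * s^2) \<le> \<phi> (S - {w}) u s + \<phi> (S - {u}) w s"
    by (simp add: algebra_simps)
  hence "att (excess u w) s * (2 * (s - excess u w * s^2)) \<le>
      att (excess u w) s * (\<phi> (S - {w}) u s + \<phi> (S - {u}) w s)"
    using b by (intro mult_left_mono att_bounds) auto
  hence "2 * (att (excess u w) s * (s - excess u w * s^2)) \<le>
      att (excess u w) s * (\<phi> (S - {w}) u s + \<phi> (S - {u}) w s)"
    by (simp only: mult.left_commute)
  thus "2 * low\<^sub>0 s \<le> att (excess u w) s * (\<phi> (S - {w}) u s + \<phi> (S - {u}) w s)"
    using att_low\<^sub>0[of s "excess u w"] b by simp
qed

text \<open>Only the term of \<open>u\<close> is improved. The remaining degree of the neighbour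
  \<open>w\<close> has no positive lower bound, so its term keeps the estimate \<open>s\<close>, and
  the rate is bounded through \<open>excess u w \<le> 1 - X u w\<close>. By
  \<open>att_con\<^sub>0\<close> the result involves only the degree \<open>m\<close> of
  \<open>u\<close>, once in the integrand and once more from the sum, whence the square.\<close>

lemma \<phi>_lower\<^sub>1:
  assumes S: "S \<subseteq> V" "u \<in> S" and y: "0 \<le> y" "y \<le> 1"
  defines "m \<equiv> wdeg_in S u"
  shows "y - m * y^2 + m^2 * con\<^sub>0_int y \<le> \<phi> S u y"
proof -
  have "y - wdeg_in S u * (y^2 - m * con\<^sub>0_int y) \<le> \<phi> S u y"
  proof (rule \<phi>_lower_step[OF S y])
    have "((\<lambda>s. 2 * s) has_integral y^2) {0..y}"
      using y(1) by (rule has_integral_from_0) (auto intro!: derivative_eq_intros)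
    thus "((\<lambda>s. 2 * s - m * con\<^sub>0 s) has_integral (y^2 - m * con\<^sub>0_int y)) {0..y}"
      by (intro has_integral_diff has_integral_mult_right con\<^sub>0_has_integral y)
    fix w s assume w: "w \<in> S" "w \<noteq> u" and s: "0 \<le> s" "s \<le> y"
    let ?x = "X u w"
    have b: "0 \<le> excess u w" "excess u w \<le> 1 - ?x" "0 \<le> s" "s \<le> 1"
      using excess_bounds[of u w] w S s y by auto
    have x: "0 \<le> ?x" "?x \<le> m" "m \<le> 1"
      using X_nonneg X_le_wdeg_in[of S w u] wdeg_in_le_1[of u S] w S by (auto simp: m_def)
    have "\<phi> (S - {w}) u s \<le> s - (m - ?x) * con\<^sub>0 s" "\<phi> (S - {u}) w s \<le> s"
      using \<phi>_upper\<^sub>0[of "S - {w}" u s] \<phi>_le[of "S - {u}" w s] w s S y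
      by (auto simp: wdeg_in_remove m_def)
    moreover have "0 \<le> \<phi> (S - {w}) u s" "0 \<le> \<phi> (S - {u}) w s"
      using w s S y by (auto intro!: \<phi>_nonneg)
    ultimately have "att (excess u w) s * (\<phi> (S - {w}) u s + \<phi> (S - {u}) w s) \<le>
        att (1 - ?x) s * (2 * s - (m - ?x) * con\<^sub>0 s)"
      using b x by (intro mult_mono att_mono att_bounds) auto
    also have "\<dots> \<le> 2 * s - m * con\<^sub>0 s"
      using b x by (intro att_con\<^sub>0) auto
    finally show "att (excess u w) s * (\<phi> (S - {w}) u s + \<phi> (S - {u}) w s) \<le> 2 * s - m * con\<^sub>0 s" .
  qed
  thus ?thesis by (simp add: m_def algebra_simps power2_eq_square)
qed

lemma \<phi>_upper\<^sub>1:
  assumes S: "S \<subseteq> V" "u \<in> S" and y: "0 \<le> y" "y \<le> 1"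
  shows "\<phi> S u y \<le> y - wdeg_in S u * con\<^sub>1 y"
proof (rule \<phi>_upper_step[OF S y low\<^sub>1_has_integral[OF y(1)]])
  fix w s assume w: "w \<in> S" "w \<noteq> u" and s: "0 \<le> s" "s \<le> y"
  have b: "0 \<le> excess u w" "excess u w \<le> 1" "0 \<le> s" "s \<le> 1"
    using excess_bounds[of u w] w S s y by auto
  define a where "a = wdeg_in (S - {w}) u"
  define a' where "a' = wdeg_in (S - {u}) w"
  define e where "e = excess u w"
  define c where "c = con\<^sub>0_int s"
  have "s - a * s^2 + a^2 * c \<le> \<phi> (S - {w}) u s"
       "s - a' * s^2 + a'^2 * c \<le> \<phi> (S - {u}) w s"
    unfolding a_def a'_def c_def using w s S y by (auto intro!: \<phi>_lower\<^sub>1)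
  \<comment> \<open>The lower bound is convex in the degree, so two degrees may be replaced by their
    mean \<open>d\<close>. It is also decreasing, so \<open>d\<close> may be replaced by
    \<open>e \<ge> d\<close>.\<close>
  moreover have "2 * (s - e * s^2 + e^2 * c) \<le>
      (s - a * s^2 + a^2 * c) + (s - a' * s^2 + a'^2 * c)"
  proof -
    define d where "d = (a + a') / 2"
    have d: "0 \<le> d" "d \<le> e"
      using wdeg_in_pair_le[of S u w] w S wdeg_in_nonneg
      by (auto simp: a_def a'_def d_def e_def)
    have "(e + d) * c \<le> 2 * c"
      using d b con\<^sub>0_int_bounds[of s] by (intro mult_right_mono) (auto simp: e_def c_def)
    also have "\<dots> \<le> s^2" using con\<^sub>0_int_bounds[of s] b by (simp add: c_def)
    finally have "0 \<le> (e - d) * (s^2 - (e + d) * c)"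
      using d by (intro mult_nonneg_nonneg) auto
    moreover have "0 \<le> (a - a')^2 * c" using con\<^sub>0_int_bounds[of s] b by (simp add: c_def)
    ultimately show ?thesis
      unfolding d_def by (simp add: field_simps power2_eq_square)
  qed
  ultimately have "2 * (s - e * s^2 + e^2 * c) \<le> \<phi> (S - {w}) u s + \<phi> (S - {u}) w s"
    by linarith
  hence "att e s * (2 * (s - e * s^2 + e^2 * c)) \<le> att e s * (\<phi> (S - {w}) u s + \<phi> (S - {u}) w s)"
    using b by (intro mult_left_mono att_bounds) (auto simp: e_def)
  hence "2 * (att e s * (s - e * s^2 + e^2 * c)) \<le> att e s * (\<phi> (S - {w}) u s + \<phi> (S - {u}) w s)"
    by (simp only: mult.left_commute)
  thus "2 * low\<^sub>1 s \<le> att (excess u w) s * (\<phi> (S - {w}) u s + \<phi> (S - {u}) w s)"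
    using att_low\<^sub>1[of s e] b by (simp add: e_def c_def)
qed

end


section \<open>The selection probability of an edge\<close>

text \<open>
  Expanding \<open>att m y\<close> in the Bernstein basis in \<open>m\<close> reduces the final estimate to three fixed weight
  functions of \<open>y\<close>, indexed 1, 2, 3 below.
\<close>

lemma att_bernstein:
  "att m y = m^2 * 1 + 2 * m * (1 - m) * (1 - (fade\<^sub>1 y + fade\<^sub>2 y) * (1/2)) + (1 - m)^2 * (1 - fade\<^sub>1 y)"
  by (simp add: att_def field_simps power2_eq_square)

text \<open>
  \<open>K m y\<close> and \<open>L p y\<close> are the integrals over \<open>s \<in> {0..y}\<close> of \<open>att m s * (s - m * con\<^sub>1 s)\<close> and
  \<open>att (1 - p) s * con\<^sub>1 s\<close>; \<open>K\<^sub>i m\<close> and \<open>L\<^sub>i p\<close> are their integrals over \<open>y \<in> {0..1}\<close> against the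
  \<open>i\<close>-th weight.
\<close>

definition K :: "real \<Rightarrow> real \<Rightarrow> real" where
  "K m y = 1/2 * y^2 - 2/5 * y^3 + 3/16 * y^4 - 4/15 * m * y^3 + 661/1200 * m * y^4 - 661/1250 * m * y^5 + 403/1200 * m * y^6 - 417/2800 * m * y^7 + 3/80 * m * y^8 + 1/3 * m^2 * y^3 - 1/4 * m^2 * y^4 + 211/7500 * m^2 * y^5 - 307/18000 * m^2 * y^6 + 17/2800 * m^2 * y^7 + 1/400 * m^2 * y^8 - 1/4 * m^3 * y^4 + 263/750 * m^3 * y^5 - 2269/9000 * m^3 * y^6 + 1/7 * m^3 * y^7 - 1/25 * m^3 * y^8"

definition L :: "real \<Rightarrow> real \<Rightarrow> real" where
  "L p y = 1/3 * y^3 - 143/600 * y^4 + 3/20 * y^5 - 1/15 * y^6 - 11/20 * p * y^4 + 5471/7500 * p * y^5 - 9383/18000 * p * y^6 + 817/2800 * p * y^7 - 31/400 * p * y^8 + 1/4 * p^2 * y^4 - 263/750 * p^2 * y^5 + 2269/9000 * p^2 * y^6 - 1/7 * p^2 * y^7 + 1/25 * p^2 * y^8"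

text \<open>Separates the derivative \<open>D\<close> from the integrand \<open>f\<close>. With
  \<open>D\<close> written out in monomials the derivative is checked term by term, and
  \<open>f s = D s\<close> is a plain polynomial identity.\<close>

lemma has_integral_from_0':
  fixes F f :: "real \<Rightarrow> real"
  assumes "0 \<le> y" "\<And>s. (F has_real_derivative D s) (at s)" "\<And>s. f s = D s" "F 0 = 0"
  shows "(f has_integral F y) {0..y}"
  using has_integral_from_0[of y F D] assms by (simp cong: has_integral_cong)

lemma K_has_integral:
  assumes "0 \<le> y"
  shows "((\<lambda>s. att m s * (s - m * con\<^sub>1 s)) has_integral K m y) {0..y}"
  using assms
proof (rule has_integral_from_0')
  show "(K m has_real_derivative 1 * s - 6/5 * s^2 + 3/4 * s^3 - 4/5 * m * s^2 + 661/300 * m * s^3 - 661/250 * m * s^4 + 403/200 * m * s^5 - 417/400 * m * s^6 + 3/10 * m * s^7 + 1 * m^2 * s^2 - 1 * m^2 * s^3 + 211/1500 * m^2 * s^4 - 307/3000 * m^2 * s^5 + 17/400 * m^2 * s^6 + 1/50 * m^2 * s^7 - 1 * m^3 * s^3 + 263/150 * m^3 * s^4 - 2269/1500 * m^3 * s^5 + 1 * m^3 * s^6 - 8/25 * m^3 * s^7) (at s)" for s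
    unfolding K_def by (auto intro!: derivative_eq_intros)
qed (unfold K_def att_def fade\<^sub>1_def fade\<^sub>2_def con\<^sub>1_def, algebra, simp)

lemma L_has_integral:
  assumes "0 \<le> y"
  shows "((\<lambda>s. att (1 - p) s * con\<^sub>1 s) has_integral L p y) {0..y}"
  using assms
proof (rule has_integral_from_0')
  show "(L p has_real_derivative 1 * s^2 - 143/150 * s^3 + 3/4 * s^4 - 2/5 * s^5 - 11/5 * p * s^3 + 5471/1500 * p * s^4 - 9383/3000 * p * s^5 + 817/400 * p * s^6 - 31/50 * p * s^7 + 1 * p^2 * s^3 - 263/150 * p^2 * s^4 + 2269/1500 * p^2 * s^5 - 1 * p^2 * s^6 + 8/25 * p^2 * s^7) (at s)" for s
    unfolding L_def by (auto intro!: derivative_eq_intros)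
qed (unfold L_def att_def fade\<^sub>1_def fade\<^sub>2_def con\<^sub>1_def, algebra, simp)

text \<open>At \<open>p = 0\<close> the rate is 1. This is the cost, estimated without thinning, of
  the degree that \<open>u\<close> loses when the other endpoint of the edge under study is
  deleted.\<close>

lemma L_0_has_integral: "0 \<le> y \<Longrightarrow> (con\<^sub>1 has_integral L 0 y) {0..y}"
  using L_has_integral[of y 0] by (simp add: att_def)

definition K\<^sub>1 :: "real \<Rightarrow> real" where
  "K\<^sub>1 m = 5/48 - 18659/1680000 * m + 184577/5040000 * m^2 - 223/15750 * m^3"

definition L\<^sub>1 :: "real \<Rightarrow> real" where
  "L\<^sub>1 p = 179/3500 - 176543/5040000 * p + 223/15750 * p^2"

lemma K\<^sub>1_has_integral: "((\<lambda>y. 1 * K m y) has_integral K\<^sub>1 m) {0..1}"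
proof -
  let ?F = "\<lambda>y. 1/6 * y^3 - 1/10 * y^4 + 3/80 * y^5 - 1/15 * m * y^4 + 661/6000 * m * y^5 - 661/7500 * m * y^6 + 403/8400 * m * y^7 - 417/22400 * m * y^8 + 1/240 * m * y^9 + 1/12 * m^2 * y^4 - 1/20 * m^2 * y^5 + 211/45000 * m^2 * y^6 - 307/126000 * m^2 * y^7 + 17/22400 * m^2 * y^8 + 1/3600 * m^2 * y^9 - 1/20 * m^3 * y^5 + 263/4500 * m^3 * y^6 - 2269/63000 * m^3 * y^7 + 1/56 * m^3 * y^8 - 1/225 * m^3 * y^9"
  have "((\<lambda>y. 1 * K m y) has_integral ?F 1) {0..1}"
  proof (rule has_integral_from_0'[where F = ?F])
    show "(?F has_real_derivative 1/2 * y^2 - 2/5 * y^3 + 3/16 * y^4 - 4/15 * m * y^3 + 661/1200 * m * y^4 - 661/1250 * m * y^5 + 403/1200 * m * y^6 - 417/2800 * m * y^7 + 3/80 * m * y^8 + 1/3 * m^2 * y^3 - 1/4 * m^2 * y^4 + 211/7500 * m^2 * y^5 - 307/18000 * m^2 * y^6 + 17/2800 * m^2 * y^7 + 1/400 * m^2 * y^8 - 1/4 * m^3 * y^4 + 263/750 * m^3 * y^5 - 2269/9000 * m^3 * y^6 + 1/7 * m^3 * y^7 - 1/25 * m^3 * y^8) (at y)" for y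
      by (auto intro!: derivative_eq_intros)
  qed (simp, unfold K_def fade\<^sub>1_def fade\<^sub>2_def, algebra, simp)
  thus ?thesis by (simp add: K\<^sub>1_def algebra_simps)
qed

lemma L\<^sub>1_has_integral: "((\<lambda>y. 1 * L p y) has_integral L\<^sub>1 p) {0..1}"
proof -
  let ?F = "\<lambda>y. 1/12 * y^4 - 143/3000 * y^5 + 1/40 * y^6 - 1/105 * y^7 - 11/100 * p * y^5 + 5471/45000 * p * y^6 - 9383/126000 * p * y^7 + 817/22400 * p * y^8 - 31/3600 * p * y^9 + 1/20 * p^2 * y^5 - 263/4500 * p^2 * y^6 + 2269/63000 * p^2 * y^7 - 1/56 * p^2 * y^8 + 1/225 * p^2 * y^9"
  have "((\<lambda>y. 1 * L p y) has_integral ?F 1) {0..1}"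
  proof (rule has_integral_from_0'[where F = ?F])
    show "(?F has_real_derivative 1/3 * y^3 - 143/600 * y^4 + 3/20 * y^5 - 1/15 * y^6 - 11/20 * p * y^4 + 5471/7500 * p * y^5 - 9383/18000 * p * y^6 + 817/2800 * p * y^7 - 31/400 * p * y^8 + 1/4 * p^2 * y^4 - 263/750 * p^2 * y^5 + 2269/9000 * p^2 * y^6 - 1/7 * p^2 * y^7 + 1/25 * p^2 * y^8) (at y)" for y
      by (auto intro!: derivative_eq_intros)
  qed (simp, unfold L_def fade\<^sub>1_def fade\<^sub>2_def, algebra, simp)
  thus ?thesis by (simp add: L\<^sub>1_def algebra_simps)
qed

lemma id\<^sub>1_has_integral: "((\<lambda>y::real. 1 * y) has_integral 1/2) {0..1}"
proof -
  have "((\<lambda>y::real. 1 * y) has_integral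
    (\<lambda>y. 1/2 * y^2) 1) {0..1}"
    unfolding fade\<^sub>1_def fade\<^sub>2_def
    by (rule has_integral_from_0) (auto intro!: derivative_eq_intros simp: field_simps eval_nat_numeral)
  thus ?thesis by simp
qed

definition K\<^sub>2 :: "real \<Rightarrow> real" where
  "K\<^sub>2 m = 7491/112000 - 1180259/166320000 * m + 23261459/997920000 * m^2 - 28033/3118500 * m^3"

definition L\<^sub>2 :: "real \<Rightarrow> real" where
  "L\<^sub>2 p = 196913/6048000 - 22201661/997920000 * p + 28033/3118500 * p^2"

lemma K\<^sub>2_has_integral: "((\<lambda>y. (1 - (fade\<^sub>1 y + fade\<^sub>2 y) * (1/2)) * K m y) has_integral K\<^sub>2 m) {0..1}"
proof -
  let ?F = "\<lambda>y. 1/6 * y^3 - 19/80 * y^4 + 203/1000 * y^5 - 413/4800 * y^6 + 93/4480 * y^7 - 1/15 * m * y^4 + 1013/6000 * m * y^5 - 80483/360000 * m * y^6 + 1613291/8400000 * m * y^7 - 1949147/16800000 * m * y^8 + 31019/604800 * m * y^9 - 17547/1120000 * m * y^10 + 93/35200 * m * y^11 + 1/12 * m^2 * y^4 - 37/300 * m^2 * y^5 + 4211/45000 * m^2 * y^6 - 217577/6300000 * m^2 * y^7 + 146903/25200000 * m^2 * y^8 - 87679/45360000 * m^2 * y^9 + 219/1120000 * m^2 * y^10 + 31/176000 * m^2 * y^11 - 1/20 * m^3 * y^5 + 1877/18000 * m^3 * y^6 - 149687/1260000 * m^3 * y^7 + 217963/2520000 * m^3 * y^8 - 989173/22680000 *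 m^3 * y^9 + 1083/70000 * m^3 * y^10 - 31/11000 * m^3 * y^11"
  have "((\<lambda>y. (1 - (fade\<^sub>1 y + fade\<^sub>2 y) * (1/2)) * K m y) has_integral ?F 1) {0..1}"
  proof (rule has_integral_from_0'[where F = ?F])
    show "(?F has_real_derivative 1/2 * y^2 - 19/20 * y^3 + 203/200 * y^4 - 413/800 * y^5 + 93/640 * y^6 - 4/15 * m * y^3 + 1013/1200 * m * y^4 - 80483/60000 * m * y^5 + 1613291/1200000 * m * y^6 - 1949147/2100000 * m * y^7 + 31019/67200 * m * y^8 - 17547/112000 * m * y^9 + 93/3200 * m * y^10 + 1/3 * m^2 * y^3 - 37/60 * m^2 * y^4 + 4211/7500 * m^2 * y^5 - 217577/900000 * m^2 * y^6 + 146903/3150000 * m^2 * y^7 - 87679/5040000 * m^2 * y^8 + 219/112000 * m^2 * y^9 + 31/16000 * m^2 * y^10 - 1/4 * m^3 * y^4 + 1877/3000 * m^3 * y^5 - 149687/180000 * m^3 * y^6 + 217963/315000 * m^3 * y^7 - 989173/2520000 * m^3 * y^8 + 1083/7000 * m^3 * y^9 - 31/1000 * m^3 * y^10) (at y)" for y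
      by (auto intro!: derivative_eq_intros)
  qed (simp, unfold K_def fade\<^sub>1_def fade\<^sub>2_def, algebra, simp)
  thus ?thesis by (simp add: K\<^sub>2_def algebra_simps)
qed

lemma L\<^sub>2_has_integral: "((\<lambda>y. (1 - (fade\<^sub>1 y + fade\<^sub>2 y) * (1/2)) * L p y) has_integral L\<^sub>2 p) {0..1}"
proof -
  let ?F = "\<lambda>y. 1/12 * y^4 - 121/1000 * y^5 + 447/4000 * y^6 - 3331/56000 * y^7 + 91/3840 * y^8 - 31/5400 * y^9 - 11/100 * p * y^5 + 20017/90000 * p * y^6 - 1574947/6300000 * p * y^7 + 4506163/25200000 * p * y^8 - 4044371/45360000 * p * y^9 + 279/8960 * p * y^10 - 961/176000 * p * y^11 + 1/20 * p^2 * y^5 - 1877/18000 * p^2 * y^6 + 149687/1260000 * p^2 * y^7 - 217963/2520000 * p^2 * y^8 + 989173/22680000 * p^2 * y^9 - 1083/70000 * p^2 * y^10 + 31/11000 * p^2 * y^11"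
  have "((\<lambda>y. (1 - (fade\<^sub>1 y + fade\<^sub>2 y) * (1/2)) * L p y) has_integral ?F 1) {0..1}"
  proof (rule has_integral_from_0'[where F = ?F])
    show "(?F has_real_derivative 1/3 * y^3 - 121/200 * y^4 + 1341/2000 * y^5 - 3331/8000 * y^6 + 91/480 * y^7 - 31/600 * y^8 - 11/20 * p * y^4 + 20017/15000 * p * y^5 - 1574947/900000 * p * y^6 + 4506163/3150000 * p * y^7 - 4044371/5040000 * p * y^8 + 279/896 * p * y^9 - 961/16000 * p * y^10 + 1/4 * p^2 * y^4 - 1877/3000 * p^2 * y^5 + 149687/180000 * p^2 * y^6 - 217963/315000 * p^2 * y^7 + 989173/2520000 * p^2 * y^8 - 1083/7000 * p^2 * y^9 + 31/1000 * p^2 * y^10) (at y)" for y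
      by (auto intro!: derivative_eq_intros)
  qed (simp, unfold L_def fade\<^sub>1_def fade\<^sub>2_def, algebra, simp)
  thus ?thesis by (simp add: L\<^sub>2_def algebra_simps)
qed

lemma id\<^sub>2_has_integral: "((\<lambda>y::real. (1 - (fade\<^sub>1 y + fade\<^sub>2 y) * (1/2)) * y) has_integral 157/480) {0..1}"
proof -
  have "((\<lambda>y::real. (1 - (fade\<^sub>1 y + fade\<^sub>2 y) * (1/2)) * y) has_integral
    (\<lambda>y. 1/2 * y^2 - 11/30 * y^3 + 31/160 * y^4) 1) {0..1}"
    unfolding fade\<^sub>1_def fade\<^sub>2_def
    by (rule has_integral_from_0) (auto intro!: derivative_eq_intros simp: field_simps eval_nat_numeral)
  thus ?thesis by simp
qed

definition K\<^sub>3 :: "real \<Rightarrow> real" where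
  "K\<^sub>3 m = 9703/168000 - 853337/138600000 * m + 16608167/831600000 * m^2 - 635087/83160000 * m^3"

definition L\<^sub>3 :: "real \<Rightarrow> real" where
  "L\<^sub>3 p = 5591/201600 - 15695573/831600000 * p + 635087/83160000 * p^2"

lemma K\<^sub>3_has_integral: "((\<lambda>y. (1 - fade\<^sub>1 y) * K m y) has_integral K\<^sub>3 m) {0..1}"
proof -
  let ?F = "\<lambda>y. 1/6 * y^3 - 1/4 * y^4 + 417/2000 * y^5 - 7/80 * y^6 + 9/448 * y^7 - 1/15 * m * y^4 + 209/1200 * m * y^5 - 6949/30000 * m * y^6 + 830111/4200000 * m * y^7 - 66397/560000 * m * y^8 + 26213/504000 * m * y^9 - 351/22400 * m * y^10 + 9/3520 * m * y^11 + 1/12 * m^2 * y^4 - 13/100 * m^2 * y^5 + 542/5625 * m^2 * y^6 - 53621/1575000 * m^2 * y^7 + 2501/420000 * m^2 * y^8 - 2953/1512000 * m^2 * y^9 + 87/560000 * m^2 * y^10 + 3/17600 * m^2 * y^11 - 1/20 * m^3 * y^5 + 122/1125 * m^3 * y^6 - 77437/630000 * m^3 * y^7 + 74381/840000 * m^3 * y^8 - 33643/756000 * m^3 * y^9 + 543/35000 * m^3 * y^10 - 3/1100 * m^3 * y^11"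
  have "((\<lambda>y. (1 - fade\<^sub>1 y) * K m y) has_integral ?F 1) {0..1}"
  proof (rule has_integral_from_0'[where F = ?F])
    show "(?F has_real_derivative 1/2 * y^2 - 1 * y^3 + 417/400 * y^4 - 21/40 * y^5 + 9/64 * y^6 - 4/15 * m * y^3 + 209/240 * m * y^4 - 6949/5000 * m * y^5 + 830111/600000 * m * y^6 - 66397/70000 * m * y^7 + 26213/56000 * m * y^8 - 351/2240 * m * y^9 + 9/320 * m * y^10 + 1/3 * m^2 * y^3 - 13/20 * m^2 * y^4 + 1084/1875 * m^2 * y^5 - 53621/225000 * m^2 * y^6 + 2501/52500 * m^2 * y^7 - 2953/168000 * m^2 * y^8 + 87/56000 * m^2 * y^9 + 3/1600 * m^2 * y^10 - 1/4 * m^3 * y^4 + 244/375 * m^3 * y^5 - 77437/90000 * m^3 * y^6 + 74381/105000 * m^3 * y^7 - 33643/84000 * m^3 * y^8 + 543/3500 * m^3 * y^9 - 3/100 * m^3 * y^10) (at y)" for y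
      by (auto intro!: derivative_eq_intros)
  qed (simp, unfold K_def fade\<^sub>1_def fade\<^sub>2_def, algebra, simp)
  thus ?thesis by (simp add: K\<^sub>3_def algebra_simps)
qed

lemma L\<^sub>3_has_integral: "((\<lambda>y. (1 - fade\<^sub>1 y) * L p y) has_integral L\<^sub>3 p) {0..1}"
proof -
  let ?F = "\<lambda>y. 1/12 * y^4 - 383/3000 * y^5 + 343/3000 * y^6 - 1021/16800 * y^7 + 77/3200 * y^8 - 1/180 * y^9 - 11/100 * p * y^5 + 10421/45000 * p * y^6 - 50882/196875 * p * y^7 + 38441/210000 * p * y^8 - 5501/60480 * p * y^9 + 17463/560000 * p * y^10 - 93/17600 * p * y^11 + 1/20 * p^2 * y^5 - 122/1125 * p^2 * y^6 + 77437/630000 * p^2 * y^7 - 74381/840000 * p^2 * y^8 + 33643/756000 * p^2 * y^9 - 543/35000 * p^2 * y^10 + 3/1100 * p^2 * y^11"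
  have "((\<lambda>y. (1 - fade\<^sub>1 y) * L p y) has_integral ?F 1) {0..1}"
  proof (rule has_integral_from_0'[where F = ?F])
    show "(?F has_real_derivative 1/3 * y^3 - 383/600 * y^4 + 343/500 * y^5 - 1021/2400 * y^6 + 77/400 * y^7 - 1/20 * y^8 - 11/20 * p * y^4 + 10421/7500 * p * y^5 - 50882/28125 * p * y^6 + 38441/26250 * p * y^7 - 5501/6720 * p * y^8 + 17463/56000 * p * y^9 - 93/1600 * p * y^10 + 1/4 * p^2 * y^4 - 244/375 * p^2 * y^5 + 77437/90000 * p^2 * y^6 - 74381/105000 * p^2 * y^7 + 33643/84000 * p^2 * y^8 - 543/3500 * p^2 * y^9 + 3/100 * p^2 * y^10) (at y)" for y
      by (auto intro!: derivative_eq_intros)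
  qed (simp, unfold L_def fade\<^sub>1_def fade\<^sub>2_def, algebra, simp)
  thus ?thesis by (simp add: L\<^sub>3_def algebra_simps)
qed

lemma id\<^sub>3_has_integral: "((\<lambda>y::real. (1 - fade\<^sub>1 y) * y) has_integral 23/80) {0..1}"
proof -
  have "((\<lambda>y::real. (1 - fade\<^sub>1 y) * y) has_integral
    (\<lambda>y. 1/2 * y^2 - 2/5 * y^3 + 3/16 * y^4) 1) {0..1}"
    unfolding fade\<^sub>1_def fade\<^sub>2_def
    by (rule has_integral_from_0) (auto intro!: derivative_eq_intros simp: field_simps eval_nat_numeral)
  thus ?thesis by simp
qed

text \<open>
  The mixed term is separated by \<open>p * q * (L p + L q) \<le> p * x p + q * x q\<close>, where \<open>x p\<close> is
  \<open>p * L p\<close> as long as that is monotone, and a constant afterwards.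
\<close>

lemma pair_cost_le:
  fixes K L :: "real \<Rightarrow> real"
  assumes L: "\<And>p. L p = b - a * p + d * p^2"
    and coeffs: "0 \<le> b" "0 \<le> d" "2 * d \<le> a" "6/5 * a \<le> b" and mid: "L (3/5) \<le> 7/10 * b"
    and high: "\<And>m. 2/5 \<le> m \<Longrightarrow> m \<le> 1 \<Longrightarrow> 2 * K m + (1 - m) * L (1 - m) \<le> c"
    and low: "\<And>m. 0 \<le> m \<Longrightarrow> m \<le> 2/5 \<Longrightarrow> 2 * K m + 43/100 * b \<le> c"
    and pq: "0 \<le> p" "0 \<le> q" "p + q \<le> 1"
    and m: "0 \<le> m" "m \<le> 1 - p" "0 \<le> m'" "m' \<le> 1 - q"
  shows "p * (2 * K m) + q * (2 * K m') + p * q * (L p + L q) \<le> (p + q) * c"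
proof -
  \<comment> \<open>\<open>p * L p\<close> increases up to \<open>3/5\<close> because
    \<open>p + p' \<le> 6/5\<close> there and \<open>6/5 * a \<le> b\<close>. At \<open>3/5\<close>
    it is at most \<open>3/5 * 7/10 * b = 42/100 * b\<close> by \<open>mid\<close>, which is below
    the constant \<open>43/100 * b\<close>.\<close>
  define x where "x p = (if p \<le> 3/5 then p * L p else 43/100 * b)" for p :: real
  have diff: "p' * L p' - p * L p = (p' - p) * (b - a * (p + p') + d * (p^2 + p * p' + p'^2))" for p p'
    unfolding L by algebra
  have mono: "p * L p \<le> p' * L p'" if "0 \<le> p" "p \<le> p'" "p + p' \<le> 6/5" for p p'
  proof -
    have "a * (p + p') \<le> a * (6/5)" using that coeffs by (intro mult_left_mono) auto
    moreover have "0 \<le> d * (p^2 + p * p' + p'^2)" using that coeffs by simp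
    ultimately have "0 \<le> (p' - p) * (b - a * (p + p') + d * (p^2 + p * p' + p'^2))"
      using that coeffs by (intro mult_nonneg_nonneg) auto
    thus ?thesis using diff[of p' p] by linarith
  qed
  have antimono: "L p' \<le> L p" if "0 \<le> p" "p \<le> p'" "p' \<le> 1" for p p'
  proof -
    have "d * (p + p') \<le> d * 2" using that coeffs by (intro mult_left_mono) auto
    hence "0 \<le> (p' - p) * (a - d * (p + p'))"
      using that coeffs by (intro mult_nonneg_nonneg) auto
    thus ?thesis unfolding L by (simp add: algebra_simps power2_eq_square)
  qed
  \<comment> \<open>For \<open>m \<ge> 2/5\<close> every admissible \<open>p \<le> 1 - m\<close>
    lies in the increasing range, so \<open>p = 1 - m\<close> is the worst case and
    \<open>high\<close> applies. For smaller \<open>m\<close> the constant bounds \<open>x p\<close>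
    and \<open>low\<close> applies.\<close>
  have cost: "2 * K m + x p \<le> c" if "0 \<le> p" "0 \<le> m" "m \<le> 1 - p" for p m
  proof (cases "2/5 \<le> m")
    case True
    hence "x p \<le> (1 - m) * L (1 - m)" using that by (auto simp: x_def intro!: mono)
    thus ?thesis using high[of m] True that by linarith
  next
    case False
    have "p * L p \<le> 3/5 * L (3/5)" if "p \<le> 3/5" using that \<open>0 \<le> p\<close> by (intro mono) auto
    hence "x p \<le> 43/100 * b" using mid coeffs by (auto simp: x_def)
    thus ?thesis using low[of m] False that by linarith
  qed
  have swap: "p * q * (L p + L q) \<le> p * x p + q * x q"
    if "0 \<le> p" "0 \<le> q" "p + q \<le> 1" "q \<le> p" for p q
  proof (cases "p \<le> 3/5")
    case True
    \<comment> \<open>This product equals \<open>p * x p + q * x q - p * q * (L p + L q)\<close>, a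
      rearrangement inequality.\<close>
    have "0 \<le> (p - q) * (p * L p - q * L q)"
      using that True mono[of q p] by (intro mult_nonneg_nonneg) auto
    thus ?thesis using that True by (simp add: x_def algebra_simps)
  next
    case False
    have Lp: "L p \<le> 7/10 * b" using antimono[of "3/5" p] mid False that by auto
    have Lq: "L q \<le> b" using antimono[of 0 q] that by (auto simp: L)
    \<comment> \<open>With \<open>L p \<le> 7/10 * b\<close>, \<open>L q \<le> b\<close> and
      \<open>x p = 43/100 * b\<close> the claim reduces to this. Inserting
      \<open>p \<le> 1 - q\<close> leaves a quadratic in \<open>q\<close> whose minimum, at
      \<open>71/180\<close>, is positive.\<close>
    have "p * (17/10 * q - 43/100) \<le> q^2"
    proof (cases "17/10 * q - 43/100 \<le> 0")
      case True
      thus ?thesis using that by (smt (verit) mult_nonneg_nonpos zero_le_power2)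
    next
      case neg: False
      have "p * (17/10 * q - 43/100) \<le> (1 - q) * (17/10 * q - 43/100)"
        using that neg by (intro mult_right_mono) auto
      moreover have "q^2 - (1 - q) * (17/10 * q - 43/100) = 27/10 * (q - 71/180)^2 + 119/12000"
        by algebra
      moreover have "0 \<le> 27/10 * (q - 71/180)^2" by simp
      ultimately show ?thesis by linarith
    qed
    hence "(q * (p * (7/10) + (p - q))) * b \<le> (p * (43/100)) * b"
      using coeffs by (intro mult_right_mono) (auto simp: algebra_simps power2_eq_square)
    moreover have "q * (p * L p + (p - q) * L q) \<le> q * (p * (7/10 * b) + (p - q) * b)"
      using that Lp Lq by (intro mult_left_mono add_mono) auto
    moreover have "q \<le> 3/5" using that False by linarith
    ultimately show ?thesis using False by (simp add: x_def algebra_simps)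
  qed
  have "p * q * (L p + L q) \<le> p * x p + q * x q"
    using swap[of p q] swap[of q p] pq by (cases "q \<le> p") (auto simp: algebra_simps)
  moreover have "p * (2 * K m + x p) \<le> p * c" "q * (2 * K m' + x q) \<le> q * c"
    using cost[of p m] cost[of q m'] pq m by (auto intro!: mult_left_mono)
  ultimately show ?thesis by (simp add: algebra_simps)
qed

text \<open>Here \<open>b\<close>, \<open>a\<close>, \<open>d\<close> are read off
  \<open>L\<^sub>1\<close>, and \<open>2323/10000\<close> is a rounded bound for the two
  one-variable cubics of \<open>high\<close> and \<open>low\<close>. They are certified by Bernstein
  expansions on intervals with end points \<open>0\<close>, \<open>2/5\<close>, \<open>7/10\<close>,
  \<open>1\<close>.\<close>

lemma pair_cost\<^sub>1_le:
  assumes "0 \<le> p" "0 \<le> q" "p + q \<le> 1" "0 \<le> m" "m \<le> 1 - p" "0 \<le> m'" "m' \<le> 1 - q"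
  shows "p * (2 * K\<^sub>1 m) + q * (2 * K\<^sub>1 m') + p * q * (L\<^sub>1 p + L\<^sub>1 q) \<le> (p + q) * (2323/10000)"
proof (rule pair_cost_le[where K = K\<^sub>1 and L = L\<^sub>1 and c = "2323/10000" and b = "179/3500" and a = "176543/5040000" and d = "223/15750"])
  show "L\<^sub>1 p = 179/3500 - 176543/5040000 * p + 223/15750 * p^2" for p
    by (simp add: L\<^sub>1_def)
  show "2 * K\<^sub>1 m + (1 - m) * L\<^sub>1 (1 - m) \<le> 2323/10000" if "2/5 \<le> m" "m \<le> 1" for m
  proof (cases "m \<le> 7/10")
    case True
    have "2323/10000 - (2 * K\<^sub>1 m + (1 - m) * L\<^sub>1 (1 - m)) =
      76073/1134000 * (7/10 - m)^3 + 248503/1134000 * (m - 2/5) * (7/10 - m)^2 + 625763/4536000 * (m - 2/5)^2 * (7/10 - m) + 8581/302400 * (m - 2/5)^3"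
      unfolding K\<^sub>1_def L\<^sub>1_def by algebra
    moreover have "0 \<le> \<dots>" using that True by simp
    ultimately show ?thesis by linarith
  next
    case False
    have "2323/10000 - (2 * K\<^sub>1 m + (1 - m) * L\<^sub>1 (1 - m)) =
      8581/302400 * (1 - m)^3 + 146527/4536000 * (m - 7/10) * (1 - m)^2 + 1777/226800 * (m - 7/10)^2 * (1 - m) + 263/5670 * (m - 7/10)^3"
      unfolding K\<^sub>1_def L\<^sub>1_def by algebra
    moreover have "0 \<le> \<dots>" using that False by simp
    ultimately show ?thesis by linarith
  qed
  show "2 * K\<^sub>1 m + 43/100 * (179/3500) \<le> 2323/10000" if "0 \<le> m" "m \<le> 2/5" for m
  proof -
    have "2323/10000 - (2 * K\<^sub>1 m + 43/100 * (179/3500)) =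
      1037/33600 * (2/5 - m)^3 + 31103/134400 * m * (2/5 - m)^2 + 94319/504000 * m^2 * (2/5 - m) + 10013/672000 * m^3"
      unfolding K\<^sub>1_def L\<^sub>1_def by algebra
    moreover have "0 \<le> \<dots>" using that by simp
    ultimately show ?thesis by linarith
  qed
qed (use assms in \<open>simp_all add: L\<^sub>1_def power2_eq_square\<close>)

lemma pair_cost\<^sub>2_le:
  assumes "0 \<le> p" "0 \<le> q" "p + q \<le> 1" "0 \<le> m" "m \<le> 1 - p" "0 \<le> m'" "m' \<le> 1 - q"
  shows "p * (2 * K\<^sub>2 m) + q * (2 * K\<^sub>2 m') + p * q * (L\<^sub>2 p + L\<^sub>2 q) \<le> (p + q) * (149/1000)"
proof (rule pair_cost_le[where K = K\<^sub>2 and L = L\<^sub>2 and c = "149/1000" and b = "196913/6048000" and a = "22201661/997920000" and d = "28033/3118500"])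
  show "L\<^sub>2 p = 196913/6048000 - 22201661/997920000 * p + 28033/3118500 * p^2" for p
    by (simp add: L\<^sub>2_def)
  show "2 * K\<^sub>2 m + (1 - m) * L\<^sub>2 (1 - m) \<le> 149/1000" if "2/5 \<le> m" "m \<le> 1" for m
  proof (cases "m \<le> 7/10")
    case True
    have "149/1000 - (2 * K\<^sub>2 m + (1 - m) * L\<^sub>2 (1 - m)) =
      188473/4490640 * (7/10 - m)^3 + 62008739/449064000 * (m - 2/5) * (7/10 - m)^2 + 78134393/898128000 * (m - 2/5)^2 * (7/10 - m) + 485819/27216000 * (m - 2/5)^3"
      unfolding K\<^sub>2_def L\<^sub>2_def by algebra
    moreover have "0 \<le> \<dots>" using that True by simp
    ultimately show ?thesis by linarith
  next
    case False
    have "149/1000 - (2 * K\<^sub>2 m + (1 - m) * L\<^sub>2 (1 - m)) =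
      485819/27216000 * (1 - m)^3 + 18057769/898128000 * (m - 7/10) * (1 - m)^2 + 386423/89812800 * (m - 7/10)^2 * (1 - m) + 2369/81648 * (m - 7/10)^3"
      unfolding K\<^sub>2_def L\<^sub>2_def by algebra
    moreover have "0 \<le> \<dots>" using that False by simp
    ultimately show ?thesis by linarith
  qed
  show "2 * K\<^sub>2 m + 43/100 * (196913/6048000) \<le> 149/1000" if "0 \<le> m" "m \<le> 2/5" for m
  proof -
    have "149/1000 - (2 * K\<^sub>2 m + 43/100 * (196913/6048000)) =
      745141/38707200 * (2/5 - m)^3 + 62357941/425779200 * m * (2/5 - m)^2 + 757526747/6386688000 * m^2 * (2/5 - m) + 21139/2252800 * m^3"
      unfolding K\<^sub>2_def L\<^sub>2_def by algebra
    moreover have "0 \<le> \<dots>" using that by simp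
    ultimately show ?thesis by linarith
  qed
qed (use assms in \<open>simp_all add: L\<^sub>2_def power2_eq_square\<close>)

lemma pair_cost\<^sub>3_le:
  assumes "0 \<le> p" "0 \<le> q" "p + q \<le> 1" "0 \<le> m" "m \<le> 1 - p" "0 \<le> m'" "m' \<le> 1 - q"
  shows "p * (2 * K\<^sub>3 m) + q * (2 * K\<^sub>3 m') + p * q * (L\<^sub>3 p + L\<^sub>3 q) \<le> (p + q) * (643/5000)"
proof (rule pair_cost_le[where K = K\<^sub>3 and L = L\<^sub>3 and c = "643/5000" and b = "5591/201600" and a = "15695573/831600000" and d = "635087/83160000"])
  show "L\<^sub>3 p = 5591/201600 - 15695573/831600000 * p + 635087/83160000 * p^2" for p
    by (simp add: L\<^sub>3_def)
  show "2 * K\<^sub>3 m + (1 - m) * L\<^sub>3 (1 - m) \<le> 643/5000" if "2/5 \<le> m" "m \<le> 1" for m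
  proof (cases "m \<le> 7/10")
    case True
    have "643/5000 - (2 * K\<^sub>3 m + (1 - m) * L\<^sub>3 (1 - m)) =
      3830287/93555000 * (7/10 - m)^3 + 50218139/374220000 * (m - 2/5) * (7/10 - m)^2 + 67814951/748440000 * (m - 2/5)^2 * (7/10 - m) + 229823/11340000 * (m - 2/5)^3"
      unfolding K\<^sub>3_def L\<^sub>3_def by algebra
    moreover have "0 \<le> \<dots>" using that True by simp
    ultimately show ?thesis by linarith
  next
    case False
    have "643/5000 - (2 * K\<^sub>3 m + (1 - m) * L\<^sub>3 (1 - m)) =
      229823/11340000 * (1 - m)^3 + 23194957/748440000 * (m - 7/10) * (1 - m)^2 + 159947/10692000 * (m - 7/10)^2 * (1 - m) + 1847/68040 * (m - 7/10)^3"
      unfolding K\<^sub>3_def L\<^sub>3_def by algebra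
    moreover have "0 \<le> \<dots>" using that False by simp
    ultimately show ?thesis by linarith
  qed
  show "2 * K\<^sub>3 m + 43/100 * (5591/201600) \<le> 643/5000" if "0 \<le> m" "m \<le> 2/5" for m
  proof -
    have "643/5000 - (2 * K\<^sub>3 m + 43/100 * (5591/201600)) =
      3349/184320 * (2/5 - m)^3 + 46647259/354816000 * m * (2/5 - m)^2 + 577849301/5322240000 * m^2 * (2/5 - m) + 6237103/591360000 * m^3"
      unfolding K\<^sub>3_def L\<^sub>3_def by algebra
    moreover have "0 \<le> \<dots>" using that by simp
    ultimately show ?thesis by linarith
  qed
qed (use assms in \<open>simp_all add: L\<^sub>3_def power2_eq_square\<close>)

lemma L_0: "L\<^sub>1 0 = 179/3500" "L\<^sub>2 0 = 196913/6048000" "L\<^sub>3 0 = 5591/201600"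
  by (simp_all add: L\<^sub>1_def L\<^sub>2_def L\<^sub>3_def)

text \<open>A quartic in \<open>m\<close>, expanded in the Bernstein basis on each half of the unit
  interval. The minimum is at \<open>m = 1\<close>, where only the first weight survives and the
  value is \<open>1 - 2 * 2323/10000\<close>.\<close>

lemma final_value:
  assumes "0 \<le> m" "m \<le> 1"
  shows "669/1250 \<le> m^2 * (2 * (1/2) - 2 * m * (2323/10000 + (1 - m) * L\<^sub>1 0)) + 2 * m * (1 - m) * (2 * (157/480) - 2 * m * (149/1000 + (1 - m) * L\<^sub>2 0)) + (1 - m)^2 * (2 * (23/80) - 2 * m * (643/5000 + (1 - m) * L\<^sub>3 0))"
    (is "_ \<le> ?V")
proof (cases "m \<le> 1/2")
  case True
  have "?V - 669/1250 = 398/625 * (1/2 - m)^4 + 413449/315000 * m * (1/2 - m)^3 + 473321/472500 * m^2 * (1/2 - m)^2 + 260843/756000 * m^3 * (1/2 - m) + 175951/3780000 * m^4"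
    unfolding L_0 by algebra
  moreover have "0 \<le> \<dots>" using assms True by simp
  ultimately show ?thesis by linarith
next
  case False
  have "?V - 669/1250 = 175951/3780000 * (1 - m)^4 + 103393/3780000 * (m - 1/2) * (1 - m)^3 + 92051/1890000 * (m - 1/2)^2 * (1 - m)^2 + 572/13125 * (m - 1/2)^3 * (1 - m) + 2/625 * (m - 1/2)^4"
    unfolding L_0 by algebra
  moreover have "0 \<le> \<dots>" using assms False by simp
  ultimately show ?thesis by linarith
qed

context vacancy_recursion begin

text \<open>The recursion on \<open>V - {v}\<close>, fed with \<open>\<phi>_upper\<^sub>1\<close>.
  The two degrees in the bracket fall short of \<open>2 * excess u w\<close> by
  \<open>X u v + X v w\<close>. The deficit \<open>X u v\<close> is charged at rate 1. The deficit
  \<open>X v w\<close> is charged at rate \<open>att (1 - X u w)\<close>, so that its cost is a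
  function of \<open>X u w\<close> and combines with the symmetric term of \<open>v\<close>.\<close>

lemma \<phi>_remove_lower:
  assumes uv: "u \<in> V" "v \<in> V" "u \<noteq> v" and y: "0 \<le> y" "y \<le> 1"
  shows "y - (\<Sum>w\<in>V - {u, v}. X u w *
      (2 * K (excess u w) y + X u v * L 0 y + X v w * L (X u w) y)) \<le> \<phi> (V - {v}) u y"
proof -
  let ?S = "V - {v}"
  have "integral {0..y} (\<lambda>s. att (excess u w) s * (\<phi> (?S - {w}) u s + \<phi> (?S - {u}) w s)) \<le>
      2 * K (excess u w) y + X u v * L 0 y + X v w * L (X u w) y"
    if w: "w \<in> V - {u, v}" for w
  proof -
    define e where "e = excess u w"
    define p where "p = X u w"
    define q where "q = X v w"
    define z where "z = X u v"
    have nonneg: "0 \<le> p" "0 \<le> q" "0 \<le> z" by (simp_all add: p_def q_def z_def X_nonneg)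
    have "((\<lambda>s. 2 * (att e s * (s - e * con\<^sub>1 s)) + z * con\<^sub>1 s + q * (att (1 - p) s * con\<^sub>1 s))
        has_integral (2 * K e y + z * L 0 y + q * L p y)) {0..y}"
      by (intro has_integral_add has_integral_mult_right K_has_integral L_has_integral
          L_0_has_integral y)
    moreover have "att e s * (\<phi> (?S - {w}) u s + \<phi> (?S - {u}) w s) \<le>
        2 * (att e s * (s - e * con\<^sub>1 s)) + z * con\<^sub>1 s + q * (att (1 - p) s * con\<^sub>1 s)"
      if s: "0 \<le> s" "s \<le> y" for s
    proof -
      have b: "0 \<le> e" "e \<le> 1 - p" "e \<le> 1" "0 \<le> s" "s \<le> 1" "0 \<le> con\<^sub>1 s"
        using excess_bounds[of u w] w uv s y con\<^sub>1_nonneg[of s] by (auto simp: e_def p_def)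
      have "wdeg_in (?S - {w}) u = wdeg u - z - p" "wdeg_in (?S - {u}) w = wdeg w - q - p"
        using wdeg_in_remove[of ?S w u] wdeg_in_remove[of V v u]
          wdeg_in_remove[of ?S u w] wdeg_in_remove[of V v w] w uv
        by (auto simp: wdeg_in_V z_def p_def q_def X_sym)
      hence "\<phi> (?S - {w}) u s \<le> s - (wdeg u - z - p) * con\<^sub>1 s"
            "\<phi> (?S - {u}) w s \<le> s - (wdeg w - q - p) * con\<^sub>1 s"
        using \<phi>_upper\<^sub>1[of "?S - {w}" u s] \<phi>_upper\<^sub>1[of "?S - {u}" w s] w uv s y by auto
      moreover have "wdeg u = 2 * e + 2 * p - wdeg w"
        by (simp add: e_def excess_def p_def field_simps)
      ultimately have "\<phi> (?S - {w}) u s + \<phi> (?S - {u}) w s \<le>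
          2 * (s - e * con\<^sub>1 s) + z * con\<^sub>1 s + q * con\<^sub>1 s"
        by (simp add: algebra_simps)
      hence "att e s * (\<phi> (?S - {w}) u s + \<phi> (?S - {u}) w s) \<le>
          att e s * (2 * (s - e * con\<^sub>1 s) + z * con\<^sub>1 s + q * con\<^sub>1 s)"
        using b by (intro mult_left_mono att_bounds)
      also have "\<dots> = 2 * (att e s * (s - e * con\<^sub>1 s)) + z * (att e s * con\<^sub>1 s) + q * (att e s * con\<^sub>1 s)"
        by (simp add: algebra_simps)
      also have "\<dots> \<le> 2 * (att e s * (s - e * con\<^sub>1 s)) + z * (1 * con\<^sub>1 s) + q * (att (1 - p) s * con\<^sub>1 s)"
        using b nonneg by (intro add_mono order.refl mult_left_mono mult_right_mono att_bounds att_mono)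
      finally show ?thesis by simp
    qed
    ultimately have "integral {0..y} (\<lambda>s. att e s * (\<phi> (?S - {w}) u s + \<phi> (?S - {u}) w s)) \<le>
        2 * K e y + z * L 0 y + q * L p y"
      using w uv y by (intro has_integral_le[OF integrable_integral[OF pair_integrable]]) auto
    thus ?thesis by (simp add: e_def p_def q_def z_def)
  qed
  hence "(\<Sum>w\<in>?S - {u}. X u w *
        integral {0..y} (\<lambda>s. att (excess u w) s * (\<phi> (?S - {w}) u s + \<phi> (?S - {u}) w s))) \<le>
      (\<Sum>w\<in>V - {u, v}. X u w * (2 * K (excess u w) y + X u v * L 0 y + X v w * L (X u w) y))"
    by (simp only: Diff_insert2[of V v "{u}", symmetric] insert_commute[of v u], intro sum_mono mult_left_mono X_nonneg) auto
  thus ?thesis using \<phi>_rec[of ?S u y] uv y by auto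
qed

text \<open>\<open>G\<close> is the total loss over both arrival orders of \<open>u\<close> and
  \<open>v\<close>. It splits over the third vertices \<open>w\<close>, where
  \<open>p = X u w\<close> and \<open>q = X v w\<close> satisfy
  \<open>p + q \<le> wdeg w \<le> 1\<close>. The pair costs bound the loss per unit of
  \<open>p + q\<close>, and all units together amount to \<open>2 * excess u v\<close>.\<close>

lemma acceptance_integral_ge:
  assumes uv: "u \<in> V" "v \<in> V" "u \<noteq> v"
  shows "669/1250 \<le> integral {0..1} (\<lambda>y. att (excess u v) y * (\<phi> (V - {v}) u y + \<phi> (V - {u}) v y))"
proof -
  define M where "M = excess u v"
  define z where "z = X u v"
  define W where "W = V - {u, v}"
  define G where "G k l = (\<Sum>w\<in>W.
      X u w * (2 * k (excess u w)) + X v w * (2 * k (excess v w))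
      + X u w * X v w * (l (X u w) + l (X v w)) + (X u w + X v w) * z * l 0)"
    for k l :: "real \<Rightarrow> real"
  have M: "0 \<le> M" "M \<le> 1" using excess_bounds[of u v] uv by (auto simp: M_def)
  have z: "0 \<le> z" "z \<le> 1 - M" using excess_bounds[of u v] uv X_nonneg by (auto simp: M_def z_def)
  have sum: "(\<Sum>w\<in>W. X u w + X v w) = 2 * M"
  proof -
    have "(\<Sum>w\<in>W. X u w) = wdeg_in (V - {v}) u" "(\<Sum>w\<in>W. X v w) = wdeg_in (V - {u}) v"
      unfolding wdeg_in_def W_def by (auto intro!: sum.cong)
    thus ?thesis
      using wdeg_in_remove[of V v u] wdeg_in_remove[of V u v] uv
      by (simp add: sum.distrib wdeg_in_V M_def excess_def X_sym)
  qed
  have lower: "2 * y - G (\<lambda>m. K m y) (\<lambda>p. L p y) \<le> \<phi> (V - {v}) u y + \<phi> (V - {u}) v y"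
    if y: "0 \<le> y" "y \<le> 1" for y
  proof -
    have "G (\<lambda>m. K m y) (\<lambda>p. L p y) =
        (\<Sum>w\<in>V - {u, v}. X u w * (2 * K (excess u w) y + X u v * L 0 y + X v w * L (X u w) y)) +
        (\<Sum>w\<in>V - {v, u}. X v w * (2 * K (excess v w) y + X v u * L 0 y + X u w * L (X v w) y))"
      unfolding G_def W_def z_def insert_commute[of v u] sum.distrib[symmetric]
      by (rule sum.cong) (simp_all add: algebra_simps X_sym[of v u])
    thus ?thesis
      using \<phi>_remove_lower[of u v y] \<phi>_remove_lower[of v u y] uv y by auto
  qed
  \<comment> \<open>\<open>G\<close> is linear in \<open>k\<close> and \<open>l\<close> jointly, so
    integrating against a weight replaces \<open>K\<close> and \<open>L\<close> by their weighted
    integrals.\<close>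
  have weight: "((\<lambda>y. w y * (2 * y - G (\<lambda>m. K m y) (\<lambda>p. L p y))) has_integral (2 * i - G k l)) {0..1}"
    if "((\<lambda>y. w y * y) has_integral i) {0..1}"
      "\<And>m. ((\<lambda>y. w y * K m y) has_integral k m) {0..1}"
      "\<And>p. ((\<lambda>y. w y * L p y) has_integral l p) {0..1}"
    for w i k l
  proof -
    have "((\<lambda>y. 2 * (w y * y) - G (\<lambda>m. w y * K m y) (\<lambda>p. w y * L p y)) has_integral (2 * i - G k l)) {0..1}"
      unfolding G_def using finite_V
      by (intro has_integral_diff has_integral_sum has_integral_add has_integral_mult_right that)
         (auto simp: W_def)
    moreover have "G (\<lambda>m. w y * K m y) (\<lambda>p. w y * L p y) = w y * G (\<lambda>m. K m y) (\<lambda>p. L p y)" for y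
      unfolding G_def sum_distrib_left by (rule sum.cong) (auto simp: algebra_simps)
    ultimately show ?thesis by (simp add: algebra_simps)
  qed
  have G_le: "G k l \<le> 2 * M * (c + (1 - M) * l 0)"
    if cost: "\<And>p q m m'. 0 \<le> p \<Longrightarrow> 0 \<le> q \<Longrightarrow> p + q \<le> 1 \<Longrightarrow> 0 \<le> m \<Longrightarrow> m \<le> 1 - p \<Longrightarrow> 0 \<le> m' \<Longrightarrow>
        m' \<le> 1 - q \<Longrightarrow> p * (2 * k m) + q * (2 * k m') + p * q * (l p + l q) \<le> (p + q) * c"
      and l: "0 \<le> l 0" for k l c
  proof -
    have "G k l \<le> (\<Sum>w\<in>W. (X u w + X v w) * c + (X u w + X v w) * z * l 0)"
      unfolding G_def
    proof (intro sum_mono add_mono order.refl cost X_nonneg)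
      fix w assume w: "w \<in> W"
      hence "X u w + X v w \<le> wdeg w"
        using uv X_le_wdeg_in[of "V - {u}" v w] wdeg_in_remove[of V u w]
        by (auto simp: W_def wdeg_in_V X_sym)
      also have "\<dots> \<le> 1" using w X_sum_le by (auto simp: W_def wdeg_def)
      finally show "X u w + X v w \<le> 1" .
    qed (use excess_bounds uv in \<open>auto simp: W_def\<close>)
    also have "\<dots> = 2 * M * (c + z * l 0)"
      unfolding sum[symmetric] sum_distrib_right[symmetric] by (simp add: sum.distrib sum_distrib_left sum_distrib_right algebra_simps)
    also have "\<dots> \<le> 2 * M * (c + (1 - M) * l 0)"
      using M z l by (intro mult_left_mono add_left_mono mult_right_mono) auto
    finally show ?thesis .
  qed
  define H where "H y = 2 * y - G (\<lambda>m. K m y) (\<lambda>p. L p y)" for y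
  have "((\<lambda>y. M^2 * (1 * H y) + 2 * M * (1 - M) * ((1 - (fade\<^sub>1 y + fade\<^sub>2 y) * (1/2)) * H y)
        + (1 - M)^2 * ((1 - fade\<^sub>1 y) * H y)) has_integral
      (M^2 * (2 * (1/2) - G K\<^sub>1 L\<^sub>1) + 2 * M * (1 - M) * (2 * (157/480) - G K\<^sub>2 L\<^sub>2)
        + (1 - M)^2 * (2 * (23/80) - G K\<^sub>3 L\<^sub>3))) {0..1}"
    unfolding H_def
    by (intro has_integral_add has_integral_mult_right weight
        id\<^sub>1_has_integral id\<^sub>2_has_integral id\<^sub>3_has_integral
        K\<^sub>1_has_integral K\<^sub>2_has_integral K\<^sub>3_has_integral
        L\<^sub>1_has_integral L\<^sub>2_has_integral L\<^sub>3_has_integral)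
  moreover have "att M y * H y = M^2 * (1 * H y)
      + 2 * M * (1 - M) * ((1 - (fade\<^sub>1 y + fade\<^sub>2 y) * (1/2)) * H y)
      + (1 - M)^2 * ((1 - fade\<^sub>1 y) * H y)" for y
    unfolding att_bernstein by algebra
  ultimately have "((\<lambda>y. att M y * (2 * y - G (\<lambda>m. K m y) (\<lambda>p. L p y))) has_integral
      (M^2 * (2 * (1/2) - G K\<^sub>1 L\<^sub>1) + 2 * M * (1 - M) * (2 * (157/480) - G K\<^sub>2 L\<^sub>2)
        + (1 - M)^2 * (2 * (23/80) - G K\<^sub>3 L\<^sub>3))) {0..1}"
    by (simp add: H_def)
  moreover have "(\<lambda>y. att M y * (\<phi> (V - {v}) u y + \<phi> (V - {u}) v y)) integrable_on {0..1}"
    using uv by (intro pair_integrable) auto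
  moreover have "att M y * (2 * y - G (\<lambda>m. K m y) (\<lambda>p. L p y)) \<le>
      att M y * (\<phi> (V - {v}) u y + \<phi> (V - {u}) v y)" if "y \<in> {0..1}" for y
    using that M lower by (intro mult_left_mono att_bounds) auto
  ultimately have "M^2 * (2 * (1/2) - G K\<^sub>1 L\<^sub>1) + 2 * M * (1 - M) * (2 * (157/480) - G K\<^sub>2 L\<^sub>2)
        + (1 - M)^2 * (2 * (23/80) - G K\<^sub>3 L\<^sub>3) \<le>
      integral {0..1} (\<lambda>y. att M y * (\<phi> (V - {v}) u y + \<phi> (V - {u}) v y))"
    by (intro has_integral_le[OF _ integrable_integral]) auto
  moreover have "M^2 * (2 * (1/2) - 2 * M * (2323/10000 + (1 - M) * L\<^sub>1 0)) +
        2 * M * (1 - M) * (2 * (157/480) - 2 * M * (149/1000 + (1 - M) * L\<^sub>2 0)) +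
        (1 - M)^2 * (2 * (23/80) - 2 * M * (643/5000 + (1 - M) * L\<^sub>3 0)) \<le>
      M^2 * (2 * (1/2) - G K\<^sub>1 L\<^sub>1) + 2 * M * (1 - M) * (2 * (157/480) - G K\<^sub>2 L\<^sub>2)
        + (1 - M)^2 * (2 * (23/80) - G K\<^sub>3 L\<^sub>3)"
    using M by (intro add_mono mult_left_mono diff_mono order.refl G_le
        pair_cost\<^sub>1_le pair_cost\<^sub>2_le pair_cost\<^sub>3_le)
      (auto simp: L_0)
  ultimately show ?thesis
    using final_value[of M] M by (simp add: M_def)
qed

end


section \<open>The thinned arrival process\<close>

interpretation unif: prob_space unif
  by (rule prob_space_uniform_measure) auto

lemma emeasure_unif_lessThan: "0 \<le> c \<Longrightarrow> c \<le> 1 \<Longrightarrow> emeasure unif {..<c} = ennreal c"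
proof -
  assume c: "0 \<le> c" "c \<le> 1"
  have "{0..1} \<inter> {..<c} = {0..<c}" using c by auto
  thus ?thesis using c by (simp add: emeasure_uniform_measure divide_ennreal_def)
qed

lemma emeasure_unif_singleton: "emeasure unif {c} = 0"
proof -
  have "emeasure lborel ({0..1} \<inter> {c}) \<le> emeasure lborel {c}"
    by (intro emeasure_mono) auto
  thus ?thesis by simp
qed

lemma nn_integral_unif:
  "f \<in> borel_measurable borel \<Longrightarrow> (\<integral>\<^sup>+ s. f s \<partial>unif) = (\<integral>\<^sup>+ s. f s * indicator {0..1} s \<partial>lborel)"
  by (subst nn_integral_uniform_measure) (auto simp: divide_ennreal_def)

type_synonym sample = "nat option \<times> real \<times> real"

abbreviation arr :: "(nat \<Rightarrow> sample) \<Rightarrow> nat \<Rightarrow> real" where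
  "arr \<zeta> v \<equiv> fst (snd (\<zeta> v))"

locale thinned_arrivals =
  fixes ch :: "nat \<Rightarrow> nat option pmf" and r :: "nat \<Rightarrow> nat \<Rightarrow> real \<Rightarrow> real"
  assumes r_measurable [measurable]: "r w u \<in> borel_measurable borel"
begin

text \<open>Choice, arrival time and coin of a vertex are bundled, so that deleting a vertex means
  integrating out a single coordinate of a product measure.\<close>

definition smp :: "nat \<Rightarrow> sample measure" where
  "smp v = measure_pmf (ch v) \<Otimes>\<^sub>M unif \<Otimes>\<^sub>M unif"

definition req :: "(nat \<Rightarrow> sample) \<Rightarrow> nat \<Rightarrow> nat \<Rightarrow> bool" where
  "req \<zeta> w u \<longleftrightarrow> fst (\<zeta> w) = Some u \<and> snd (snd (\<zeta> w)) < r w u (arr \<zeta> w)"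

text \<open>
  Whether \<open>u\<close> is matched before time \<open>t\<close> is determined by recursion on time; the natural number bounds
  the recursion depth, for which \<open>card S\<close> is always enough.
\<close>

primrec taken_upto :: "nat \<Rightarrow> nat set \<Rightarrow> (nat \<Rightarrow> sample) \<Rightarrow> nat \<Rightarrow> real \<Rightarrow> bool" where
  "taken_upto 0 S \<zeta> u t = False"
| "taken_upto (Suc k) S \<zeta> u t =
     ((\<exists>w\<in>S. arr \<zeta> u < arr \<zeta> w \<and> arr \<zeta> w < t \<and> req \<zeta> w u \<and> \<not> taken_upto k S \<zeta> u (arr \<zeta> w)) \<or>
      (\<exists>w\<in>S. arr \<zeta> w < arr \<zeta> u \<and> arr \<zeta> u < t \<and> req \<zeta> u w \<and> \<not> taken_upto k S \<zeta> w (arr \<zeta> u)))"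

definition taken :: "nat set \<Rightarrow> (nat \<Rightarrow> sample) \<Rightarrow> nat \<Rightarrow> real \<Rightarrow> bool" where
  "taken S = taken_upto (card S) S"

text \<open>The edge between \<open>u\<close> and \<open>w\<close> enters the matching before time
  \<open>t\<close>, with \<open>w\<close> as its later endpoint. Only the vacancy of
  \<open>u\<close> is tested, because \<open>w\<close> is free at its own arrival.\<close>

definition late :: "nat set \<Rightarrow> (nat \<Rightarrow> sample) \<Rightarrow> nat \<Rightarrow> nat \<Rightarrow> real \<Rightarrow> bool" where
  "late S \<zeta> w u t \<longleftrightarrow> arr \<zeta> u < arr \<zeta> w \<and> arr \<zeta> w < t \<and> req \<zeta> w u \<and> \<not> taken S \<zeta> u (arr \<zeta> w)"

definition vacancy :: "nat set \<Rightarrow> nat \<Rightarrow> real \<Rightarrow> real" where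
  "vacancy S u y = measure (PiM S smp) {\<zeta> \<in> space (PiM S smp). arr \<zeta> u < y \<and> \<not> taken S \<zeta> u y}"

text \<open>A recursive call is made at the arrival time of some vertex of \<open>S\<close> arriving
  before \<open>t\<close>, and strictly fewer vertices arrive before that time. When none arrives
  before \<open>t\<close>, both disjuncts are false at any depth.\<close>

lemma taken_upto_stable:
  assumes "finite S" "u \<in> S" "card {w\<in>S. arr \<zeta> w < t} \<le> k"
  shows "taken_upto (Suc k) S \<zeta> u t = taken_upto k S \<zeta> u t"
  using assms(2,3)
proof (induction k arbitrary: u t)
  case 0
  hence "{w\<in>S. arr \<zeta> w < t} = {}" using assms(1) by simp
  thus ?case using 0 by auto
next
  case (Suc k)
  have less: "card {w\<in>S. arr \<zeta> w < arr \<zeta> v} \<le> k" if "v \<in> S" "arr \<zeta> v < t" for v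
  proof -
    have "card {w\<in>S. arr \<zeta> w < arr \<zeta> v} < card {w\<in>S. arr \<zeta> w < t}"
      using that assms(1) by (intro psubset_card_mono) auto
    thus ?thesis using Suc.prems by linarith
  qed
  have "taken_upto (Suc k) S \<zeta> v (arr \<zeta> w) = taken_upto k S \<zeta> v (arr \<zeta> w)"
    if "v \<in> S" "w \<in> S" "arr \<zeta> w < t" for v w
    using Suc.IH[of v] less[of w] that by blast
  thus ?case
    unfolding taken_upto.simps(2)[of "Suc k" S \<zeta> u t] taken_upto.simps(2)[of k S \<zeta> u t]
    using Suc.prems(1) by blast
qed

lemma taken_iff:
  assumes "finite S" "u \<in> S"
  shows "taken S \<zeta> u t \<longleftrightarrow> (\<exists>w\<in>S. late S \<zeta> w u t) \<or> (\<exists>w\<in>S. late S \<zeta> u w t)"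
proof -
  have "card {w\<in>S. arr \<zeta> w < t} \<le> card S"
    using assms by (intro card_mono) auto
  hence "taken S \<zeta> u t = taken_upto (Suc (card S)) S \<zeta> u t"
    using taken_upto_stable[OF assms] by (simp add: taken_def)
  thus ?thesis by (auto simp: taken_def late_def)
qed

lemma taken_cong:
  assumes "finite S" "u \<in> S" "\<And>w. w \<in> S \<Longrightarrow> \<zeta> w = \<zeta>' w"
  shows "taken S \<zeta> u t = taken S \<zeta>' u t"
proof -
  have "taken_upto k S \<zeta> u t = taken_upto k S \<zeta>' u t" for k
    using assms(2) by (induction k arbitrary: u t) (simp_all add: assms(3) req_def)
  thus ?thesis by (simp add: taken_def)
qed

text \<open>Both endpoints of an edge completed before \<open>t\<close> arrive before
  \<open>t\<close>, so neither of them is \<open>v\<close>. As \<open>late\<close> refers back to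
  \<open>taken\<close> at an earlier arrival, the induction is on the number of arrivals before
  \<open>t\<close>.\<close>

lemma taken_remove:
  assumes "finite S" "u \<in> S" "u \<noteq> v" "t \<le> arr \<zeta> v"
  shows "taken S \<zeta> u t = taken (S - {v}) \<zeta> u t"
  using assms(2-)
proof (induction "card {w\<in>S. arr \<zeta> w < t}" arbitrary: u t rule: less_induct)
  case less
  have IH: "taken S \<zeta> a (arr \<zeta> w) = taken (S - {v}) \<zeta> a (arr \<zeta> w)"
    if "a \<in> S" "a \<noteq> v" "w \<in> S" "arr \<zeta> w < t" for a w
  proof (rule less.hyps)
    show "card {x\<in>S. arr \<zeta> x < arr \<zeta> w} < card {x\<in>S. arr \<zeta> x < t}"
      using that assms(1) by (intro psubset_card_mono) auto
  qed (use that less.prems in auto)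
  have "late S \<zeta> w u t = late (S - {v}) \<zeta> w u t" if "w \<in> S" for w
    using that less.prems IH[of u w] by (auto simp: late_def)
  moreover have "late S \<zeta> u w t = late (S - {v}) \<zeta> u w t" if "w \<in> S" for w
    using that less.prems IH[of w u] by (cases "w = v") (auto simp: late_def)
  moreover have "w \<noteq> v" if "w \<in> S" "late S \<zeta> w u t \<or> late S \<zeta> u w t" for w
    using that less.prems by (auto simp: late_def)
  moreover have "finite (S - {v})" "u \<in> S - {v}" using assms(1) less.prems by auto
  ultimately show ?case
    unfolding taken_iff[OF assms(1) less.prems(1)] taken_iff[OF \<open>finite (S - {v})\<close> \<open>u \<in> S - {v}\<close>]
    by blast
qed

section \<open>Measurability of the thinned process and integration over one vertex\<close>

lemma sets_smp: "sets (smp v) = sets (count_space UNIV \<Otimes>\<^sub>M borel \<Otimes>\<^sub>M borel)"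
  unfolding smp_def by (intro sets_pair_measure_cong) auto

lemma space_smp [simp]: "space (smp v) = UNIV"
  by (simp add: smp_def space_pair_measure)

lemma prob_space_smp: "prob_space (smp v)"
  unfolding smp_def by (intro prob_space_pair unif.prob_space_axioms prob_space_measure_pmf)

sublocale smp: product_sigma_finite smp
  unfolding product_sigma_finite_def
  by (intro allI prob_space_imp_sigma_finite prob_space_smp)

lemma measurable_smp [measurable]:
  "fst \<in> measurable (smp v) (count_space UNIV)"
  "(\<lambda>z. fst (snd z)) \<in> borel_measurable (smp v)"
  "(\<lambda>z. snd (snd z)) \<in> borel_measurable (smp v)"
  by (simp_all add: measurable_cong_sets[OF sets_smp refl])

lemma measurable_sample:
  assumes "f \<in> measurable M (PiM S smp)" "v \<in> S"
  shows "(\<lambda>x. fst (f x v)) \<in> measurable M (count_space UNIV)"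
    and "(\<lambda>x. fst (snd (f x v))) \<in> borel_measurable M"
    and "(\<lambda>x. snd (snd (f x v))) \<in> borel_measurable M"
proof -
  note * = measurable_compose[OF assms(1) measurable_component_singleton[OF assms(2)]]
  show "(\<lambda>x. fst (f x v)) \<in> measurable M (count_space UNIV)"
    by (rule measurable_compose[OF *]) measurable
  show "(\<lambda>x. fst (snd (f x v))) \<in> borel_measurable M"
    by (rule measurable_compose[OF *]) measurable
  show "(\<lambda>x. snd (snd (f x v))) \<in> borel_measurable M"
    by (rule measurable_compose[OF *]) measurable
qed

lemma req_measurable:
  assumes f: "f \<in> measurable M (PiM S smp)" "v \<in> S"
  shows "Measurable.pred M (\<lambda>x. req (f x) v u)"
proof -
  note [measurable] = measurable_sample[OF f]
  show ?thesis unfolding req_def by measurable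
qed

text \<open>The time \<open>t\<close> is a random variable because the recursion evaluates
  \<open>taken_upto\<close> at random arrival times. The general source space \<open>M\<close> also
  admits pairs of a time and a sample, as in \<open>vacancy_measurable\<close>.\<close>

lemma taken_upto_measurable:
  assumes S: "finite S" "u \<in> S" and f: "f \<in> measurable M (PiM S smp)"
    and t: "t \<in> borel_measurable M"
  shows "Measurable.pred M (\<lambda>x. taken_upto k S (f x) u (t x))"
  using S(2) t
proof (induction k arbitrary: u t)
  case (Suc k)
  have sample: "(\<lambda>x. arr (f x) v) \<in> borel_measurable M"
    "Measurable.pred M (\<lambda>x. req (f x) v w)" if "v \<in> S" for v w
    using measurable_sample[OF f that] req_measurable[OF f that] by auto
  have step: "Measurable.pred M (\<lambda>x. taken_upto k S (f x) v (arr (f x) w))"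
    if "v \<in> S" "w \<in> S" for v w
    using that sample by (intro Suc.IH) auto
  show ?case
    unfolding taken_upto.simps
    by (intro pred_intros_logic pred_intros_finite borel_measurable_pred_less sample step Suc.prems S(1))
qed simp

lemma taken_measurable:
  "finite S \<Longrightarrow> u \<in> S \<Longrightarrow> f \<in> measurable M (PiM S smp) \<Longrightarrow> t \<in> borel_measurable M \<Longrightarrow>
   Measurable.pred M (\<lambda>x. taken S (f x) u (t x))"
  unfolding taken_def by (rule taken_upto_measurable)

lemma late_measurable:
  assumes S: "finite S" "u \<in> S" "w \<in> S" and f: "f \<in> measurable M (PiM S smp)"
    and t: "t \<in> borel_measurable M"
  shows "Measurable.pred M (\<lambda>x. late S (f x) w u (t x))"
proof -
  show ?thesis unfolding late_def
    by (intro pred_intros_logic borel_measurable_pred_less req_measurable[OF f] taken_measurable S f t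
        measurable_sample(2)[OF f])
qed


lemma emeasure_smp_arr: "A \<in> sets borel \<Longrightarrow> emeasure (smp v) {z. fst (snd z) \<in> A} = emeasure unif A"
proof -
  assume A: "A \<in> sets borel"
  interpret U: prob_space "unif \<Otimes>\<^sub>M unif" by (intro prob_space_pair unif.prob_space_axioms)
  have "{z. fst (snd z) \<in> A} = (UNIV :: nat option set) \<times> (A \<times> (UNIV :: real set))" by auto
  thus ?thesis
    unfolding smp_def using A unif.emeasure_space_1
    by (simp add: U.emeasure_pair_measure_Times unif.emeasure_pair_measure_Times)
qed

lemma PiM_insert_emeasure:
  assumes "finite S" "w \<notin> S" "Measurable.pred (PiM (insert w S) smp) P"
  shows "emeasure (PiM (insert w S) smp) {\<zeta> \<in> space (PiM (insert w S) smp). P \<zeta>} =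
    (\<integral>\<^sup>+ z. emeasure (PiM S smp) {x \<in> space (PiM S smp). P (x(w := z))} \<partial>smp w)"
proof -
  have [measurable]: "Measurable.pred (PiM (insert w S) smp) P" by fact
  have "emeasure (PiM (insert w S) smp) {\<zeta> \<in> space (PiM (insert w S) smp). P \<zeta>} =
      (\<integral>\<^sup>+ \<zeta>. indicator {\<zeta> \<in> space (PiM (insert w S) smp). P \<zeta>} \<zeta> \<partial>PiM (insert w S) smp)"
    by (subst nn_integral_indicator) auto
  also have "\<dots> = (\<integral>\<^sup>+ z. \<integral>\<^sup>+ x. indicator {\<zeta> \<in> space (PiM (insert w S) smp). P \<zeta>} (x(w := z)) \<partial>PiM S smp \<partial>smp w)"
    using assms by (subst smp.product_nn_integral_insert_rev) auto
  also have "\<dots> = (\<integral>\<^sup>+ z. emeasure (PiM S smp) {x \<in> space (PiM S smp). P (x(w := z))} \<partial>smp w)"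
  proof (rule nn_integral_cong)
    fix z assume "z \<in> space (smp w)"
    have upd: "(\<lambda>x. x(w := z)) \<in> measurable (PiM S smp) (PiM (insert w S) smp)"
      by (rule measurable_fun_upd[where J = S]) auto
    have "Measurable.pred (PiM S smp) (\<lambda>x. P (x(w := z)))"
      using measurable_compose[OF upd assms(3)] .
    moreover have "indicator {\<zeta> \<in> space (PiM (insert w S) smp). P \<zeta>} (x(w := z)) =
        (indicator {x \<in> space (PiM S smp). P (x(w := z))} x :: ennreal)"
      if "x \<in> space (PiM S smp)" for x
      using that measurable_space[OF upd that] by (auto simp: indicator_def)
    ultimately show "(\<integral>\<^sup>+ x. indicator {\<zeta> \<in> space (PiM (insert w S) smp). P \<zeta>} (x(w := z)) \<partial>PiM S smp) =
        emeasure (PiM S smp) {x \<in> space (PiM S smp). P (x(w := z))}"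
      by (simp add: nn_integral_indicator pred_def cong: nn_integral_cong)
  qed
  finally show ?thesis .
qed

lemma prob_space_PiM_smp: "prob_space (PiM S smp)"
  by (intro prob_space_PiM prob_space_smp)

lemma vacancy_measurable:
  assumes S: "finite S" "u \<in> S"
  shows "vacancy S u \<in> borel_measurable borel"
proof -
  interpret P: prob_space "PiM S smp" by (rule prob_space_PiM_smp)
  have "Measurable.pred (borel \<Otimes>\<^sub>M PiM S smp) (\<lambda>p. arr (snd p) u < fst p \<and> \<not> taken S (snd p) u (fst p))"
    by (intro pred_intros_logic borel_measurable_pred_less measurable_sample(2)[OF _ S(2)]
        taken_measurable S) measurable
  hence "{p \<in> space (borel \<Otimes>\<^sub>M PiM S smp). arr (snd p) u < fst p \<and> \<not> taken S (snd p) u (fst p)}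
      \<in> sets (borel \<Otimes>\<^sub>M PiM S smp)" by (simp add: pred_def)
  from P.measurable_emeasure_Pair[OF this]
  have "(\<lambda>y. emeasure (PiM S smp) {\<zeta> \<in> space (PiM S smp). arr \<zeta> u < y \<and> \<not> taken S \<zeta> u y})
      \<in> borel_measurable borel"
    by (rule back_subst[where P = "\<lambda>f. f \<in> borel_measurable borel"])
       (auto simp: space_pair_measure intro!: ext arg_cong[where f = "emeasure (PiM S smp)"])
  thus ?thesis
    unfolding vacancy_def measure_def by measurable
qed

lemma vacancy_bounds: "0 \<le> vacancy S u y" "vacancy S u y \<le> 1"
proof -
  interpret P: prob_space "PiM S smp" by (rule prob_space_PiM_smp)
  show "0 \<le> vacancy S u y" "vacancy S u y \<le> 1" by (auto simp: vacancy_def)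
qed

end

context thinned_arrivals begin

lemma rate_integrable:
  assumes S: "finite S" "u \<in> S" and y: "y \<le> 1"
    and r: "\<And>s. 0 \<le> s \<Longrightarrow> s \<le> 1 \<Longrightarrow> 0 \<le> r w u s \<and> r w u s \<le> 1"
  shows "set_integrable lborel {0..y} (\<lambda>s. r w u s * vacancy S u s)"
  unfolding set_integrable_def
proof (rule Bochner_Integration.integrable_bound)
  show "integrable lborel (\<lambda>s. indicator {0..y} s :: real)"
    by (simp add: integrable_indicator_iff emeasure_lborel_Icc_eq)
  note [measurable] = vacancy_measurable[OF S]
  show "(\<lambda>s. indicator {0..y} s *\<^sub>R (r w u s * vacancy S u s)) \<in> borel_measurable lborel"
    by measurable
  have "\<bar>r w u s * vacancy S u s\<bar> \<le> 1" if "s \<in> {0..y}" for s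
    using r[of s] that y vacancy_bounds[of S u s] by (auto simp: abs_mult intro: mult_le_one)
  thus "AE s in lborel. norm (indicator {0..y} s *\<^sub>R (r w u s * vacancy S u s)) \<le> norm (indicator {0..y} s :: real)"
    by (intro AE_I2) (auto simp: indicator_def)
qed

text \<open>Fubini in the coordinate of \<open>w\<close>. Given its sample, the event says that
  \<open>w\<close> chose \<open>u\<close>, that its coin is below the rate, and that
  \<open>u\<close> is present and free at time \<open>Y\<close> in the process without
  \<open>w\<close>. The three conditions contribute the pmf, the rate and the vacancy.\<close>

lemma late_emeasure:
  assumes S: "finite S" "u \<in> S" "w \<in> S" "u \<noteq> w" and y: "0 \<le> y" "y \<le> 1"
    and r: "\<And>s. 0 \<le> s \<Longrightarrow> s \<le> 1 \<Longrightarrow> 0 \<le> r w u s \<and> r w u s \<le> 1"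
  shows "emeasure (PiM S smp) {\<zeta> \<in> space (PiM S smp). late S \<zeta> w u y} =
    ennreal (pmf (ch w) (Some u) * integral {0..y} (\<lambda>s. r w u s * vacancy (S - {w}) u s))"
proof -
  define S' where "S' = S - {w}"
  have S': "finite S'" "w \<notin> S'" "u \<in> S'" "insert w S' = S" using S by (auto simp: S'_def)
  define v where "v = vacancy S' u"
  have [measurable]: "v \<in> borel_measurable borel"
    using vacancy_measurable[OF S'(1,3)] by (simp add: v_def)
  define h where "h = (\<lambda>(Y, U). indicator {..<y} Y * indicator {U. U < r w u Y} U * ennreal (v Y))"
  interpret P: prob_space "PiM S' smp" by (rule prob_space_PiM_smp)
  interpret U2: prob_space "unif \<Otimes>\<^sub>M unif" by (intro prob_space_pair unif.prob_space_axioms)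
  have h [measurable]: "h \<in> borel_measurable (borel \<Otimes>\<^sub>M borel)"
  proof -
    have "(\<lambda>p. indicator {..<y} (fst p) * (if snd p < r w u (fst p) then 1 else 0) * ennreal (v (fst p)))
        \<in> borel_measurable (borel \<Otimes>\<^sub>M borel)" by measurable
    thus ?thesis by (rule back_subst[where P = "\<lambda>f. f \<in> borel_measurable _"])
        (auto simp: h_def indicator_def)
  qed
  have inner: "emeasure (PiM S' smp) {x \<in> space (PiM S' smp). late S (x(w := z)) w u y} =
      indicator {Some u} (fst z) * h (snd z)" for z
  proof -
    define Y where "Y = fst (snd z)"
    have eq: "late S (x(w := z)) w u y \<longleftrightarrow>
        fst z = Some u \<and> snd (snd z) < r w u Y \<and> Y < y \<and> arr x u < Y \<and> \<not> taken S' x u Y" for x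
    proof -
      \<comment> \<open>\<open>Y\<close> is the arrival time of \<open>w\<close> itself, so
        \<open>taken_remove\<close> applies at the boundary \<open>t = arr w\<close>. After that the
        coordinate \<open>w\<close> is no longer read.\<close>
      have "taken S (x(w := z)) u Y = taken S' (x(w := z)) u Y"
        unfolding S'_def using S by (intro taken_remove) (auto simp: Y_def)
      also have "\<dots> = taken S' x u Y"
        using S' by (intro taken_cong) auto
      finally show ?thesis using S(4) by (auto simp: late_def req_def Y_def)
    qed
    show ?thesis
    proof (cases "fst z = Some u \<and> snd (snd z) < r w u Y \<and> Y < y")
      case True
      hence "emeasure (PiM S' smp) {x \<in> space (PiM S' smp). late S (x(w := z)) w u y} = ennreal (v Y)"
        unfolding eq v_def vacancy_def by (simp add: P.emeasure_eq_measure)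
      thus ?thesis using True by (simp add: h_def Y_def case_prod_beta)
    next
      case False
      hence "{x \<in> space (PiM S' smp). late S (x(w := z)) w u y} = {}" unfolding eq by auto
      moreover have "indicator {Some u} (fst z) * h (snd z) = 0"
        using False by (auto simp: h_def Y_def case_prod_beta indicator_def)
      ultimately show ?thesis by (simp only: emeasure_empty)
    qed
  qed
  have "emeasure (PiM S smp) {\<zeta> \<in> space (PiM S smp). late S \<zeta> w u y} =
      (\<integral>\<^sup>+ z. indicator {Some u} (fst z) * h (snd z) \<partial>smp w)"
    using PiM_insert_emeasure[OF S'(1,2), of "\<lambda>\<zeta>. late S \<zeta> w u y"]
      late_measurable[of S u w "\<lambda>x. x" "PiM S smp" "\<lambda>_. y"] S
    by (simp add: S'(4) inner)
  also have "\<dots> = (\<integral>\<^sup>+ f. \<integral>\<^sup>+ q. indicator {Some u} f * h q \<partial>(unif \<Otimes>\<^sub>M unif) \<partial>measure_pmf (ch w))"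
    unfolding smp_def by (subst U2.nn_integral_fst[symmetric]) auto
  also have "\<dots> = (\<integral>\<^sup>+ f. indicator {Some u} f * (\<integral>\<^sup>+ q. h q \<partial>(unif \<Otimes>\<^sub>M unif)) \<partial>measure_pmf (ch w))"
    by (intro nn_integral_cong nn_integral_cmult) auto
  also have "\<dots> = ennreal (pmf (ch w) (Some u)) * (\<integral>\<^sup>+ q. h q \<partial>(unif \<Otimes>\<^sub>M unif))"
    by (subst nn_integral_multc) (auto simp: emeasure_pmf_single)
  also have "(\<integral>\<^sup>+ q. h q \<partial>(unif \<Otimes>\<^sub>M unif)) = (\<integral>\<^sup>+ Y. \<integral>\<^sup>+ U. h (Y, U) \<partial>unif \<partial>unif)"
    by (subst unif.nn_integral_fst[symmetric]) auto
  also have "\<dots> = (\<integral>\<^sup>+ Y. (\<integral>\<^sup>+ U. h (Y, U) \<partial>unif) * indicator {0..1} Y \<partial>lborel)"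
  proof (rule nn_integral_unif)
    have "(\<lambda>Y. \<integral>\<^sup>+ U. h (Y, U) \<partial>unif) \<in> borel_measurable unif"
      by (rule unif.borel_measurable_nn_integral) (auto simp: case_prod_beta)
    thus "(\<lambda>Y. \<integral>\<^sup>+ U. h (Y, U) \<partial>unif) \<in> borel_measurable borel" by simp
  qed
  also have "\<dots> = (\<integral>\<^sup>+ Y. ennreal (indicator {0..y} Y *\<^sub>R (r w u Y * v Y)) \<partial>lborel)"
  \<comment> \<open>The null point \<open>Y = y\<close> is discarded, since \<open>h\<close>
    contains the half-open range \<open>{..<y}\<close> and the integral runs over
    \<open>{0..y}\<close>.\<close>
  proof (rule nn_integral_cong_AE, rule AE_mp[OF AE_lborel_singleton[of y]], intro AE_I2 impI)
    fix Y :: real assume ne: "Y \<noteq> y"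
    have "(\<integral>\<^sup>+ U. h (Y, U) \<partial>unif) = indicator {..<y} Y * emeasure unif {..<r w u Y} * ennreal (v Y)"
    proof -
      have "(\<integral>\<^sup>+ U. h (Y, U) \<partial>unif) = (\<integral>\<^sup>+ U. (indicator {..<y} Y * ennreal (v Y)) * indicator {..<r w u Y} U \<partial>unif)"
        by (intro nn_integral_cong) (auto simp: h_def indicator_def)
      also have "\<dots> = (indicator {..<y} Y * ennreal (v Y)) * emeasure unif {..<r w u Y}"
        by (subst nn_integral_cmult_indicator) auto
      finally show ?thesis by (simp add: ac_simps)
    qed
    moreover have "emeasure unif {..<r w u Y} = ennreal (r w u Y)" if "0 \<le> Y" "Y \<le> 1"
      using r[OF that] by (intro emeasure_unif_lessThan) auto
    moreover have "ennreal (r w u Y) * ennreal (v Y) = ennreal (r w u Y * v Y)" if "0 \<le> Y" "Y \<le> 1"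
      using r[OF that] by (simp add: ennreal_mult' vacancy_bounds v_def)
    ultimately show "(\<integral>\<^sup>+ U. h (Y, U) \<partial>unif) * indicator {0..1} Y =
        ennreal (indicator {0..y} Y *\<^sub>R (r w u Y * v Y))"
      using ne y by (auto simp: indicator_def)
  qed
  also have "\<dots> = ennreal (integral {0..y} (\<lambda>s. r w u s * v s))"
  proof -
    note int = rate_integrable[OF S'(1,3) y(2) r]
    have "(\<integral>\<^sup>+ Y. ennreal (indicator {0..y} Y *\<^sub>R (r w u Y * v Y)) \<partial>lborel) =
        ennreal (LINT Y:{0..y}|lborel. r w u Y * v Y)"
      unfolding set_lebesgue_integral_def
    proof (rule nn_integral_eq_integral)
      show "integrable lborel (\<lambda>Y. indicator {0..y} Y *\<^sub>R (r w u Y * v Y))"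
        using int by (simp add: set_integrable_def v_def)
      show "AE Y in lborel. 0 \<le> indicator {0..y} Y *\<^sub>R (r w u Y * v Y)"
        using r y vacancy_bounds by (intro AE_I2) (auto simp: indicator_def v_def)
    qed
    thus ?thesis using set_borel_integral_eq_integral(2)[OF int] by (simp add: v_def)
  qed
  finally show ?thesis by (simp add: ennreal_mult' v_def S'_def)
qed

lemma arr_distinct_AE:
  assumes "finite S"
  shows "AE \<zeta> in PiM S smp. inj_on (arr \<zeta>) S"
proof -
  have "AE \<zeta> in PiM S smp. arr \<zeta> v \<noteq> arr \<zeta> w" if vw: "v \<in> S" "w \<in> S" "v \<noteq> w" for v w
  proof -
    define S' where "S' = S - {w}"
    have S': "finite S'" "w \<notin> S'" "v \<in> S'" "insert w S' = S" using assms vw by (auto simp: S'_def)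
    have m: "Measurable.pred (PiM S smp) (\<lambda>\<zeta>. arr \<zeta> v = arr \<zeta> w)"
    proof -
      have "(\<lambda>\<zeta>. arr \<zeta> v = arr \<zeta> w) = (\<lambda>\<zeta>. \<not> arr \<zeta> v < arr \<zeta> w \<and> \<not> arr \<zeta> w < arr \<zeta> v)"
        by auto
      thus ?thesis
        using measurable_sample(2)[of "\<lambda>x. x" "PiM S smp" S] vw
        by (simp only:) (intro pred_intros_logic borel_measurable_pred_less, auto)
    qed
    have [measurable]: "(\<lambda>x. arr x v) \<in> borel_measurable (PiM S' smp)"
      using measurable_sample(2)[of "\<lambda>x. x" "PiM S' smp" S' v] S' by auto
    have "emeasure (PiM S smp) {\<zeta> \<in> space (PiM S smp). arr \<zeta> v = arr \<zeta> w} =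
      (\<integral>\<^sup>+ \<zeta>. indicator {\<zeta> \<in> space (PiM S smp). arr \<zeta> v = arr \<zeta> w} \<zeta> \<partial>PiM S smp)"
      using m by (subst nn_integral_indicator) (auto simp: pred_def)
    also have "\<dots> = (\<integral>\<^sup>+ x. \<integral>\<^sup>+ z. indicator {\<zeta> \<in> space (PiM S smp). arr \<zeta> v = arr \<zeta> w} (x(w := z)) \<partial>smp w \<partial>PiM S' smp)"
      using smp.product_nn_integral_insert[OF S'(1,2),
          of "indicator {\<zeta> \<in> space (PiM S smp). arr \<zeta> v = arr \<zeta> w}"] m
      by (simp add: S'(4) pred_def)
    also have "\<dots> \<le> (\<integral>\<^sup>+ x. \<integral>\<^sup>+ z. indicator {z. fst (snd z) \<in> {arr x v}} z \<partial>smp w \<partial>PiM S' smp)"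
      using vw by (intro nn_integral_mono) (auto simp: indicator_def)
    also have "\<dots> = (\<integral>\<^sup>+ x. 0 \<partial>PiM S' smp)"
    proof (rule nn_integral_cong)
      fix x
      have "{z. fst (snd z) \<in> {arr x v}} \<in> sets (smp w)"
        using measurable_sets[OF measurable_smp(2), of "{arr x v}" w] by (simp add: vimage_def)
      thus "(\<integral>\<^sup>+ z. indicator {z. fst (snd z) \<in> {arr x v}} z \<partial>smp w) = 0"
        using emeasure_smp_arr[of "{arr x v}" w] emeasure_unif_singleton by simp
    qed
    finally have "emeasure (PiM S smp) {\<zeta> \<in> space (PiM S smp). arr \<zeta> v = arr \<zeta> w} = 0" by simp
    thus ?thesis
      using m by (subst AE_iff_measurable[where N = "{\<zeta> \<in> space (PiM S smp). arr \<zeta> v = arr \<zeta> w}"])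
        (auto simp: pred_def)
  qed
  hence "AE \<zeta> in PiM S smp. \<forall>v\<in>S. \<forall>w\<in>S. v \<noteq> w \<longrightarrow> arr \<zeta> v \<noteq> arr \<zeta> w"
    using assms by (intro AE_finite_allI) auto
  thus ?thesis by eventually_elim (auto simp: inj_on_def)
qed


lemma arr_emeasure:
  assumes "finite S" "u \<in> S" "0 \<le> y" "y \<le> 1"
  shows "emeasure (PiM S smp) {\<zeta> \<in> space (PiM S smp). arr \<zeta> u < y} = ennreal y"
proof -
  define S' where "S' = S - {u}"
  have S': "finite S'" "u \<notin> S'" "insert u S' = S" using assms by (auto simp: S'_def)
  interpret P: prob_space "PiM S' smp" by (rule prob_space_PiM_smp)
  have m: "Measurable.pred (PiM S smp) (\<lambda>\<zeta>. arr \<zeta> u < y)"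
    using measurable_sample(2)[of "\<lambda>x. x" "PiM S smp" S u] assms
    by (intro borel_measurable_pred_less) auto
  have "emeasure (PiM S smp) {\<zeta> \<in> space (PiM S smp). arr \<zeta> u < y} =
      (\<integral>\<^sup>+ z. emeasure (PiM S' smp) {x \<in> space (PiM S' smp). fst (snd z) < y} \<partial>smp u)"
    using PiM_insert_emeasure[OF S'(1,2), of "\<lambda>\<zeta>. arr \<zeta> u < y"] m by (simp add: S'(3))
  also have "\<dots> = (\<integral>\<^sup>+ z. indicator {z. fst (snd z) \<in> {..<y}} z \<partial>smp u)"
    by (intro nn_integral_cong) (auto simp: indicator_def P.emeasure_space_1)
  also have "\<dots> = emeasure (smp u) {z. fst (snd z) \<in> {..<y}}"
    using measurable_sets[OF measurable_smp(2), of "{..<y}" u]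
    by (intro nn_integral_indicator) (simp add: vimage_def)
  also have "\<dots> = ennreal y"
    by (rule trans[OF emeasure_smp_arr emeasure_unif_lessThan[OF assms(3,4)]]) simp
  finally show ?thesis .
qed

text \<open>Almost surely, a vertex \<open>u\<close> that arrives before \<open>y\<close> is either
  free at \<open>y\<close> or an endpoint of exactly one edge completed before \<open>y\<close>. The
  indicator of \<open>arr \<zeta> u < y\<close> is thus the sum of the indicators of these cases;
  distinct arrival times exclude two completions at the same moment.\<close>

lemma vacancy_eq_diff:
  assumes S: "finite S" "u \<in> S" and y: "0 \<le> y" "y \<le> 1"
  defines "Late \<equiv> \<lambda>w v. {\<zeta> \<in> space (PiM S smp). late S \<zeta> w v y}"
  shows "vacancy S u y = y - (\<Sum>w\<in>S - {u}. measure (PiM S smp) (Late w u) + measure (PiM S smp) (Late u w))"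
proof -
  interpret P: prob_space "PiM S smp" by (rule prob_space_PiM_smp)
  define A where "A = {\<zeta> \<in> space (PiM S smp). arr \<zeta> u < y}"
  define B where "B = {\<zeta> \<in> space (PiM S smp). arr \<zeta> u < y \<and> \<not> taken S \<zeta> u y}"
  have Late: "Late w v \<in> sets (PiM S smp)" if "w \<in> S" "v \<in> S" for w v
    using late_measurable[of S v w "\<lambda>x. x" "PiM S smp" "\<lambda>_. y"] S that by (simp add: Late_def pred_def)
  have u: "(\<lambda>\<zeta>. arr \<zeta> u) \<in> borel_measurable (PiM S smp)"
    using measurable_sample(2)[of "\<lambda>x. x" "PiM S smp" S u] S by auto
  have A: "A \<in> sets (PiM S smp)" "B \<in> sets (PiM S smp)"
    unfolding A_def B_def using taken_measurable[of S u "\<lambda>x. x" "PiM S smp" "\<lambda>_. y"] S u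
    by (auto intro!: pred_intros_logic borel_measurable_pred_less simp flip: pred_def)
  have "AE \<zeta> in PiM S smp. indicator A \<zeta> = (indicator B \<zeta> :: real) +
      (\<Sum>w\<in>S - {u}. indicator (Late w u) \<zeta> + indicator (Late u w) \<zeta>)"
    using arr_distinct_AE[OF S(1)] AE_space
  proof eventually_elim
    case (elim \<zeta>)
    have none: "(\<Sum>w\<in>S - {u}. indicator (Late w u) \<zeta> + indicator (Late u w) \<zeta> :: real) = 0"
      if "\<And>w. w \<in> S \<Longrightarrow> \<not> late S \<zeta> w u y \<and> \<not> late S \<zeta> u w y"
      using that by (intro sum.neutral) (auto simp: Late_def)
    consider "\<not> arr \<zeta> u < y" | "arr \<zeta> u < y" "\<not> taken S \<zeta> u y" | "arr \<zeta> u < y" "taken S \<zeta> u y" by blast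
    thus ?case
    proof cases
      case 1
      hence "\<not> late S \<zeta> w u y \<and> \<not> late S \<zeta> u w y" for w by (auto simp: late_def)
      thus ?thesis using none 1 by (auto simp: A_def B_def)
    next
      case 2
      hence "\<not> late S \<zeta> w u y \<and> \<not> late S \<zeta> u w y" if "w \<in> S" for w
        using taken_iff[OF S] that by blast
      thus ?thesis using none 2 elim by (auto simp: A_def B_def)
    next
      case 3
      define m where "m w \<longleftrightarrow> late S \<zeta> w u y \<or> late S \<zeta> u w y" for w
      obtain v where v: "v \<in> S" "m v" using 3 taken_iff[OF S] by (auto simp: m_def)
      have vu: "v \<noteq> u" using v by (auto simp: m_def late_def)
      have unique: "w = v" if w: "w \<in> S" "m w" for w
      proof (rule ccontr)
        assume "w \<noteq> v"
        hence ne: "arr \<zeta> w \<noteq> arr \<zeta> v" using elim w v by (auto dest: inj_onD)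
        \<comment> \<open>An edge at \<open>u\<close> completed before the arrival of
          \<open>a\<close> makes \<open>u\<close> taken at that arrival, contrary to the vacancy
          recorded in \<open>late\<close>.\<close>
        have first: False if "late S \<zeta> a u y" "m b" "a \<in> S" "b \<in> S" "arr \<zeta> b < arr \<zeta> a" for a b
        proof -
          have "late S \<zeta> b u (arr \<zeta> a) \<or> late S \<zeta> u b (arr \<zeta> a)"
            using that by (auto simp: m_def late_def)
          hence "taken S \<zeta> u (arr \<zeta> a)" using taken_iff[OF S] that by blast
          thus False using that by (auto simp: late_def)
        qed
        \<comment> \<open>As the later endpoint, \<open>u\<close> requests only the one vertex that
          it chose.\<close>
        have "\<not> (late S \<zeta> u w y \<and> late S \<zeta> u v y)"
          using \<open>w \<noteq> v\<close> by (auto simp: late_def req_def)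
        moreover have False if "late S \<zeta> a u y" "late S \<zeta> u b y" "a \<in> S" "b \<in> S" for a b
          using first[of a b] that by (auto simp: m_def late_def)
        moreover have "\<not> (late S \<zeta> w u y \<and> late S \<zeta> v u y)"
          using first[of w v] first[of v w] ne w v by (meson linorder_neqE)
        ultimately show False using w v unfolding m_def by blast
      qed
      have "(\<Sum>w\<in>S - {u}. indicator (Late w u) \<zeta> + indicator (Late u w) \<zeta> :: real) =
          (\<Sum>w\<in>S - {u}. if w = v then 1 else 0)"
      proof (rule sum.cong[OF refl])
        fix w assume w: "w \<in> S - {u}"
        show "indicator (Late w u) \<zeta> + indicator (Late u w) \<zeta> = (if w = v then 1 else 0 :: real)"
        proof (cases "w = v")
          case True
          have "\<not> (late S \<zeta> v u y \<and> late S \<zeta> u v y)" by (auto simp: late_def)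
          thus ?thesis using v True elim by (auto simp: m_def Late_def indicator_def)
        next
          case False
          thus ?thesis using unique[of w] w by (auto simp: m_def Late_def indicator_def)
        qed
      qed
      also have "\<dots> = 1" using S(1) v vu by (simp add: sum.delta)
      finally show ?thesis using 3 elim by (auto simp: A_def B_def)
    qed
  qed
  hence "(\<integral>\<zeta>. indicator A \<zeta> \<partial>PiM S smp) = (\<integral>\<zeta>. (indicator B \<zeta> :: real) +
      (\<Sum>w\<in>S - {u}. indicator (Late w u) \<zeta> + indicator (Late u w) \<zeta>) \<partial>PiM S smp)"
    using A Late S by (intro integral_cong_AE borel_measurable_add borel_measurable_sum borel_measurable_indicator) auto
  also have "\<dots> = P.prob B + (\<Sum>w\<in>S - {u}. P.prob (Late w u) + P.prob (Late u w))"
    using A Late S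
    by (intro has_bochner_integral_integral_eq has_bochner_integral_add has_bochner_integral_sum
        has_bochner_integral_real_indicator) (auto simp: P.emeasure_eq_measure)
  finally have "P.prob A = P.prob B + (\<Sum>w\<in>S - {u}. P.prob (Late w u) + P.prob (Late u w))"
    using A by simp
  moreover have "P.prob A = y"
    using arr_emeasure[OF S y] y by (simp add: A_def measure_def)
  ultimately show ?thesis by (simp add: vacancy_def B_def)
qed

end

section \<open>The recursion for a given fractional matching\<close>

lemma borel_measurable_att [measurable]: "att m \<in> borel_measurable borel"
  by (intro borel_measurable_continuous_onI continuous_intros)

locale matching_instance =
  fixes n :: nat and E :: "nat set set" and x :: "nat set \<Rightarrow> real"
  assumes graph: "graph n E" and frac: "fractional_matching n E x"
begin

definition X :: "nat \<Rightarrow> nat \<Rightarrow> real" where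
  "X u w = (if {u, w} \<in> E then x {u, w} else 0)"

lemma edge_verts: "{u, v} \<in> E \<Longrightarrow> u < n \<and> v < n \<and> u \<noteq> v"
  using graph by (auto simp: graph_def)

lemma finite_nbrs: "finite (nbrs E v)"
  by (rule finite_subset[of _ "{..<n}"]) (use edge_verts in \<open>auto simp: nbrs_def\<close>)

text \<open>The masses of \<open>None\<close> and of the neighbours already add up to 1, which
  leaves none for any other vertex.\<close>

lemma pmf_choice: "w < n \<Longrightarrow> pmf (choice_pmf E x w) (Some u) = X u w"
proof (cases "u \<in> nbrs E w")
  case True
  assume "w < n"
  thus ?thesis using choice_pmf(2)[OF graph frac] True by (simp add: X_def nbrs_def)
next
  case False
  assume w: "w < n"
  let ?p = "choice_pmf E x w" and ?N = "nbrs E w"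
  have "measure (measure_pmf ?p) (insert (Some u) (insert None (Some ` ?N))) =
      (\<Sum>a\<in>insert (Some u) (insert None (Some ` ?N)). pmf ?p a)"
    by (rule measure_measure_pmf_finite) (simp add: finite_nbrs)
  also have "\<dots> = pmf ?p (Some u) + (pmf ?p None + (\<Sum>v\<in>?N. pmf ?p (Some v)))"
    using False finite_nbrs by (simp add: image_iff sum.reindex)
  also have "\<dots> = pmf ?p (Some u) + 1"
    using choice_pmf[OF graph frac w] by simp
  finally have "pmf ?p (Some u) \<le> 0"
    using measure_pmf.prob_le_1[of ?p "insert (Some u) (insert None (Some ` ?N))"] by linarith
  thus ?thesis using False by (simp add: X_def nbrs_def antisym)
qed

sublocale weighted_graph "{..<n}" X
proof
  fix u v :: nat
  show "X u v = X v u" by (simp add: X_def insert_commute)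
  show "0 \<le> X u v" using frac by (simp add: X_def fractional_matching_def)
  show "X u u = 0" using edge_verts[of u u] by (auto simp: X_def)
next
  fix u :: nat assume u: "u \<in> {..<n}"
  have "(\<Sum>w<n. X u w) = (\<Sum>w\<in>nbrs E u. X u w)"
    by (rule sum.mono_neutral_right)
       (use edge_verts in \<open>auto simp: X_def nbrs_def insert_commute\<close>)
  also have "\<dots> = (\<Sum>w\<in>nbrs E u. x {w, u})"
    by (rule sum.cong) (auto simp: X_def nbrs_def insert_commute)
  also have "\<dots> \<le> 1"
    using choice_pmf(1)[OF graph frac, of u] u pmf_nonneg[of "choice_pmf E x u" None] by simp
  finally show "(\<Sum>w<n. X u w) \<le> 1" .
qed simp

sublocale thinned_arrivals "choice_pmf E x" "\<lambda>w u. att (excess u w)"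
  by unfold_locales measurable

lemma rate_bounds:
  "u < n \<Longrightarrow> w < n \<Longrightarrow> u \<noteq> w \<Longrightarrow> 0 \<le> s \<Longrightarrow> s \<le> 1 \<Longrightarrow>
    0 \<le> att (excess u w) s \<and> att (excess u w) s \<le> 1"
  using att_bounds excess_bounds by auto

lemma rate_integrable_on:
  assumes "S \<subseteq> {..<n}" "u \<in> S" "w < n" "u \<noteq> w" "y \<le> 1"
  shows "(\<lambda>s. att (excess u w) s * vacancy S u s) integrable_on {0..y}"
proof -
  have "finite S" using assms(1) finite_subset by blast
  thus ?thesis
    using rate_integrable[OF _ assms(2,5), of w] rate_bounds[of u w] assms
    by (intro set_borel_integral_eq_integral) auto
qed

lemma late_prob:
  assumes S: "S \<subseteq> {..<n}" "u \<in> S" "w \<in> S" "u \<noteq> w" and y: "0 \<le> y" "y \<le> 1"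
  shows "measure (PiM S smp) {\<zeta> \<in> space (PiM S smp). late S \<zeta> w u y} =
    X u w * integral {0..y} (\<lambda>s. att (excess u w) s * vacancy (S - {w}) u s)"
proof -
  have "finite S" using S(1) finite_subset by blast
  hence "emeasure (PiM S smp) {\<zeta> \<in> space (PiM S smp). late S \<zeta> w u y} =
      ennreal (pmf (choice_pmf E x w) (Some u) *
        integral {0..y} (\<lambda>s. att (excess u w) s * vacancy (S - {w}) u s))"
    using S y by (intro late_emeasure rate_bounds) auto
  moreover have "pmf (choice_pmf E x w) (Some u) = X u w"
    using S by (intro pmf_choice) auto
  moreover have "0 \<le> integral {0..y} (\<lambda>s. att (excess u w) s * vacancy (S - {w}) u s)"
  proof (intro integral_nonneg rate_integrable_on mult_nonneg_nonneg vacancy_bounds)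
    have "u < n" "w < n" using S by auto
    thus "0 \<le> att (excess u w) s" if "s \<in> {0..y}" for s
      using rate_bounds[of u w s] that S y by auto
  qed (use S y in auto)
  ultimately show ?thesis by (simp add: measure_def X_nonneg)
qed

text \<open>Weight and rate are symmetric in \<open>u\<close> and \<open>w\<close>. The two arrival
  orders therefore share the factors \<open>X u w\<close> and \<open>att (excess u w) s\<close>, and
  their integrals merge into one bracket.\<close>

lemma vacancy_rec:
  assumes S: "S \<subseteq> {..<n}" "u \<in> S" and y: "0 \<le> y" "y \<le> 1"
  shows "vacancy S u y = y - (\<Sum>w\<in>S - {u}. X u w *
    integral {0..y} (\<lambda>s. att (excess u w) s * (vacancy (S - {w}) u s + vacancy (S - {u}) w s)))"
proof -
  have fin: "finite S" using S(1) finite_subset by blast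
  show ?thesis
    unfolding vacancy_eq_diff[OF fin S(2) y]
  proof (intro arg_cong[where f = "\<lambda>a. y - a"] sum.cong refl)
    fix w assume w: "w \<in> S - {u}"
    have "integral {0..y} (\<lambda>s. att (excess u w) s * (vacancy (S - {w}) u s + vacancy (S - {u}) w s)) =
        integral {0..y} (\<lambda>s. att (excess u w) s * vacancy (S - {w}) u s) +
        integral {0..y} (\<lambda>s. att (excess w u) s * vacancy (S - {u}) w s)"
      unfolding distrib_left excess_sym[of w u]
      using w S y rate_integrable_on[of "S - {w}" u w y] rate_integrable_on[of "S - {u}" w u y]
      by (intro Henstock_Kurzweil_Integration.integral_add) (auto simp: excess_sym[of w u])
    thus "measure (PiM S smp) {\<zeta> \<in> space (PiM S smp). late S \<zeta> w u y} +
        measure (PiM S smp) {\<zeta> \<in> space (PiM S smp). late S \<zeta> u w y} = X u w *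
        integral {0..y} (\<lambda>s. att (excess u w) s * (vacancy (S - {w}) u s + vacancy (S - {u}) w s))"
      using late_prob[of S u w y] late_prob[of S w u y] w S y
      by (simp add: X_sym[of w u] distrib_left)
  qed
qed

sublocale vacancy_recursion "{..<n}" X vacancy
proof
  fix S u and y :: real assume S: "S \<subseteq> {..<n}" "u \<in> S" and y: "0 \<le> y" "y \<le> 1"
  show "0 \<le> vacancy S u y" by (rule vacancy_bounds)
  show "vacancy S u y = y - (\<Sum>w\<in>S - {u}. X u w *
    integral {0..y} (\<lambda>s. att (excess u w) s * (vacancy (S - {w}) u s + vacancy (S - {u}) w s)))"
    by (rule vacancy_rec[OF S y])
next
  fix S u assume S: "S \<subseteq> {..<n}" "u \<in> S"
  have "(\<lambda>s. att (excess u w) s * (vacancy (S - {w}) u s + vacancy (S - {u}) w s)) integrable_on {0..1}"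
    if w: "w \<in> S - {u}" for w
    unfolding distrib_left
    using w S rate_integrable_on[of "S - {w}" u w 1] rate_integrable_on[of "S - {u}" w u 1]
    by (intro integrable_add) (auto simp: excess_sym[of w u])
  \<comment> \<open>Continuity comes from the recursion itself, whose right-hand side is built from
    indefinite integrals.\<close>
  hence "continuous_on {0..1} (\<lambda>y. y - (\<Sum>w\<in>S - {u}. X u w *
      integral {0..y} (\<lambda>s. att (excess u w) s * (vacancy (S - {w}) u s + vacancy (S - {u}) w s))))"
    by (intro continuous_intros indefinite_integral_continuous_1) auto
  thus "continuous_on {0..1} (vacancy S u)"
    by (rule continuous_on_eq) (use vacancy_rec[OF S] in auto)
qed

lemma late_pair_prob_ge:
  assumes "u < n" "v < n" "u \<noteq> v"
  shows "669/1250 * X u v \<le>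
    measure (PiM {..<n} smp) {\<zeta> \<in> space (PiM {..<n} smp). late {..<n} \<zeta> v u 1} +
    measure (PiM {..<n} smp) {\<zeta> \<in> space (PiM {..<n} smp). late {..<n} \<zeta> u v 1}"
proof -
  have "integral {0..1} (\<lambda>s. att (excess u v) s * (vacancy ({..<n} - {v}) u s + vacancy ({..<n} - {u}) v s)) =
        integral {0..1} (\<lambda>s. att (excess u v) s * vacancy ({..<n} - {v}) u s) +
        integral {0..1} (\<lambda>s. att (excess v u) s * vacancy ({..<n} - {u}) v s)"
    unfolding distrib_left excess_sym[of v u]
    using assms rate_integrable_on[of "{..<n} - {v}" u v 1] rate_integrable_on[of "{..<n} - {u}" v u 1]
    by (intro Henstock_Kurzweil_Integration.integral_add) (auto simp: excess_sym[of v u])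
  hence "measure (PiM {..<n} smp) {\<zeta> \<in> space (PiM {..<n} smp). late {..<n} \<zeta> v u 1} +
    measure (PiM {..<n} smp) {\<zeta> \<in> space (PiM {..<n} smp). late {..<n} \<zeta> u v 1} = X u v *
    integral {0..1} (\<lambda>s. att (excess u v) s * (vacancy ({..<n} - {v}) u s + vacancy ({..<n} - {u}) v s))"
    using late_prob[of "{..<n}" u v 1] late_prob[of "{..<n}" v u 1] assms
    by (simp add: X_sym[of v u] distrib_left)
  moreover have "X u v * (669/1250) \<le> X u v *
    integral {0..1} (\<lambda>s. att (excess u v) s * (vacancy ({..<n} - {v}) u s + vacancy ({..<n} - {u}) v s))"
    using acceptance_integral_ge[of u v] assms by (intro mult_left_mono X_nonneg) auto
  ultimately show ?thesis by simp
qed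

end

text \<open>The stream is the image of an infinite product measure, and a function of finitely many
  entries sees only a finite marginal, where integrals of products factorise. It is the independence
  of the coins in integral form.\<close>

lemma nn_integral_stream_space_prod:
  fixes h :: "nat \<Rightarrow> 'a \<Rightarrow> ennreal"
  assumes M: "prob_space M" and I: "finite I" and h: "\<And>i. i \<in> I \<Longrightarrow> h i \<in> borel_measurable M"
  shows "(\<integral>\<^sup>+ \<omega>. (\<Prod>i\<in>I. h i (\<omega> !! i)) \<partial>stream_space M) = (\<Prod>i\<in>I. \<integral>\<^sup>+ a. h i a \<partial>M)"
proof -
  interpret P: product_prob_space "\<lambda>_::nat. M" UNIV
    by (intro product_prob_spaceI M)
  have [measurable]: "(\<lambda>\<omega>. \<Prod>i\<in>I. h i (\<omega> !! i)) \<in> borel_measurable (stream_space M)"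
    using h by (intro borel_measurable_prod_ennreal) (auto intro: measurable_compose[OF measurable_snth])
  have m: "(\<lambda>f. \<Prod>i\<in>I. h i (f i)) \<in> borel_measurable (PiM I (\<lambda>_. M))"
    using h by (intro borel_measurable_prod_ennreal measurable_compose[OF measurable_component_singleton]) auto
  have "(\<integral>\<^sup>+ \<omega>. (\<Prod>i\<in>I. h i (\<omega> !! i)) \<partial>stream_space M) =
      (\<integral>\<^sup>+ f. (\<Prod>i\<in>I. h i (to_stream f !! i)) \<partial>PiM UNIV (\<lambda>_. M))"
    by (subst stream_space_eq_distr) (simp add: nn_integral_distr)
  also have "\<dots> = (\<integral>\<^sup>+ f. (\<Prod>i\<in>I. h i (restrict f I i)) \<partial>PiM UNIV (\<lambda>_. M))"
    by (simp add: to_stream_def)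
  also have "\<dots> = (\<integral>\<^sup>+ f. (\<Prod>i\<in>I. h i (f i)) \<partial>distr (PiM UNIV (\<lambda>_. M)) (PiM I (\<lambda>_. M)) (\<lambda>f. restrict f I))"
    using m by (subst nn_integral_distr) (auto intro: measurable_restrict_subset)
  also have "\<dots> = (\<integral>\<^sup>+ f. (\<Prod>i\<in>I. h i (f i)) \<partial>PiM I (\<lambda>_. M))"
    using P.distr_PiM_restrict_finite[OF I] by simp
  also have "\<dots> = (\<Prod>i\<in>I. \<integral>\<^sup>+ a. h i a \<partial>M)"
    using P.product_nn_integral_prod[OF I h] .
  finally show ?thesis .
qed

text \<open>The coin of \<open>v\<close> is stream entry number \<open>v\<close>, whatever the
  arrival order. This matches \<open>draw_loop\<close>, which fills the coin cells by vertex
  number.\<close>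

definition samples :: "nat \<Rightarrow> (nat \<Rightarrow> nat option) \<times> (nat \<Rightarrow> real) \<times> real stream \<Rightarrow> nat \<Rightarrow> sample" where
  "samples n = (\<lambda>(F, Y, \<omega>). \<lambda>v\<in>{..<n}. (F v, Y v, \<omega> !! v))"

context thinned_arrivals begin

definition sample_space :: "nat \<Rightarrow> ((nat \<Rightarrow> nat option) \<times> (nat \<Rightarrow> real) \<times> real stream) measure" where
  "sample_space n = PiM {..<n} (\<lambda>v. measure_pmf (ch v)) \<Otimes>\<^sub>M PiM {..<n} (\<lambda>v. unif) \<Otimes>\<^sub>M stream_space unif"

lemma sample_space_components:
  "v < n \<Longrightarrow> (\<lambda>\<xi>. fst \<xi> v) \<in> measurable (sample_space n) (count_space UNIV)"
  "v < n \<Longrightarrow> (\<lambda>\<xi>. fst (snd \<xi>) v) \<in> borel_measurable (sample_space n)"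
  "(\<lambda>\<xi>. snd (snd \<xi>) !! i) \<in> borel_measurable (sample_space n)"
proof -
  show "(\<lambda>\<xi>. fst \<xi> v) \<in> measurable (sample_space n) (count_space UNIV)" if "v < n"
    unfolding sample_space_def
    by (rule measurable_compose[OF measurable_fst])
       (use that measurable_component_singleton[of v "{..<n}" "\<lambda>v. measure_pmf (ch v)"] in auto)
  show "(\<lambda>\<xi>. fst (snd \<xi>) v) \<in> borel_measurable (sample_space n)" if "v < n"
    unfolding sample_space_def
    by (rule measurable_compose[OF measurable_snd], rule measurable_compose[OF measurable_fst])
       (use that measurable_component_singleton[of v "{..<n}" "\<lambda>v. unif"] in auto)
  have "(\<lambda>\<omega>. \<omega> !! i) \<in> measurable (stream_space unif) unif" by measurable
  thus "(\<lambda>\<xi>. snd (snd \<xi>) !! i) \<in> borel_measurable (sample_space n)"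
    unfolding sample_space_def
    by (intro measurable_compose[OF measurable_snd] measurable_compose[OF measurable_snd]) auto
qed

lemma samples_measurable: "samples n \<in> measurable (sample_space n) (PiM {..<n} smp)"
proof -
  have "(\<lambda>\<xi>. \<lambda>v\<in>{..<n}. (fst \<xi> v, fst (snd \<xi>) v, snd (snd \<xi>) !! v)) \<in>
      measurable (sample_space n) (PiM {..<n} smp)"
  proof (rule measurable_restrict)
    fix v assume "v \<in> {..<n}"
    thus "(\<lambda>\<xi>. (fst \<xi> v, fst (snd \<xi>) v, snd (snd \<xi>) !! v)) \<in> measurable (sample_space n) (smp v)"
      using sample_space_components
      by (subst measurable_cong_sets[OF refl sets_smp]) (auto intro!: measurable_Pair)
  qed
  thus ?thesis by (simp add: samples_def case_prod_beta)
qed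

text \<open>Independent families of choices, times and coins are regrouped into independent
  vertices. It suffices to compare boxes: their indicator is a product over \<open>v\<close>, and
  integrating out the stream, the times and the choices in turn preserves the product form.\<close>

lemma distr_samples: "distr (sample_space n) (PiM {..<n} smp) (samples n) = PiM {..<n} smp"
proof (rule smp.PiM_eqI)
  fix A assume A: "\<And>v. v \<in> {..<n} \<Longrightarrow> A v \<in> sets (smp v)"
  let ?C = "PiM {..<n} (\<lambda>v. measure_pmf (ch v))"
  let ?U = "PiM {..<n} (\<lambda>v. unif)"
  let ?S = "stream_space unif"
  interpret U: prob_space ?U by (intro prob_space_PiM unif.prob_space_axioms)
  interpret S: prob_space ?S by (rule unif.prob_space_stream_space)
  interpret US: prob_space "?U \<Otimes>\<^sub>M ?S" by (intro prob_space_pair U.prob_space_axioms S.prob_space_axioms)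
  interpret UU: prob_space "unif \<Otimes>\<^sub>M unif" by (intro prob_space_pair unif.prob_space_axioms)
  interpret PC: product_sigma_finite "\<lambda>v. measure_pmf (ch v)"
    unfolding product_sigma_finite_def by (intro allI prob_space_imp_sigma_finite prob_space_measure_pmf)
  interpret PU: product_sigma_finite "\<lambda>v::nat. unif"
    unfolding product_sigma_finite_def by (intro allI prob_space_imp_sigma_finite unif.prob_space_axioms)
  define a where "a v z = (indicator (A v) z :: ennreal)" for v z
  have a: "a v \<in> borel_measurable (count_space UNIV \<Otimes>\<^sub>M borel \<Otimes>\<^sub>M borel)" if "v \<in> {..<n}" for v
  proof -
    have "a v = indicator (A v)" by (auto simp: a_def)
    thus ?thesis using A[OF that] by (simp add: sets_smp)
  qed
  have a3: "(\<lambda>z. a v (c, b, z)) \<in> borel_measurable borel" if "v \<in> {..<n}" for v c b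
    by (rule measurable_compose[OF _ a[OF that]]) measurable
  have a2: "(\<lambda>q. a v (c, q)) \<in> borel_measurable (borel \<Otimes>\<^sub>M borel)" if "v \<in> {..<n}" for v c
    by (rule measurable_compose[OF _ a[OF that]]) measurable
  have a2': "(\<lambda>b. \<integral>\<^sup>+ z. a v (c, b, z) \<partial>unif) \<in> borel_measurable unif" if "v \<in> {..<n}" for v c
    using a2[OF that, of c] by (intro unif.borel_measurable_nn_integral) (auto simp: case_prod_beta)
  have meas: "(\<lambda>\<xi>. \<Prod>v<n. a v (samples n \<xi> v)) \<in> borel_measurable (sample_space n)"
    using a
    by (intro borel_measurable_prod_ennreal measurable_compose[OF samples_measurable]
        measurable_compose[OF measurable_component_singleton]) (auto simp: measurable_cong_sets[OF sets_smp refl])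
  have "emeasure (distr (sample_space n) (PiM {..<n} smp) (samples n)) (PiE {..<n} A) =
      (\<integral>\<^sup>+ \<zeta>. indicator (PiE {..<n} A) \<zeta> \<partial>distr (sample_space n) (PiM {..<n} smp) (samples n))"
    using A by (subst nn_integral_indicator) (auto intro!: sets_PiM_I_finite)
  also have "\<dots> = (\<integral>\<^sup>+ \<xi>. indicator (PiE {..<n} A) (samples n \<xi>) \<partial>sample_space n)"
    using A by (intro nn_integral_distr samples_measurable) (auto intro!: borel_measurable_indicator sets_PiM_I_finite)
  also have "\<dots> = (\<integral>\<^sup>+ \<xi>. (\<Prod>v<n. a v (samples n \<xi> v)) \<partial>sample_space n)"
  proof (rule nn_integral_cong)
    fix \<xi>
    have "samples n \<xi> \<in> PiE {..<n} A \<longleftrightarrow> (\<forall>v<n. samples n \<xi> v \<in> A v)"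
      by (auto simp: samples_def PiE_iff extensional_def split: prod.splits)
    thus "indicator (PiE {..<n} A) (samples n \<xi>) = (\<Prod>v<n. a v (samples n \<xi> v))"
      by (auto simp: a_def indicator_def)
  qed
  also have "\<dots> = (\<integral>\<^sup>+ F. \<integral>\<^sup>+ q. (\<Prod>v<n. a v (samples n (F, q) v)) \<partial>(?U \<Otimes>\<^sub>M ?S) \<partial>?C)"
    using meas unfolding sample_space_def by (subst US.nn_integral_fst) auto
  also have "\<dots> = (\<integral>\<^sup>+ F. \<integral>\<^sup>+ Y. \<integral>\<^sup>+ \<omega>. (\<Prod>v<n. a v (F v, Y v, \<omega> !! v)) \<partial>?S \<partial>?U \<partial>?C)"
  proof (rule nn_integral_cong)
    fix F assume "F \<in> space ?C"
    hence "(\<lambda>q. (F, q)) \<in> measurable (?U \<Otimes>\<^sub>M ?S) (sample_space n)"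
      unfolding sample_space_def by measurable
    from measurable_compose[OF this meas]
    have "(\<integral>\<^sup>+ q. (\<Prod>v<n. a v (samples n (F, q) v)) \<partial>(?U \<Otimes>\<^sub>M ?S)) =
        (\<integral>\<^sup>+ Y. \<integral>\<^sup>+ \<omega>. (\<Prod>v<n. a v (samples n (F, Y, \<omega>) v)) \<partial>?S \<partial>?U)"
      by (subst S.nn_integral_fst) auto
    also have "\<dots> = (\<integral>\<^sup>+ Y. \<integral>\<^sup>+ \<omega>. (\<Prod>v<n. a v (F v, Y v, \<omega> !! v)) \<partial>?S \<partial>?U)"
      by (intro nn_integral_cong prod.cong) (auto simp: samples_def)
    finally show "(\<integral>\<^sup>+ q. (\<Prod>v<n. a v (samples n (F, q) v)) \<partial>(?U \<Otimes>\<^sub>M ?S)) = \<dots>" .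
  qed
  also have "\<dots> = (\<integral>\<^sup>+ F. \<integral>\<^sup>+ Y. (\<Prod>v<n. \<integral>\<^sup>+ z. a v (F v, Y v, z) \<partial>unif) \<partial>?U \<partial>?C)"
    using a3 by (intro nn_integral_cong nn_integral_stream_space_prod unif.prob_space_axioms) auto
  also have "\<dots> = (\<integral>\<^sup>+ F. (\<Prod>v<n. \<integral>\<^sup>+ b. \<integral>\<^sup>+ z. a v (F v, b, z) \<partial>unif \<partial>unif) \<partial>?C)"
    using a2' by (intro nn_integral_cong PU.product_nn_integral_prod) auto
  also have "\<dots> = (\<Prod>v<n. \<integral>\<^sup>+ c. \<integral>\<^sup>+ b. \<integral>\<^sup>+ z. a v (c, b, z) \<partial>unif \<partial>unif \<partial>measure_pmf (ch v))"
    by (rule PC.product_nn_integral_prod) auto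
  also have "\<dots> = (\<Prod>v<n. emeasure (smp v) (A v))"
  proof (rule prod.cong[OF refl])
    fix v assume v: "v \<in> {..<n}"
    have "(\<integral>\<^sup>+ c. \<integral>\<^sup>+ b. \<integral>\<^sup>+ z. a v (c, b, z) \<partial>unif \<partial>unif \<partial>measure_pmf (ch v)) =
        (\<integral>\<^sup>+ c. \<integral>\<^sup>+ q. a v (c, q) \<partial>(unif \<Otimes>\<^sub>M unif) \<partial>measure_pmf (ch v))"
      using a2[OF v] by (intro nn_integral_cong unif.nn_integral_fst) auto
    also have "\<dots> = (\<integral>\<^sup>+ z. a v z \<partial>smp v)"
      unfolding smp_def using a[OF v] by (intro UU.nn_integral_fst) auto
    also have "\<dots> = emeasure (smp v) (A v)"
      unfolding a_def using A[OF v] by simp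
    finally show "(\<integral>\<^sup>+ c. \<integral>\<^sup>+ b. \<integral>\<^sup>+ z. a v (c, b, z) \<partial>unif \<partial>unif \<partial>measure_pmf (ch v)) =
        emeasure (smp v) (A v)" .
  qed
  finally show "emeasure (distr (sample_space n) (PiM {..<n} smp) (samples n)) (PiE {..<n} A) =
      (\<Prod>v<n. emeasure (smp v) (A v))" .
qed simp_all

end


section \<open>The program\<close>

lemma upd_apply: "upd m a i j z a' i' j' = (if a' = a \<and> i' = i \<and> j' = j then z else m a' i' j')"
  by (simp add: upd_def)

lemma upd_other: "a' \<noteq> a \<Longrightarrow> upd m a i j z a' = m a'"
  by (simp add: upd_def)

abbreviation zero :: iexp where "zero \<equiv> IConst 0"
abbreviation one :: iexp where "one \<equiv> IConst 1"

text \<open>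
  Beyond the cells prescribed by the model, integer array 4 records that the coins have been drawn,
  5 holds a loop counter and 6 marks the matched vertices; real array 2 holds the coins and 3 the
  sum of two rows of the matrix \<open>x\<close> and the value of \<open>m\<close>.
\<close>

abbreviation size_exp :: iexp where "size_exp \<equiv> ICell 0 zero zero"
abbreviation vertex_exp :: iexp where "vertex_exp \<equiv> ICell 2 zero zero"
abbreviation revealed_exp :: iexp where "revealed_exp \<equiv> ICell 2 zero one"
abbreviation partner_exp :: iexp where "partner_exp \<equiv> ISub revealed_exp one"
abbreviation started_exp :: iexp where "started_exp \<equiv> ICell 4 zero zero"
abbreviation counter_exp :: iexp where "counter_exp \<equiv> ICell 5 zero zero"
abbreviation matched_exp :: "iexp \<Rightarrow> iexp" where "matched_exp w \<equiv> ICell 6 w zero"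
abbreviation set_counter :: "iexp \<Rightarrow> real com" where "set_counter \<equiv> ISet 5 zero zero"

abbreviation time_exp :: "real rexp" where "time_exp \<equiv> RCell 1 zero zero"
abbreviation coin_exp :: "real rexp" where "coin_exp \<equiv> RCell 2 vertex_exp zero"
abbreviation sum_exp :: "real rexp" where "sum_exp \<equiv> RCell 3 zero zero"
abbreviation excess_exp :: "real rexp" where "excess_exp \<equiv> RCell 3 zero one"

definition draw_loop :: "real com" where
  "draw_loop = Loop (ILess counter_exp size_exp)
     (Seq (Draw 2 counter_exp zero) (set_counter (IAdd counter_exp one)))"

definition sum_loop :: "real com" where
  "sum_loop = Loop (ILess counter_exp size_exp)
     (Seq (RSet 3 zero zero
            (RAdd sum_exp (RAdd (RCell 0 partner_exp counter_exp) (RCell 0 vertex_exp counter_exp))))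
       (set_counter (IAdd counter_exp one)))"

definition fade_exp :: "real \<Rightarrow> real \<Rightarrow> real rexp" where
  "fade_exp a b = RSub (RMult (RConst a) time_exp) (RMult (RConst b) (RMult time_exp time_exp))"

definition att_exp :: "real rexp" where
  "att_exp = RSub (RConst 1) (RMult (RSub (RConst 1) excess_exp)
     (RAdd (fade_exp (6/5) (3/4)) (RMult excess_exp (fade_exp 1 (4/5)))))"

text \<open>All coins are drawn at the first arrival. In the branches with nothing to do,
  \<open>set_counter zero\<close> plays the part of a skip command; it is harmless because the
  counter is reset before every loop.\<close>

definition start_com :: "real com" where
  "start_com = Cond (ILess started_exp one)
     (Seq (ISet 4 zero zero one) (Seq (set_counter zero) draw_loop)) (set_counter zero)"

definition decide_com :: "real com" where
  "decide_com = Seq (set_counter zero) (Seq (RSet 3 zero zero (RConst 0)) (Seq sum_loop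
     (Seq (RSet 3 zero one (RSub (RDiv sum_exp (RConst 2)) (RCell 0 partner_exp vertex_exp)))
       (Cond (BAnd (ILess (matched_exp partner_exp) one) (RLess coin_exp att_exp))
         (Seq (ISet 6 partner_exp zero one) (Seq (ISet 6 vertex_exp zero one) (ISet 3 zero zero one)))
         (set_counter zero)))))"

definition scheme :: "real com" where
  "scheme = Seq start_com (Cond (ILess zero revealed_exp) decide_com (set_counter zero))"

lemma algebraic_constants_scheme: "a \<in> constants scheme \<Longrightarrow> algebraic a"
proof -
  have "constants scheme \<subseteq> \<rat>"
    by (simp add: scheme_def start_com_def decide_com_def draw_loop_def sum_loop_def att_exp_def
        fade_exp_def)
  thus "a \<in> constants scheme \<Longrightarrow> algebraic a" by (auto intro: rat_imp_algebraic)
qed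

text \<open>Each round costs three steps, one for the test and two for the assignments, and the last
  test costs one more. The offset \<open>i - k\<close> is due to \<open>rand s\<close> being the
  unread part of the stream when the counter stands at \<open>k\<close>.\<close>

lemma draw_loop_exec:
  assumes "imem s 0 0 0 = n" "imem s 5 0 0 = k" "k \<le> n"
  shows "\<exists>s'. exec draw_loop s (3 * (n - k) + 1) s' \<and>
    (\<forall>i. k \<le> i \<and> i < n \<longrightarrow> rmem s' 2 i 0 = rand s !! (i - k)) \<and>
    (\<forall>i<k. rmem s' 2 i 0 = rmem s 2 i 0) \<and>
    (\<forall>a. a \<noteq> 2 \<longrightarrow> rmem s' a = rmem s a) \<and> (\<forall>a. a \<noteq> 5 \<longrightarrow> imem s' a = imem s a)"
  using assms
proof (induction "n - k" arbitrary: k s)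
  case 0
  hence "exec draw_loop s 1 s" unfolding draw_loop_def by (intro exec.LoopFalse) simp
  thus ?case using 0 by (intro exI[of _ s]) auto
next
  case (Suc d)
  define s1 where "s1 = s\<lparr>rmem := upd (rmem s) 2 k 0 (shd (rand s)), rand := stl (rand s)\<rparr>"
  define s2 where "s2 = s1\<lparr>imem := upd (imem s1) 5 0 0 (Suc k)\<rparr>"
  have "exec (Draw 2 counter_exp zero) s 1 s1"
    using exec.Draw[of 2 counter_exp zero s] Suc.prems by (simp add: s1_def)
  moreover have "exec (set_counter (IAdd counter_exp one)) s1 1 s2"
    using exec.ISet[of 5 zero zero "IAdd counter_exp one" s1] Suc.prems by (simp add: s1_def s2_def)
  ultimately have body: "exec (Seq (Draw 2 counter_exp zero) (set_counter (IAdd counter_exp one))) s (1 + 1) s2"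
    by (rule exec.Seq)
  have s2: "imem s2 0 0 0 = n" "imem s2 5 0 0 = Suc k" "rand s2 = stl (rand s)"
    "\<And>i. rmem s2 2 i 0 = (if i = k then shd (rand s) else rmem s 2 i 0)"
    "\<And>a. a \<noteq> 2 \<Longrightarrow> rmem s2 a = rmem s a" "\<And>a. a \<noteq> 5 \<Longrightarrow> imem s2 a = imem s a"
    using Suc.prems by (auto simp: s2_def s1_def upd_apply upd_other)
  have "d = n - Suc k" "Suc k \<le> n" using Suc by auto
  from Suc.hyps(1)[OF this(1) s2(1,2) this(2)] obtain s' where s':
    "exec draw_loop s2 (3 * (n - Suc k) + 1) s'"
    "\<forall>i. Suc k \<le> i \<and> i < n \<longrightarrow> rmem s' 2 i 0 = rand s2 !! (i - Suc k)"
    "\<forall>i<Suc k. rmem s' 2 i 0 = rmem s2 2 i 0"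
    "\<forall>a. a \<noteq> 2 \<longrightarrow> rmem s' a = rmem s2 a" "\<forall>a. a \<noteq> 5 \<longrightarrow> imem s' a = imem s2 a"
    by blast
  have "exec draw_loop s (Suc ((1 + 1) + (3 * (n - Suc k) + 1))) s'"
    unfolding draw_loop_def
    by (rule exec.LoopTrue[OF _ body]) (use Suc.prems Suc.hyps(2) s'(1) in \<open>auto simp: draw_loop_def\<close>)
  moreover have "Suc ((1 + 1) + (3 * (n - Suc k) + 1)) = 3 * (n - k) + 1"
    using \<open>Suc k \<le> n\<close> by linarith
  moreover have "rmem s' 2 i 0 = rand s !! (i - k)" if "k \<le> i" "i < n" for i
  proof (cases "i = k")
    case True
    thus ?thesis using s'(3) s2(4) by simp
  next
    case False
    hence "Suc k \<le> i" "i - k = Suc (i - Suc k)" using that by auto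
    thus ?thesis using s'(2) s2(3) that by simp
  qed
  ultimately show ?case
    using s'(3-5) s2(4-6) by (intro exI[of _ s']) auto
qed

lemma sum_loop_exec:
  assumes "imem s 0 0 0 = n" "imem s 5 0 0 = k" "k \<le> n"
  shows "\<exists>s'. exec sum_loop s (3 * (n - k) + 1) s' \<and>
    rmem s' 3 0 0 = rmem s 3 0 0 +
      (\<Sum>i=k..<n. rmem s 0 (imem s 2 0 1 - 1) i + rmem s 0 (imem s 2 0 0) i) \<and>
    (\<forall>a. a \<noteq> 3 \<longrightarrow> rmem s' a = rmem s a) \<and> (\<forall>a. a \<noteq> 5 \<longrightarrow> imem s' a = imem s a)"
  using assms
proof (induction "n - k" arbitrary: k s)
  case 0
  hence "exec sum_loop s 1 s" unfolding sum_loop_def by (intro exec.LoopFalse) simp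
  thus ?case using 0 by (intro exI[of _ s]) auto
next
  case (Suc d)
  define f where "f i = rmem s 0 (imem s 2 0 1 - 1) i + rmem s 0 (imem s 2 0 0) i" for i
  define s1 where "s1 = s\<lparr>rmem := upd (rmem s) 3 0 0 (rmem s 3 0 0 + f k)\<rparr>"
  define s2 where "s2 = s1\<lparr>imem := upd (imem s1) 5 0 0 (Suc k)\<rparr>"
  let ?c = "RSet 3 zero zero
    (RAdd sum_exp (RAdd (RCell 0 partner_exp counter_exp) (RCell 0 vertex_exp counter_exp)))"
  have "exec ?c s 1 s1"
    using exec.RSet[of 3 zero zero "RAdd sum_exp (RAdd (RCell 0 partner_exp counter_exp)
        (RCell 0 vertex_exp counter_exp))" s] Suc.prems by (simp add: s1_def f_def)
  moreover have "exec (set_counter (IAdd counter_exp one)) s1 1 s2"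
    using exec.ISet[of 5 zero zero "IAdd counter_exp one" s1] Suc.prems by (simp add: s1_def s2_def)
  ultimately have body: "exec (Seq ?c (set_counter (IAdd counter_exp one))) s (1 + 1) s2"
    by (rule exec.Seq)
  have s2: "imem s2 0 0 0 = n" "imem s2 5 0 0 = Suc k" "rmem s2 3 0 0 = rmem s 3 0 0 + f k"
    "\<And>a. a \<noteq> 3 \<Longrightarrow> rmem s2 a = rmem s a" "\<And>a. a \<noteq> 5 \<Longrightarrow> imem s2 a = imem s a"
    using Suc.prems by (auto simp: s2_def s1_def upd_apply upd_other)
  have "d = n - Suc k" "Suc k \<le> n" using Suc by auto
  from Suc.hyps(1)[OF this(1) s2(1,2) this(2)] obtain s' where s':
    "exec sum_loop s2 (3 * (n - Suc k) + 1) s'"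
    "rmem s' 3 0 0 = rmem s2 3 0 0 +
      (\<Sum>i=Suc k..<n. rmem s2 0 (imem s2 2 0 1 - 1) i + rmem s2 0 (imem s2 2 0 0) i)"
    "\<forall>a. a \<noteq> 3 \<longrightarrow> rmem s' a = rmem s2 a" "\<forall>a. a \<noteq> 5 \<longrightarrow> imem s' a = imem s2 a"
    by blast
  have "exec sum_loop s (Suc ((1 + 1) + (3 * (n - Suc k) + 1))) s'"
    unfolding sum_loop_def
    by (rule exec.LoopTrue[OF _ body]) (use Suc.prems Suc.hyps(2) s'(1) in \<open>auto simp: sum_loop_def\<close>)
  moreover have "Suc ((1 + 1) + (3 * (n - Suc k) + 1)) = 3 * (n - k) + 1"
    using \<open>Suc k \<le> n\<close> by linarith
  moreover have "rmem s' 3 0 0 = rmem s 3 0 0 + (\<Sum>i=k..<n. f i)"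
    using s'(2) s2(3-5) \<open>Suc k \<le> n\<close> by (simp add: f_def sum.atLeast_Suc_lessThan)
  ultimately show ?case
    using s'(3,4) s2(4,5) by (intro exI[of _ s']) (auto simp: f_def)
qed

text \<open>\<open>D\<close> is the set of matched vertices and \<open>\<omega>\<close> the stream
  at the start of the whole run: either it is still unread or its first \<open>n\<close> entries are
  stored as coins. The acceptance flag is left out because \<open>feed\<close> resets it before each
  run.\<close>

definition scheme_inv :: "nat \<Rightarrow> (nat \<Rightarrow> nat \<Rightarrow> real) \<Rightarrow> real stream \<Rightarrow> nat set \<Rightarrow> mstate \<Rightarrow> bool" where
  "scheme_inv n z \<omega> D s \<longleftrightarrow> imem s 0 0 0 = n \<and> rmem s 0 = z \<and>
     (\<forall>w. imem s 6 w 0 = of_bool (w \<in> D)) \<and>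
     (imem s 4 0 0 = 0 \<and> rand s = \<omega> \<or> imem s 4 0 0 = 1 \<and> (\<forall>i<n. rmem s 2 i 0 = \<omega> !! i))"

lemma start_com_exec:
  assumes "scheme_inv n z \<omega> D s"
  shows "\<exists>t s'. exec start_com s t s' \<and> t \<le> 3 * n + 4 \<and> scheme_inv n z \<omega> D s' \<and> imem s' 4 0 0 = 1 \<and>
    imem s' 2 = imem s 2 \<and> imem s' 3 = imem s 3 \<and> rmem s' 1 = rmem s 1"
proof (cases "imem s 4 0 0 = 0")
  case True
  define s1 where "s1 = s\<lparr>imem := upd (imem s) 4 0 0 1\<rparr>"
  define s2 where "s2 = s1\<lparr>imem := upd (imem s1) 5 0 0 0\<rparr>"
  have e1: "exec (ISet 4 zero zero one) s 1 s1"
    using exec.ISet[of 4 zero zero one s] by (simp add: s1_def)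
  have e2: "exec (set_counter zero) s1 1 s2"
    using exec.ISet[of 5 zero zero zero s1] by (simp add: s2_def)
  have s2: "imem s2 0 0 0 = n" "imem s2 5 0 0 = 0" "imem s2 4 0 0 = 1" "rand s2 = rand s"
    "\<And>a. rmem s2 a = rmem s a" "\<And>a. a \<noteq> 5 \<Longrightarrow> a \<noteq> 4 \<Longrightarrow> imem s2 a = imem s a"
    using assms by (auto simp: s2_def s1_def upd_apply upd_other scheme_inv_def)
  obtain s' where s': "exec draw_loop s2 (3 * (n - 0) + 1) s'"
    "\<forall>i. 0 \<le> i \<and> i < n \<longrightarrow> rmem s' 2 i 0 = rand s2 !! (i - 0)"
    "\<forall>a. a \<noteq> 2 \<longrightarrow> rmem s' a = rmem s2 a" "\<forall>a. a \<noteq> 5 \<longrightarrow> imem s' a = imem s2 a"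
    using draw_loop_exec[OF s2(1,2) le0] by auto
  have "exec start_com s (Suc (1 + (1 + (3 * (n - 0) + 1)))) s'"
    unfolding start_com_def using True
    by (intro exec.CondTrue exec.Seq[OF e1] exec.Seq[OF e2] s'(1)) auto
  moreover have "scheme_inv n z \<omega> D s'"
    using assms True s' s2 by (auto simp: scheme_inv_def)
  ultimately show ?thesis
    using s' s2 by (intro exI[of _ "Suc (1 + (1 + (3 * (n - 0) + 1)))"] exI[of _ s']) auto
next
  case False
  define s1 where "s1 = s\<lparr>imem := upd (imem s) 5 0 0 0\<rparr>"
  have "exec start_com s (Suc 1) s1"
    unfolding start_com_def using False exec.ISet[of 5 zero zero zero s]
    by (intro exec.CondFalse) (auto simp: s1_def)
  moreover have "scheme_inv n z \<omega> D s1" "imem s1 4 0 0 = 1" "imem s1 2 = imem s 2"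
    "imem s1 3 = imem s 3" "rmem s1 1 = rmem s 1"
    using assms False by (auto simp: scheme_inv_def s1_def upd_apply upd_other)
  ultimately show ?thesis by (intro exI[of _ "Suc 1"] exI[of _ s1]) auto
qed

lemma rval_att_exp: "rval att_exp s = att (rmem s 3 0 1) (rmem s 1 0 0)"
  by (simp add: att_exp_def fade_exp_def att_def fade\<^sub>1_def fade\<^sub>2_def power2_eq_square)

text \<open>\<open>u\<close> decodes the partner from \<open>Suc u\<close>. If nothing is revealed,
  truncated subtraction yields the dummy value 0, which the guard \<open>0 < imem s 2 0 1\<close> in
  \<open>A\<close> masks. The flag is 0 beforehand, so the program writes it on acceptance
  only.\<close>

lemma scheme_exec:
  assumes inv: "scheme_inv n z \<omega> D s" and out: "imem s 3 0 0 = 0" and v: "imem s 2 0 0 = v" "v < n"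
  defines "u \<equiv> imem s 2 0 1 - 1"
  defines "A \<equiv> 0 < imem s 2 0 1 \<and> u \<notin> D \<and>
    \<omega> !! v < att ((\<Sum>i<n. z u i + z v i) / 2 - z u v) (rmem s 1 0 0)"
  shows "\<exists>t s'. exec scheme s t s' \<and> t \<le> 6 * n + 20 \<and> (accepts s' \<longleftrightarrow> A) \<and>
    scheme_inv n z \<omega> (if A then insert u (insert v D) else D) s'"
proof -
  obtain t0 s0 where s0: "exec start_com s t0 s0" "t0 \<le> 3 * n + 4" "scheme_inv n z \<omega> D s0"
    "imem s0 4 0 0 = 1" "imem s0 2 = imem s 2" "imem s0 3 = imem s 3" "rmem s0 1 = rmem s 1"
    using start_com_exec[OF inv] by blast
  show ?thesis
  proof (cases "0 < imem s 2 0 1")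
    case False
    define s1 where "s1 = s0\<lparr>imem := upd (imem s0) 5 0 0 0\<rparr>"
    have "exec (Cond (ILess zero revealed_exp) decide_com (set_counter zero)) s0 (Suc 1) s1"
      using False s0 exec.ISet[of 5 zero zero zero s0] by (intro exec.CondFalse) (auto simp: s1_def)
    hence "exec scheme s (t0 + Suc 1) s1" unfolding scheme_def using s0(1) by (rule exec.Seq[rotated])
    moreover have "scheme_inv n z \<omega> D s1" "\<not> accepts s1"
      using s0 out by (auto simp: scheme_inv_def s1_def upd_apply upd_other accepts_def)
    ultimately show ?thesis
      using False s0(2) by (intro exI[of _ "t0 + Suc 1"] exI[of _ s1]) (auto simp: A_def)
  next
    case True
    define s1 where "s1 = s0\<lparr>imem := upd (imem s0) 5 0 0 0\<rparr>"
    define s2 where "s2 = s1\<lparr>rmem := upd (rmem s1) 3 0 0 0\<rparr>"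
    have e1: "exec (set_counter zero) s0 1 s1"
      using exec.ISet[of 5 zero zero zero s0] by (simp add: s1_def)
    have e2: "exec (RSet 3 zero zero (RConst 0)) s1 1 s2"
      using exec.RSet[of 3 zero zero "RConst 0" s1] by (simp add: s2_def)
    have s2: "imem s2 0 0 0 = n" "imem s2 5 0 0 = 0" "rmem s2 3 0 0 = 0"
      "\<And>a. a \<noteq> 3 \<Longrightarrow> rmem s2 a = rmem s0 a" "\<And>a. a \<noteq> 5 \<Longrightarrow> imem s2 a = imem s0 a"
      using s0 by (auto simp: s2_def s1_def upd_apply upd_other scheme_inv_def)
    obtain s3 where s3: "exec sum_loop s2 (3 * (n - 0) + 1) s3"
      "rmem s3 3 0 0 = rmem s2 3 0 0 +
        (\<Sum>i=0..<n. rmem s2 0 (imem s2 2 0 1 - 1) i + rmem s2 0 (imem s2 2 0 0) i)"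
      "\<forall>a. a \<noteq> 3 \<longrightarrow> rmem s3 a = rmem s2 a" "\<forall>a. a \<noteq> 5 \<longrightarrow> imem s3 a = imem s2 a"
      using sum_loop_exec[OF s2(1,2) le0] by blast
    define m where "m = (\<Sum>i<n. z u i + z v i) / 2 - z u v"
    define s4 where "s4 = s3\<lparr>rmem := upd (rmem s3) 3 0 1 m\<rparr>"
    have z: "rmem s0 0 = z" using s0 by (simp add: scheme_inv_def)
    have "rmem s3 3 0 0 = (\<Sum>i<n. z u i + z v i)"
      using s3 s2 s0 v z by (simp add: u_def lessThan_atLeast0)
    hence e4: "exec (RSet 3 zero one (RSub (RDiv sum_exp (RConst 2)) (RCell 0 partner_exp vertex_exp))) s3 1 s4"
      using exec.RSet[of 3 zero one "RSub (RDiv sum_exp (RConst 2)) (RCell 0 partner_exp vertex_exp)" s3]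
        s3 s2 s0 v z by (simp add: s4_def m_def u_def)
    have s4: "rmem s4 3 0 1 = m" "\<And>a. a \<noteq> 3 \<Longrightarrow> rmem s4 a = rmem s0 a"
      "\<And>a. a \<noteq> 5 \<Longrightarrow> imem s4 a = imem s0 a"
      using s3 s2 by (auto simp: s4_def upd_apply upd_other)
    let ?b = "BAnd (ILess (matched_exp partner_exp) one) (RLess coin_exp att_exp)"
    let ?acc = "Seq (ISet 6 partner_exp zero one) (Seq (ISet 6 vertex_exp zero one) (ISet 3 zero zero one))"
    have "rmem s4 2 v 0 = \<omega> !! v" using s0 s4(2)[of 2] v by (auto simp: scheme_inv_def)
    hence b: "bval ?b s4 \<longleftrightarrow> A"
      using s4 s0 v True by (auto simp: scheme_inv_def rval_att_exp A_def u_def m_def)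
    have "\<exists>t s'. exec (Cond ?b ?acc (set_counter zero)) s4 t s' \<and> t \<le> 4 \<and> (accepts s' \<longleftrightarrow> A) \<and>
        scheme_inv n z \<omega> (if A then insert u (insert v D) else D) s'"
    proof (cases A)
      case A: True
      define s5 where "s5 = s4\<lparr>imem := upd (imem s4) 6 u 0 1\<rparr>"
      define s6 where "s6 = s5\<lparr>imem := upd (imem s5) 6 v 0 1\<rparr>"
      define s7 where "s7 = s6\<lparr>imem := upd (imem s6) 3 0 0 1\<rparr>"
      have i2: "imem s4 2 = imem s 2" "imem s5 2 = imem s 2"
        using s4 s0 by (auto simp: s5_def upd_other)
      have "exec (ISet 6 partner_exp zero one) s4 1 s5"
        using exec.ISet[of 6 partner_exp zero one s4] i2 by (simp add: s5_def u_def)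
      moreover have "exec (ISet 6 vertex_exp zero one) s5 1 s6"
        using exec.ISet[of 6 vertex_exp zero one s5] i2 v by (simp add: s6_def)
      moreover have "exec (ISet 3 zero zero one) s6 1 s7"
        using exec.ISet[of 3 zero zero one s6] by (simp add: s7_def)
      ultimately have "exec (Cond ?b ?acc (set_counter zero)) s4 (Suc (1 + (1 + 1))) s7"
        using b A by (intro exec.CondTrue exec.Seq) auto
      moreover have "accepts s7" by (simp add: accepts_def s7_def upd_apply)
      moreover have "scheme_inv n z \<omega> (insert u (insert v D)) s7"
        using s0 s4(2)[of 0] s4(2)[of 2] s4(3)[of 0] s4(3)[of 4] s4(3)[of 6]
        by (auto simp: scheme_inv_def s7_def s6_def s5_def upd_apply upd_other)
      ultimately show ?thesis using A by (intro exI[of _ "Suc (1 + (1 + 1))"] exI[of _ s7]) auto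
    next
      case A: False
      define s5 where "s5 = s4\<lparr>imem := upd (imem s4) 5 0 0 0\<rparr>"
      have "exec (Cond ?b ?acc (set_counter zero)) s4 (Suc 1) s5"
        using b A exec.ISet[of 5 zero zero zero s4] by (intro exec.CondFalse) (auto simp: s5_def)
      moreover have "\<not> accepts s5"
        using s4(3)[of 3] s0 out by (simp add: accepts_def s5_def upd_apply)
      moreover have "scheme_inv n z \<omega> D s5"
        using s0 s4(2)[of 0] s4(2)[of 2] s4(3)[of 0] s4(3)[of 4] s4(3)[of 6]
        by (auto simp: scheme_inv_def s5_def upd_apply upd_other)
      ultimately show ?thesis using A by (intro exI[of _ "Suc 1"] exI[of _ s5]) auto
    qed
    then obtain t s' where s': "exec (Cond ?b ?acc (set_counter zero)) s4 t s'" "t \<le> 4"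
      "accepts s' \<longleftrightarrow> A" "scheme_inv n z \<omega> (if A then insert u (insert v D) else D) s'" by blast
    have "exec decide_com s0 (1 + (1 + ((3 * (n - 0) + 1) + (1 + t)))) s'"
      unfolding decide_com_def
      by (intro exec.Seq[OF e1] exec.Seq[OF e2] exec.Seq[OF s3(1)] exec.Seq[OF e4] s'(1))
    hence "exec scheme s (t0 + Suc (1 + (1 + ((3 * (n - 0) + 1) + (1 + t))))) s'"
      unfolding scheme_def using True s0
      by (intro exec.Seq[OF s0(1)] exec.CondTrue) auto
    thus ?thesis
      using s' s0(2) by (intro exI[of _ "t0 + Suc (1 + (1 + ((3 * (n - 0) + 1) + (1 + t))))"] exI[of _ s']) auto
  qed
qed

section \<open>Runs of the program as runs of the thinned process\<close>

lemma final_eqI: "exec c s t s' \<Longrightarrow> final c s = s'"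
  unfolding final_def by (rule the_equality) (auto dest: exec_deterministic)

lemma revealed_eq_Some_iff:
  "revealed E F Y v = Some u \<longleftrightarrow> u \<in> nbrs E v \<and> Y u < Y v \<and> F v = Some u"
proof -
  have *: "Y w < Y v \<and> active F Y w v \<longleftrightarrow> Y w < Y v \<and> F v = Some w" for w
    by (auto simp: active_def)
  have the: "(THE w. w \<in> nbrs E v \<and> Y w < Y v \<and> F v = Some w) = w"
    if "w \<in> nbrs E v" "Y w < Y v" "F v = Some w" for w
    using that by (intro the_equality) auto
  show ?thesis
    unfolding revealed_def * using the by auto
qed

lemma set_arrival_order [simp]: "set (arrival_order n Y) = {..<n}"
  and distinct_arrival_order [simp]: "distinct (arrival_order n Y)"
  and length_arrival_order [simp]: "length (arrival_order n Y) = n"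
  by (auto simp: arrival_order_def)

lemma arrival_order_nth_less: "i < n \<Longrightarrow> arrival_order n Y ! i < n"
  using nth_mem[of i "arrival_order n Y"] by simp

lemma arrival_order_mono:
  "i \<le> j \<Longrightarrow> j < n \<Longrightarrow> Y (arrival_order n Y ! i) \<le> Y (arrival_order n Y ! j)"
  using sorted_nth_mono[of "map Y (arrival_order n Y)" i j] by (simp add: arrival_order_def)

text \<open>A strictly smaller key stands earlier in a sorted list, so this inclusion survives ties.
  The converse inclusion in \<open>earlier_eq_take\<close> is where distinct arrival times
  enter.\<close>

lemma earlier_in_take:
  assumes "i < n" "u < n" "Y u < Y (arrival_order n Y ! i)"
  shows "u \<in> set (take i (arrival_order n Y))"
proof -
  obtain j where j: "j < n" "arrival_order n Y ! j = u"
    using assms(2) by (metis set_arrival_order length_arrival_order lessThan_iff in_set_conv_nth)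
  hence "j < i" using arrival_order_mono[of i j n Y] assms by (meson linorder_not_le)
  thus ?thesis using j assms by (auto simp: in_set_conv_nth intro!: exI[of _ j])
qed

lemma nth_notin_take: "i < n \<Longrightarrow> arrival_order n Y ! i \<notin> set (take i (arrival_order n Y))"
  by (auto simp: in_set_conv_nth nth_eq_iff_index_eq)

lemma earlier_eq_take:
  assumes "inj_on Y {..<n}" "i < n"
  shows "{w. w < n \<and> Y w < Y (arrival_order n Y ! i)} = set (take i (arrival_order n Y))"
proof (intro equalityI subsetI)
  fix w assume w: "w \<in> set (take i (arrival_order n Y))"
  then obtain j where j: "j < i" "w = arrival_order n Y ! j"
    using assms(2) by (auto simp: in_set_conv_nth)
  have wn: "w < n" using j assms(2) by (simp add: arrival_order_nth_less)
  have "w \<noteq> arrival_order n Y ! i" using nth_notin_take[OF assms(2), of Y] w by auto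
  hence "Y w \<noteq> Y (arrival_order n Y ! i)"
    using assms wn arrival_order_nth_less[OF assms(2)] by (auto dest: inj_onD)
  moreover have "Y w \<le> Y (arrival_order n Y ! i)"
    using arrival_order_mono[of j i n Y] j assms(2) by simp
  ultimately show "w \<in> {w. w < n \<and> Y w < Y (arrival_order n Y ! i)}" using wn by simp
qed (use earlier_in_take[OF assms(2)] in auto)

context matching_instance begin

lemma excess_eq: "(\<Sum>i<n. X u i + X v i) / 2 - X u v = excess u v"
  by (simp add: excess_def wdeg_def sum.distrib)

definition accepted :: "(nat \<Rightarrow> nat option) \<Rightarrow> (nat \<Rightarrow> real) \<Rightarrow> real stream \<Rightarrow> nat set \<Rightarrow> nat \<Rightarrow> nat \<Rightarrow> bool" where
  "accepted F Y \<omega> D v u \<longleftrightarrow> revealed E F Y v = Some u \<and> u \<notin> D \<and> \<omega> !! v < att (excess u v) (Y v)"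

definition run :: "(nat \<Rightarrow> nat option) \<Rightarrow> (nat \<Rightarrow> real) \<Rightarrow> real stream \<Rightarrow> nat \<Rightarrow> nat set set" where
  "run F Y \<omega> i = snd (play scheme n E x (F, Y, \<omega>) i)"

text \<open>At most one \<open>u\<close> is accepted, so the union adds the endpoints of one edge or
  nothing. This form covers both outcomes at once.\<close>

lemma scheme_step:
  assumes inv: "scheme_inv n X \<omega> D s" and v: "v < n"
  shows "\<exists>t\<le>6 * n + 20. \<exists>s'. exec scheme (fed_state E F Y v s) t s' \<and>
    (accepts s' \<longleftrightarrow> (\<exists>u. accepted F Y \<omega> D v u)) \<and>
    scheme_inv n X \<omega> (D \<union> (\<Union>u\<in>{u. accepted F Y \<omega> D v u}. {u, v})) s'"
proof -
  define sf where "sf = fed_state E F Y v s"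
  define k where "k = (case revealed E F Y v of None \<Rightarrow> 0 | Some u \<Rightarrow> Suc u)"
  have sf: "scheme_inv n X \<omega> D sf" "imem sf 3 0 0 = 0" "imem sf 2 0 0 = v" "imem sf 2 0 1 = k"
    "rmem sf 1 0 0 = Y v"
    using inv by (auto simp: sf_def fed_state_def feed_def scheme_inv_def upd_apply upd_other k_def)
  let ?A = "0 < k \<and> k - 1 \<notin> D \<and> \<omega> !! v < att (excess (k - 1) v) (Y v)"
  have A: "accepted F Y \<omega> D v u \<longleftrightarrow> ?A \<and> u = k - 1" for u
    by (auto simp: accepted_def k_def split: option.splits)
  obtain t s' where "exec scheme sf t s'" "t \<le> 6 * n + 20" "accepts s' \<longleftrightarrow> ?A"
    "scheme_inv n X \<omega> (if ?A then insert (k - 1) (insert v D) else D) s'"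
    using scheme_exec[OF sf(1-3) v] unfolding sf(4,5) excess_eq by blast
  moreover have "(if ?A then insert (k - 1) (insert v D) else D) =
      D \<union> (\<Union>u\<in>{u. accepted F Y \<omega> D v u}. {u, v})"
    using A by auto
  ultimately show ?thesis using A unfolding sf_def by auto
qed

lemma accepted_unique: "accepted F Y \<omega> D v u \<Longrightarrow> accepted F Y \<omega> D v u' \<Longrightarrow> u = u'"
  by (simp add: accepted_def)

text \<open>The marked vertices are those covered by the matching, and they have all arrived. The
  arriving vertex is therefore uncovered, the partner has passed the mark test, and
  \<open>try_add\<close> never refuses. Ties are included, since measurability will concern the
  whole space.\<close>

lemma play_invariant:
  assumes "i \<le> n"
  shows "scheme_inv n X \<omega> (\<Union>(run F Y \<omega> i)) (fst (play scheme n E x (F, Y, \<omega>) i)) \<and>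
    \<Union>(run F Y \<omega> i) \<subseteq> set (take i (arrival_order n Y)) \<and> matching (run F Y \<omega> i) \<and>
    (\<forall>j<i. run F Y \<omega> (Suc j) = run F Y \<omega> j \<union>
      {{u, arrival_order n Y ! j} |u. accepted F Y \<omega> (\<Union>(run F Y \<omega> j)) (arrival_order n Y ! j) u})"
  using assms
proof (induction i)
  case 0
  have "rmem (init n E x \<omega>) 0 = X" by (auto simp: init_def X_def fun_eq_iff)
  thus ?case by (auto simp: run_def scheme_inv_def init_def matching_def)
next
  case (Suc i)
  define v where "v = arrival_order n Y ! i"
  define s where "s = fst (play scheme n E x (F, Y, \<omega>) i)"
  let ?M = "run F Y \<omega> i"
  let ?acc = "accepted F Y \<omega> (\<Union>?M) v"
  have IH: "scheme_inv n X \<omega> (\<Union>?M) s" "\<Union>?M \<subseteq> set (take i (arrival_order n Y))" "matching ?M"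
    using Suc by (auto simp: s_def)
  have v: "v < n" using Suc.prems arrival_order_nth_less[of i n Y] by (simp add: v_def)
  obtain t s' where s': "exec scheme (fed_state E F Y v s) t s'" "accepts s' \<longleftrightarrow> (\<exists>u. ?acc u)"
    "scheme_inv n X \<omega> (\<Union>?M \<union> (\<Union>u\<in>{u. ?acc u}. {u, v})) s'"
    using scheme_step[OF IH(1) v, of F Y] by blast
  have play: "play scheme n E x (F, Y, \<omega>) (Suc i) = (s', case revealed E F Y v of
      None \<Rightarrow> ?M | Some u \<Rightarrow> if accepts s' then try_add {u, v} ?M else ?M)"
    using final_eqI[OF s'(1)]
    by (cases "play scheme n E x (F, Y, \<omega>) i") (simp add: Let_def run_def v_def s_def split: option.split)
  have vM: "v \<notin> \<Union>?M" using IH(2) nth_notin_take[of i n Y] Suc.prems by (auto simp: v_def)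
  have acc: "u \<in> set (take i (arrival_order n Y))" "matching (insert {u, v} ?M)" if "?acc u" for u
  proof -
    have u: "u < n" "Y u < Y v" "u \<notin> \<Union>?M"
      using that edge_verts[of u v] by (auto simp: accepted_def revealed_eq_Some_iff nbrs_def)
    show "u \<in> set (take i (arrival_order n Y))"
      using earlier_in_take[of i n u Y] u Suc.prems by (simp add: v_def)
    show "matching (insert {u, v} ?M)"
      using IH(3) u vM by (auto simp: matching_def pairwise_insert disjnt_def)
  qed
  have M: "run F Y \<omega> (Suc i) = ?M \<union> {{u, v} |u. ?acc u}"
  proof (cases "\<exists>u. ?acc u")
    case True
    then obtain u where u: "?acc u" by blast
    hence "{{u, v} |u. ?acc u} = {{u, v}}" using accepted_unique by blast
    moreover have "run F Y \<omega> (Suc i) = insert {u, v} ?M"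
      using play s'(2) u acc(2)[OF u] by (auto simp: run_def accepted_def try_add_def)
    ultimately show ?thesis by auto
  next
    case False
    thus ?thesis using play s'(2) by (auto simp: run_def split: option.splits)
  qed
  have U: "\<Union>(run F Y \<omega> (Suc i)) = \<Union>?M \<union> (\<Union>u\<in>{u. ?acc u}. {u, v})"
    unfolding M by auto
  have take: "set (take (Suc i) (arrival_order n Y)) = insert v (set (take i (arrival_order n Y)))"
    using Suc.prems by (simp add: take_Suc_conv_app_nth v_def)
  have match: "matching (run F Y \<omega> (Suc i))"
  proof (cases "\<exists>u. ?acc u")
    case True
    then obtain u where u: "?acc u" by blast
    hence "{{u, v} |u. ?acc u} = {{u, v}}" using accepted_unique by blast
    thus ?thesis using acc(2)[OF u] unfolding M by simp
  next
    case False
    thus ?thesis using IH(3) unfolding M by simp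
  qed
  have st: "fst (play scheme n E x (F, Y, \<omega>) (Suc i)) = s'" using play by simp
  have sub: "\<Union>?M \<union> (\<Union>u\<in>{u. ?acc u}. {u, v}) \<subseteq> insert v (set (take i (arrival_order n Y)))"
    using IH(2) acc(1) by blast
  have steps: "\<forall>j<Suc i. run F Y \<omega> (Suc j) = run F Y \<omega> j \<union>
      {{u, arrival_order n Y ! j} |u. accepted F Y \<omega> (\<Union>(run F Y \<omega> j)) (arrival_order n Y ! j) u}"
  proof (intro allI impI)
    fix j assume "j < Suc i"
    show "run F Y \<omega> (Suc j) = run F Y \<omega> j \<union>
      {{u, arrival_order n Y ! j} |u. accepted F Y \<omega> (\<Union>(run F Y \<omega> j)) (arrival_order n Y ! j) u}"
    proof (cases "j = i")
      case True
      show ?thesis unfolding True using M unfolding v_def .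
    next
      case False
      hence "j < i" using \<open>j < Suc i\<close> by simp
      with Suc.IH[OF Suc_leD[OF Suc.prems], THEN conjunct2, THEN conjunct2, THEN conjunct2]
      show ?thesis by (elim allE impE)
    qed
  qed
  show ?case
    using s'(3) sub match steps unfolding st take U[symmetric] by (intro conjI)
qed

lemmas run_inv = play_invariant[THEN conjunct1]

lemma run_Suc:
  "i < n \<Longrightarrow> run F Y \<omega> (Suc i) = run F Y \<omega> i \<union>
    {{u, arrival_order n Y ! i} |u. accepted F Y \<omega> (\<Union>(run F Y \<omega> i)) (arrival_order n Y ! i) u}"
  using play_invariant[of "Suc i" \<omega> F Y] by simp

lemma run_mono: "i \<le> j \<Longrightarrow> j \<le> n \<Longrightarrow> run F Y \<omega> i \<subseteq> run F Y \<omega> j"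
proof (induction j rule: dec_induct)
  case (step j)
  thus ?case using run_Suc[of j F Y \<omega>] by auto
qed simp

lemma run_subset: "i \<le> n \<Longrightarrow> run F Y \<omega> i \<subseteq> Pow {..<n}"
  using play_invariant[of i \<omega> F Y] set_take_subset[of i "arrival_order n Y"] by fastforce

lemma scheme_halts:
  "i < n \<Longrightarrow> halts_within scheme
    (fed_state E F Y (arrival_order n Y ! i) (fst (play scheme n E x (F, Y, \<omega>) i))) (6 * n + 20)"
  using scheme_step[OF run_inv arrival_order_nth_less, of i i] unfolding halts_within_def by fastforce

text \<open>The first \<open>i\<close> arrivals are matched with any time \<open>t\<close> before
  which exactly these vertices arrive; letting \<open>t\<close> vary permits the induction
  hypothesis at \<open>Y v\<close> for the next vertex \<open>v\<close>. A \<open>late\<close> event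
  before \<open>t\<close> either happened before \<open>Y v\<close> or has \<open>v\<close> as its
  later endpoint. As \<open>req\<close> does not consult the edges, \<open>F\<close> is assumed to
  choose neighbours.\<close>

lemma run_eq_taken:
  assumes inj: "inj_on Y {..<n}" and F: "\<And>v. v < n \<Longrightarrow> F v \<in> insert None (Some ` nbrs E v)"
    and \<zeta>: "\<And>v. v < n \<Longrightarrow> \<zeta> v = (F v, Y v, \<omega> !! v)"
    and i: "i \<le> n" and t: "{w. w < n \<and> Y w < t} = set (take i (arrival_order n Y))" and u: "u < n"
  shows "u \<in> \<Union>(run F Y \<omega> i) \<longleftrightarrow> taken {..<n} \<zeta> u t"
  using i t u
proof (induction i arbitrary: t u)
  case 0
  hence "\<not> late {..<n} \<zeta> w v t" if "w < n" "v < n" for w v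
    using that \<zeta> by (auto simp: late_def)
  hence "\<not> taken {..<n} \<zeta> u t" using taken_iff[of "{..<n}" u \<zeta> t] 0 by auto
  thus ?case by (simp add: run_def)
next
  case (Suc i)
  define v where "v = arrival_order n Y ! i"
  have v: "v < n" using Suc.prems arrival_order_nth_less[of i n Y] by (simp add: v_def)
  have take: "set (take (Suc i) (arrival_order n Y)) = insert v (set (take i (arrival_order n Y)))"
    using Suc.prems by (simp add: take_Suc_conv_app_nth v_def)
  have before: "{w. w < n \<and> Y w < Y v} = set (take i (arrival_order n Y))"
    using earlier_eq_take[OF inj] Suc.prems by (simp add: v_def)
  have IH: "a \<in> \<Union>(run F Y \<omega> i) \<longleftrightarrow> taken {..<n} \<zeta> a (Y v)" if "a < n" for a
    using Suc.IH[of "Y v" a] before that Suc.prems by simp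
  have arr: "arr \<zeta> w = Y w" if "w < n" for w using \<zeta> that by simp
  have lt: "Y w < t \<longleftrightarrow> Y w < Y v \<or> w = v" if "w < n" for w
    using Suc.prems(2) take before that by blast
  have late_split: "late {..<n} \<zeta> w a t \<longleftrightarrow> late {..<n} \<zeta> w a (Y v) \<or> w = v \<and> late {..<n} \<zeta> v a t"
    if "w < n" for w a
    using lt[of w] that by (auto simp: late_def arr)
  have acc: "accepted F Y \<omega> (\<Union>(run F Y \<omega> i)) v a \<longleftrightarrow> late {..<n} \<zeta> v a t" if "a < n" for a
  proof -
    have "F v = Some a \<Longrightarrow> a \<in> nbrs E v" using F[OF v] by auto
    thus ?thesis
      using IH[OF that] lt[OF v] v that \<zeta>[OF v] \<zeta>[OF that]
      by (auto simp: accepted_def late_def req_def revealed_eq_Some_iff)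
  qed
  have acc_n: "a < n" if "accepted F Y \<omega> D v a" for a D
    using that edge_verts[of a v] by (auto simp: accepted_def revealed_eq_Some_iff nbrs_def)
  have "u \<in> \<Union>(run F Y \<omega> (Suc i)) \<longleftrightarrow> u \<in> \<Union>(run F Y \<omega> i) \<or>
      (\<exists>a. accepted F Y \<omega> (\<Union>(run F Y \<omega> i)) v a \<and> (u = a \<or> u = v))"
    using run_Suc[of i F Y \<omega>] Suc.prems unfolding v_def by (simp add: Bex_def) blast
  also have "\<dots> \<longleftrightarrow> taken {..<n} \<zeta> u (Y v) \<or> (\<exists>a<n. late {..<n} \<zeta> v a t \<and> (u = a \<or> u = v))"
    using IH[OF Suc.prems(3)] acc acc_n by blast
  also have "\<dots> \<longleftrightarrow> taken {..<n} \<zeta> u t"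
  proof -
    have iff: "taken {..<n} \<zeta> u s \<longleftrightarrow> (\<exists>w<n. late {..<n} \<zeta> w u s) \<or> (\<exists>w<n. late {..<n} \<zeta> u w s)" for s
      using taken_iff[of "{..<n}" u \<zeta> s] Suc.prems(3) by (simp add: Bex_def)
    have "(\<exists>w<n. late {..<n} \<zeta> w u t) \<longleftrightarrow> (\<exists>w<n. late {..<n} \<zeta> w u (Y v)) \<or> late {..<n} \<zeta> v u t"
      using late_split v by blast
    moreover have "(\<exists>w<n. late {..<n} \<zeta> u w t) \<longleftrightarrow>
        (\<exists>w<n. late {..<n} \<zeta> u w (Y v)) \<or> u = v \<and> (\<exists>w<n. late {..<n} \<zeta> v w t)"
      using late_split[OF Suc.prems(3)] by blast
    ultimately show ?thesis unfolding iff using Suc.prems(3) by blast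
  qed
  finally show ?case .
qed

text \<open>At the arrival of \<open>v\<close>, \<open>run_eq_taken\<close> with
  \<open>t = Y v\<close> translates the vacancy of \<open>u\<close> into \<open>u\<close> being
  uncovered in the program, which then accepts. By \<open>run_mono\<close> the edge stays.\<close>

lemma late_imp_matched:
  assumes inj: "inj_on Y {..<n}" and F: "\<And>v. v < n \<Longrightarrow> F v \<in> insert None (Some ` nbrs E v)"
    and \<zeta>: "\<And>v. v < n \<Longrightarrow> \<zeta> v = (F v, Y v, \<omega> !! v)"
    and uv: "u < n" "v < n" "late {..<n} \<zeta> v u t"
  shows "{u, v} \<in> rcrs_matching scheme n E x (F, Y, \<omega>)"
proof -
  obtain i where i: "i < n" "arrival_order n Y ! i = v"
    using uv(2) by (metis set_arrival_order length_arrival_order lessThan_iff in_set_conv_nth)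
  have "{w. w < n \<and> Y w < Y v} = set (take i (arrival_order n Y))"
    using earlier_eq_take[OF inj i(1)] i(2) by simp
  hence "u \<notin> \<Union>(run F Y \<omega> i)"
    using run_eq_taken[OF inj F \<zeta>, of i "Y v" u] i uv \<zeta>[of v] by (auto simp: late_def)
  hence "accepted F Y \<omega> (\<Union>(run F Y \<omega> i)) v u"
    using uv \<zeta>[of u] \<zeta>[of v] F[of v]
    by (auto simp: accepted_def late_def req_def revealed_eq_Some_iff)
  hence "{u, v} \<in> run F Y \<omega> (Suc i)" using run_Suc[of i F Y \<omega>] i by auto
  thus ?thesis
    using run_mono[of "Suc i" n F Y \<omega>] i by (auto simp: rcrs_matching_def run_def)
qed

end


section \<open>Selectability\<close>

text \<open>
  Measurability of the event that an edge is selected has to be shown on the whole space, ties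
  between arrival times included, because the space need not be complete.
\<close>

lemma pred_insort_key:
  fixes Y :: "'b \<Rightarrow> nat \<Rightarrow> real"
  assumes Y: "\<And>a. a < n \<Longrightarrow> (\<lambda>\<xi>. Y \<xi> a) \<in> borel_measurable M"
    and "a < n" "set ys \<subseteq> {..<n}"
  shows "Measurable.pred M (\<lambda>\<xi>. insort_key (Y \<xi>) a ys = xs)"
  using assms(3)
proof (induction ys arbitrary: xs)
  case (Cons y ys)
  let ?R = "\<lambda>\<xi>. \<not> Y \<xi> y < Y \<xi> a \<and> a # y # ys = xs \<or>
      Y \<xi> y < Y \<xi> a \<and> xs \<noteq> [] \<and> y = hd xs \<and> insort_key (Y \<xi>) a ys = tl xs"
  have "Measurable.pred M (\<lambda>\<xi>. Y \<xi> y < Y \<xi> a)"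
    using Y \<open>a < n\<close> Cons.prems by (intro borel_measurable_pred_less) auto
  moreover have "Measurable.pred M (\<lambda>\<xi>. insort_key (Y \<xi>) a ys = tl xs)"
    using Cons by simp
  ultimately have "Measurable.pred M ?R"
    by (intro pred_intros_logic) simp_all
  moreover have "(\<lambda>\<xi>. insort_key (Y \<xi>) a (y # ys) = xs) = ?R"
    by (cases xs) (auto simp: fun_eq_iff)
  ultimately show ?case by (simp only:)
qed simp

text \<open>The sorted tail takes finitely many values. Quantifying over them turns the nesting into
  a finite disjunction of events covered by \<open>pred_insort_key\<close> and the induction
  hypothesis.\<close>

lemma pred_sort_key:
  fixes Y :: "'b \<Rightarrow> nat \<Rightarrow> real"
  assumes Y: "\<And>a. a < n \<Longrightarrow> (\<lambda>\<xi>. Y \<xi> a) \<in> borel_measurable M" and "set zs \<subseteq> {..<n}"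
  shows "Measurable.pred M (\<lambda>\<xi>. sort_key (Y \<xi>) zs = xs)"
  using assms(2)
proof (induction zs arbitrary: xs)
  case (Cons z zs)
  let ?L = "{ys. set ys \<subseteq> set zs \<and> length ys = length zs}"
  have "Measurable.pred M (\<lambda>\<xi>. \<exists>ys\<in>?L. sort_key (Y \<xi>) zs = ys \<and> insort_key (Y \<xi>) z ys = xs)"
    using Cons Y by (intro pred_intros_finite pred_intros_logic pred_insort_key[of n]
      finite_lists_length_eq) auto
  moreover have "sort_key (Y \<xi>) (z # zs) = xs \<longleftrightarrow>
      (\<exists>ys\<in>?L. sort_key (Y \<xi>) zs = ys \<and> insort_key (Y \<xi>) z ys = xs)" for \<xi>
    using set_sort[of "Y \<xi>" zs] length_sort[of "Y \<xi>" zs] by (auto simp del: set_sort length_sort)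
  ultimately show ?case by (simp only:)
qed simp

context matching_instance begin

abbreviation AS where "AS \<equiv> sample_space n"

lemma arrival_space_eq: "arrival_space n E x = AS"
  by (simp add: arrival_space_def sample_space_def)

lemma pred_arrival:
  assumes "i < n"
  shows "Measurable.pred AS (\<lambda>\<xi>. arrival_order n (fst (snd \<xi>)) ! i = v)"
proof -
  let ?L = "{ys. set ys \<subseteq> {..<n} \<and> length ys = n}"
  have "Measurable.pred AS (\<lambda>\<xi>. \<exists>ys\<in>?L. sort_key (fst (snd \<xi>)) [0..<n] = ys \<and> ys ! i = v)"
    using sample_space_components(2)
    by (intro pred_intros_finite pred_intros_logic pred_sort_key[of n] finite_lists_length_eq) auto
  moreover have "arrival_order n (fst (snd \<xi>)) ! i = v \<longleftrightarrow>
      (\<exists>ys\<in>?L. sort_key (fst (snd \<xi>)) [0..<n] = ys \<and> ys ! i = v)"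
    for \<xi> :: "(nat \<Rightarrow> nat option) \<times> (nat \<Rightarrow> real) \<times> real stream"
    by (auto simp: arrival_order_def)
  ultimately show ?thesis by (simp only:)
qed

lemma pred_accepted:
  assumes "v < n" "u < n"
  shows "Measurable.pred AS (\<lambda>\<xi>. accepted (fst \<xi>) (fst (snd \<xi>)) (snd (snd \<xi>)) D v u)"
proof -
  have "Measurable.pred AS (\<lambda>\<xi>. fst \<xi> v = Some u)"
    by (rule measurable_compose[OF sample_space_components(1)[OF assms(1)]]) simp
  moreover have "Measurable.pred AS (\<lambda>\<xi>. fst (snd \<xi>) u < fst (snd \<xi>) v)"
    "Measurable.pred AS (\<lambda>\<xi>. snd (snd \<xi>) !! v < att (excess u v) (fst (snd \<xi>) v))"
    using assms
    by (intro borel_measurable_pred_less sample_space_components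
        measurable_compose[OF sample_space_components(2) borel_measurable_att]; simp)+
  ultimately have "Measurable.pred AS (\<lambda>\<xi>. (fst (snd \<xi>) u < fst (snd \<xi>) v \<and> fst \<xi> v = Some u) \<and>
      snd (snd \<xi>) !! v < att (excess u v) (fst (snd \<xi>) v))"
    by (intro pred_intros_logic)
  thus ?thesis
    unfolding accepted_def revealed_eq_Some_iff
    by (cases "u \<in> nbrs E v"; cases "u \<in> D") simp_all
qed

lemma accepted_less: "accepted F Y \<omega> D v u \<Longrightarrow> u < n"
  using edge_verts[of u v] by (auto simp: accepted_def revealed_eq_Some_iff nbrs_def)

text \<open>The next matching is determined by the arriving vertex \<open>v\<close>, the current
  matching \<open>C\<close> and the set \<open>A\<close> of accepted partners. Each ranges over a
  finite set, so the event is a finite union.\<close>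

lemma pred_run:
  "i \<le> n \<Longrightarrow> Measurable.pred AS (\<lambda>\<xi>. run (fst \<xi>) (fst (snd \<xi>)) (snd (snd \<xi>)) i = B)"
proof (induction i arbitrary: B)
  case 0
  have "run F Y \<omega> 0 = {}" for F Y \<omega> by (simp add: run_def)
  thus ?case by simp
next
  case (Suc i)
  let ?run = "\<lambda>\<xi>. run (fst \<xi>) (fst (snd \<xi>)) (snd (snd \<xi>))"
  let ?acc = "\<lambda>\<xi>. accepted (fst \<xi>) (fst (snd \<xi>)) (snd (snd \<xi>))"
  let ?P = "\<lambda>\<xi>. \<exists>v\<in>{..<n}. \<exists>C\<in>Pow (Pow {..<n}). \<exists>A\<in>Pow {..<n}.
      arrival_order n (fst (snd \<xi>)) ! i = v \<and> ?run \<xi> i = C \<and>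
      (\<forall>u\<in>{..<n}. u \<in> A \<longleftrightarrow> ?acc \<xi> (\<Union>C) v u) \<and> B = C \<union> (\<lambda>u. {u, v}) ` A"
  have "Measurable.pred AS ?P"
    using Suc by (intro pred_intros_finite pred_intros_logic pred_arrival pred_accepted) simp_all
  moreover have "?run \<xi> (Suc i) = B \<longleftrightarrow> ?P \<xi>" for \<xi>
  proof -
    define v where "v = arrival_order n (fst (snd \<xi>)) ! i"
    define C where "C = ?run \<xi> i"
    define A where "A = {u. ?acc \<xi> (\<Union>C) v u}"
    have run: "?run \<xi> (Suc i) = C \<union> (\<lambda>u. {u, v}) ` A"
      using run_Suc[of i] Suc.prems by (auto simp: C_def A_def v_def)
    have mem: "v \<in> {..<n}" "C \<in> Pow (Pow {..<n})" "A \<in> Pow {..<n}"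
      using arrival_order_nth_less[of i n] run_subset[of i] Suc.prems accepted_less
      by (auto simp: v_def C_def A_def)
    show ?thesis
    proof
      assume "?run \<xi> (Suc i) = B"
      thus "?P \<xi>" using mem run
        by (intro bexI[of _ v] bexI[of _ C] bexI[of _ A]) (auto simp: v_def C_def A_def)
    next
      assume "?P \<xi>"
      then obtain A' where "A' \<subseteq> {..<n}" "\<forall>u\<in>{..<n}. u \<in> A' \<longleftrightarrow> ?acc \<xi> (\<Union>C) v u"
        "B = C \<union> (\<lambda>u. {u, v}) ` A'"
        unfolding v_def C_def by auto
      moreover from this have "A' = A" using mem(3) by (auto simp: A_def)
      ultimately show "?run \<xi> (Suc i) = B" using run by simp
    qed
  qed
  ultimately show ?case by (simp only:)
qed

lemma matched_measurable:
  "{\<xi> \<in> space AS. e \<in> rcrs_matching scheme n E x \<xi>} \<in> sets AS"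
proof -
  have "Measurable.pred AS (\<lambda>\<xi>. \<exists>C\<in>Pow (Pow {..<n}).
      run (fst \<xi>) (fst (snd \<xi>)) (snd (snd \<xi>)) n = C \<and> e \<in> C)"
    by (intro pred_intros_finite pred_intros_logic pred_run) auto
  moreover have "e \<in> rcrs_matching scheme n E x \<xi> \<longleftrightarrow> (\<exists>C\<in>Pow (Pow {..<n}).
      run (fst \<xi>) (fst (snd \<xi>)) (snd (snd \<xi>)) n = C \<and> e \<in> C)" for \<xi>
    using run_subset[of n "fst \<xi>" "fst (snd \<xi>)" "snd (snd \<xi>)"]
    by (simp add: run_def rcrs_matching_def)
  ultimately show ?thesis by (simp add: pred_def)
qed

lemma choice_AE: "v < n \<Longrightarrow> AE z in smp v. fst z \<in> insert None (Some ` nbrs E v)"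
proof -
  assume v: "v < n"
  let ?N = "insert None (Some ` nbrs E v)"
  interpret UU: prob_space "unif \<Otimes>\<^sub>M unif" by (intro prob_space_pair unif.prob_space_axioms)
  have "set_pmf (choice_pmf E x v) \<subseteq> ?N"
  proof
    fix a assume "a \<in> set_pmf (choice_pmf E x v)"
    thus "a \<in> ?N"
      using pmf_choice[OF v] by (cases a) (auto simp: set_pmf_iff X_def nbrs_def split: if_splits)
  qed
  hence "emeasure (measure_pmf (choice_pmf E x v)) (- ?N) = 0"
    by (auto simp: measure_pmf_zero_iff measure_pmf.emeasure_eq_measure)
  moreover have "emeasure (smp v) ((- ?N) \<times> UNIV) =
      emeasure (measure_pmf (choice_pmf E x v)) (- ?N) * emeasure (unif \<Otimes>\<^sub>M unif) UNIV"
    unfolding smp_def using sets.top[of "unif \<Otimes>\<^sub>M unif"]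
    by (intro UU.emeasure_pair_measure_Times) (auto simp: space_pair_measure)
  moreover have "(- ?N) \<times> (UNIV :: (real \<times> real) set) \<in> sets (smp v)"
    unfolding smp_def using sets.top[of "unif \<Otimes>\<^sub>M unif"]
    by (intro pair_measureI) (auto simp: space_pair_measure)
  ultimately show ?thesis by (intro AE_I[of _ _ "(- ?N) \<times> UNIV"]) auto
qed

text \<open>Both properties hold almost surely under the product of the vertex laws and are pulled
  back along \<open>samples\<close> by \<open>distr_samples\<close>.\<close>

lemma samples_AE:
  "AE \<xi> in AS. inj_on (fst (snd \<xi>)) {..<n} \<and> (\<forall>v<n. fst \<xi> v \<in> insert None (Some ` nbrs E v))"
proof -
  have "AE \<zeta> in PiM {..<n} smp. \<forall>v\<in>{..<n}. fst (\<zeta> v) \<in> insert None (Some ` nbrs E v)"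
    by (intro AE_finite_allI AE_PiM_component prob_space_smp choice_AE) auto
  with arr_distinct_AE[of "{..<n}"]
  have "AE \<zeta> in PiM {..<n} smp. inj_on (arr \<zeta>) {..<n} \<and>
      (\<forall>v\<in>{..<n}. fst (\<zeta> v) \<in> insert None (Some ` nbrs E v))"
    by auto
  hence "AE \<xi> in AS. inj_on (arr (samples n \<xi>)) {..<n} \<and>
      (\<forall>v\<in>{..<n}. fst (samples n \<xi> v) \<in> insert None (Some ` nbrs E v))"
    by (intro AE_distrD[OF samples_measurable]) (simp only: distr_samples)
  moreover have "inj_on (arr (samples n \<xi>)) {..<n} \<longleftrightarrow> inj_on (fst (snd \<xi>)) {..<n}" for \<xi>
    by (rule inj_on_cong) (auto simp: samples_def case_prod_beta)
  ultimately show ?thesis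
    by (simp add: samples_def case_prod_beta Ball_def)
qed

lemma prob_space_AS: "prob_space AS"
  unfolding sample_space_def
  by (intro prob_space_pair prob_space_PiM prob_space_measure_pmf unif.prob_space_axioms
      unif.prob_space_stream_space)

text \<open>The events \<open>L v u\<close> and \<open>L u v\<close> differ in which endpoint
  arrives later, hence are disjoint. Off a null set each lies in the event that the program selects
  the edge, and \<open>distr_samples\<close> carries their probabilities over from the product
  measure.\<close>

lemma matched_prob_ge:
  assumes "{u, v} \<in> E"
  shows "669/1250 * x {u, v} \<le> measure AS {\<xi> \<in> space AS. {u, v} \<in> rcrs_matching scheme n E x \<xi>}"
proof -
  interpret AS: prob_space AS by (rule prob_space_AS)
  have uv: "u < n" "v < n" "u \<noteq> v" using edge_verts assms by auto
  define L where "L a b = {\<xi> \<in> space AS. late {..<n} (samples n \<xi>) a b 1}" for a b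
  have L_sets: "L a b \<in> sets AS" if "a < n" "b < n" for a b
    using late_measurable[OF _ _ _ samples_measurable, of n b a "\<lambda>_. 1"] that
    by (simp add: L_def pred_def)
  have L: "measure (PiM {..<n} smp) {\<zeta> \<in> space (PiM {..<n} smp). late {..<n} \<zeta> a b 1} = measure AS (L a b)"
    if "a < n" "b < n" for a b
  proof -
    let ?A = "{\<zeta> \<in> space (PiM {..<n} smp). late {..<n} \<zeta> a b 1}"
    have "?A \<in> sets (PiM {..<n} smp)"
      using late_measurable[of "{..<n}" b a "\<lambda>\<zeta>. \<zeta>" "PiM {..<n} smp" "\<lambda>_. 1"] that
      by (simp add: pred_def)
    hence "measure (distr AS (PiM {..<n} smp) (samples n)) ?A = measure AS (samples n -` ?A \<inter> space AS)"
      by (intro measure_distr samples_measurable)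
    moreover have "samples n -` ?A \<inter> space AS = L a b"
      using measurable_space[OF samples_measurable] by (auto simp: L_def)
    ultimately show ?thesis by (simp add: distr_samples)
  qed
  have "AE \<xi> in AS. \<xi> \<in> L v u \<union> L u v \<longrightarrow> \<xi> \<in> {\<xi> \<in> space AS. {u, v} \<in> rcrs_matching scheme n E x \<xi>}"
    using samples_AE
  proof eventually_elim
    case (elim \<xi>)
    obtain F Y \<omega> where \<xi>: "\<xi> = (F, Y, \<omega>)" by (metis prod.exhaust)
    have "{a, b} \<in> rcrs_matching scheme n E x \<xi>" if "\<xi> \<in> L b a" "a < n" "b < n" for a b
      unfolding \<xi>
      by (rule late_imp_matched[of Y F "samples n \<xi>" \<omega> a b 1])
         (use elim that in \<open>auto simp: \<xi> L_def samples_def\<close>)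
    from this[of u v] this[of v u] show ?case
      using uv by (auto simp: L_def insert_commute[of v u])
  qed
  hence "measure AS (L v u \<union> L u v) \<le> measure AS {\<xi> \<in> space AS. {u, v} \<in> rcrs_matching scheme n E x \<xi>}"
    by (intro AS.finite_measure_mono_AE matched_measurable)
  moreover have "measure AS (L v u \<union> L u v) = measure AS (L v u) + measure AS (L u v)"
    using L_sets uv by (intro AS.finite_measure_Union) (auto simp: L_def late_def)
  ultimately show ?thesis
    using late_pair_prob_ge[OF uv] L uv assms by (simp add: X_def)
qed

end

section \<open>The numerical value of the selectability constant\<close>

lemma q_poly_root: "\<exists>t\<ge>119/1000. t \<le> 1199/10000 \<and> q_poly t = 0"
\<comment> \<open>\<open>q_poly\<close> changes sign between the ends. The right end stays below
  \<open>0.12\<close>, which gives the strict upper bound on \<open>t\<^sub>0\<close>.\<close>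
proof (rule IVT')
  show "continuous_on {119/1000..1199/10000} q_poly"
    unfolding q_poly_def[abs_def] by (intro continuous_intros)
qed (simp_all add: q_poly_def power_numeral_even power_numeral_odd)

lemma q_poly_root_unique: "\<exists>!t. 0 < t \<and> t < 1 \<and> q_poly t = 0"
proof -
  obtain t where "119/1000 \<le> t" "t \<le> 1199/10000" "q_poly t = 0" using q_poly_root by blast
  hence t: "0 < t" "t < 1" "q_poly t = 0" by auto
  have less: "q_poly a / a < q_poly b / b" if "0 < a" "a < b" for a b
  proof -
    \<comment> \<open>Dividing by \<open>t\<close> makes the polynomial strictly increasing.\<close>
    define P where "P = (\<lambda>t::real. 4 * t^5 + 16 * t^4 + 100 * t^3 + 180 * t^2 + 80 * t)"
    have "P a < P b"
      unfolding P_def using that by (intro add_strict_mono mult_strict_left_mono power_strict_mono) auto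
    moreover have "- (1 / a) < - (1 / b)" using that by (simp add: frac_less2)
    moreover have "q_poly c / c = P c + - (1 / c) - 4" if "0 < c" for c
      using that by (simp add: q_poly_def P_def field_simps power_numeral_even power_numeral_odd)
    ultimately show ?thesis using that by simp
  qed
  show ?thesis
  proof (rule ex1I[of _ t])
    fix s assume s: "0 < s \<and> s < 1 \<and> q_poly s = 0"
    show "s = t" using less[of s t] less[of t s] s t by (cases s t rule: linorder_cases) auto
  qed (use t in auto)
qed

lemma t\<^sub>0_bounds: "119/1000 \<le> t\<^sub>0" "t\<^sub>0 \<le> 1199/10000"
proof -
  obtain t where t: "119/1000 \<le> t" "t \<le> 1199/10000" "q_poly t = 0"
    using q_poly_root by blast
  moreover have "t\<^sub>0 = t"
    unfolding t\<^sub>0_def using t by (intro the1_equality q_poly_root_unique) auto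
  ultimately show "119/1000 \<le> t\<^sub>0" "t\<^sub>0 \<le> 1199/10000" by auto
qed

text \<open>The terms \<open>5 * t^2\<close> and \<open>- 10 * t^3\<close> move in opposite
  directions, so they are grouped into \<open>f\<close>, which increases on \<open>{0..1/5}\<close>.
  The enclosure of \<open>t\<^sub>0\<close> then passes to \<open>\<beta>\<^sub>0\<close> by
  evaluating at the two ends.\<close>

lemma \<beta>\<^sub>0_bounds: "535/1000 \<le> \<beta>\<^sub>0" "\<beta>\<^sub>0 \<le> 669/1250"
proof -
  note t = t\<^sub>0_bounds
  define f where "f = (\<lambda>t::real. t^2 * (5 - 10 * t))"
  have f: "f a \<le> f b" if "0 \<le> a" "a \<le> b" "b \<le> 1/5" for a b
  proof -
    have "f b - f a = (b - a) * (5 * (a + b) - 10 * (a^2 + a * b + b^2))"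
      by (simp add: f_def algebra_simps power2_eq_square power3_eq_cube)
    moreover have "a^2 + a * b + b^2 \<le> 1/5 * a + 1/5 * b + 1/5 * b"
      using that unfolding power2_eq_square by (intro add_mono mult_right_mono) (auto intro: mult_mono)
    hence "0 \<le> (b - a) * (5 * (a + b) - 10 * (a^2 + a * b + b^2))"
      using that by (intro mult_nonneg_nonneg) auto
    ultimately show ?thesis by linarith
  qed
  have eq: "\<beta>\<^sub>0 = 1/30 * (16 + f t\<^sub>0 + 4 * t\<^sub>0^5)"
    by (simp add: \<beta>\<^sub>0_def f_def algebra_simps power2_eq_square power3_eq_cube)
  have "f (119/1000) \<le> f t\<^sub>0" "f t\<^sub>0 \<le> f (1199/10000)" using f t by auto
  moreover have "(119/1000)^5 \<le> t\<^sub>0^5" "t\<^sub>0^5 \<le> (1199/10000)^5" using t by (auto intro: power_mono)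
  ultimately show "535/1000 \<le> \<beta>\<^sub>0" "\<beta>\<^sub>0 \<le> 669/1250"
    unfolding eq by (auto simp: f_def power_numeral_even power_numeral_odd)
qed

lemma polynomial_time_scheme: "polynomial_time scheme"
proof -
  have "\<exists>p :: nat poly. \<forall>n. poly p n = 6 * n + 20"
    by (intro exI[of _ "[:20, 6:]"]) simp
  then obtain p :: "nat poly" where p: "\<And>n. poly p n = 6 * n + 20" by blast
  show ?thesis
    unfolding polynomial_time_def
  proof (intro conjI exI[of _ p] allI impI)
    show "\<forall>a\<in>constants scheme. algebraic a" using algebraic_constants_scheme by blast
  next
    fix n E and x :: "nat set \<Rightarrow> real" and F Y \<omega> i
    assume "graph n E" "fractional_matching n E x" "i < n"
    then interpret matching_instance n E x by unfold_locales
    show "halts_within scheme (fed_state E F Y (arrival_order n Y ! i)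
        (fst (play scheme n E x (F, Y, \<omega>) i))) (poly p n)"
      unfolding p using \<open>i < n\<close> by (rule scheme_halts)
  qed
qed

lemma selectable_scheme:
  assumes "graph n E" "fractional_matching n E x"
  shows "selectable scheme n E x \<beta>\<^sub>0"
proof -
  interpret matching_instance n E x using assms by unfold_locales
  show ?thesis
    unfolding selectable_def arrival_space_eq
  proof
    fix e assume e: "e \<in> E"
    then obtain u v where uv: "e = {u, v}" using graph by (auto simp: graph_def card_2_iff)
    have "\<beta>\<^sub>0 * x e \<le> 669/1250 * x e"
      using \<beta>\<^sub>0_bounds frac e by (intro mult_right_mono) (auto simp: fractional_matching_def)
    thus "\<beta>\<^sub>0 * x e \<le> measure AS {\<xi> \<in> space AS. e \<in> rcrs_matching scheme n E x \<xi>}"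
      using matched_prob_ge[of u v] e unfolding uv by linarith
  qed
qed

theorem theorem2:
  shows "(\<exists>!t. 0 < t \<and> t < 1 \<and> q_poly t = 0) \<and>
    0.119 \<le> t\<^sub>0 \<and> t\<^sub>0 < 0.120 \<and> 0.535 \<le> \<beta>\<^sub>0 \<and> \<beta>\<^sub>0 < 0.536 \<and>
    (\<exists>c. polynomial_time c \<and>
      (\<forall>n E x. graph n E \<longrightarrow> fractional_matching n E x \<longrightarrow> selectable c n E x \<beta>\<^sub>0))"
proof (intro conjI exI[of _ scheme] allI impI q_poly_root_unique polynomial_time_scheme selectable_scheme)
qed (use t\<^sub>0_bounds \<beta>\<^sub>0_bounds in simp_all)

end
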